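(* Let $X$ be a separable Banach space, let $N_d,K$ be positive integers, $\nu>0$, $\pi_1,\dots,\pi_K\in(0,1)$ with $\sum_{k=1}^K\pi_k=1$, $\zeta_1,\dots,\zeta_K\in\mathbb{C}^{N_d}$, and let $\Sigma_1,\dots,\Sigma_K$ be positive definite Hermitian $N_d\times N_d$ matrices. Let $\mathcal{F}_a:X\to\mathbb{C}^{N_d}$ be a Fréchet differentiable map such that: (1) for every $\epsilon>0$ there are $M=M(\epsilon)\in\mathbb{R}$ and $C\in\mathbb{R}$ such that $\|\mathcal{F}_a(m)\|_2\le C\exp(\epsilon\|m\|_X^2+M)$ for all $m\in X$; (2) for every $\rho>0$ there is a constant $K_\rho>0$ such that $\|\mathcal{F}_a'(m)\|_{op}\le K_\rho$ for all $m\in X$ with $\|m\|_X<\rho$. Let $\mu_0$ be a Gaussian probability measure with $\mu_0(X)=1$, and let $(E,\|\cdot\|_E)$ be the Cameron–Martin space associated to $\mu_0$. Fix $d\in\mathbb{C}^{N_d}$, put $$\Phi(m;d)=\ln\Big\{\sum_{k=1}^K\pi_k\frac{1}{\pi^{N_d}\det(\Sigma_k+\nu I)}\exp\big(-\|d-\mathcal{F}_a(m)-\zeta_k\|^2_{\Sigma_k+\nu I}\big)\Big\},$$ let $\mu$ be the posterior probability measure on $X$ given by $$\frac{d\mu}{d\mu_0}(m)=\frac{1}{Z(d)}\exp(\Phi(m;d)),\qquad Z(d)=\int_X\exp(\Phi(m;d))\,\mu_0(dm),$$ and define $$J(m)=\begin{cases}-\Phi(m;d)+\frac12\|m\|_E^2,&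 m\in E,\\ +\infty,&\text{otherwise.}\end{cases}$$ Then for any $m_1,m_2\in E$, $$\lim_{\delta\to0}\frac{\mu(B(m_1,\delta))}{\mu(B(m_2,\delta))}=\exp\big(J(m_2)-J(m_1)\big).$$
   Context: For a positive definite Hermitian matrix $\Gamma$ and $v\in\mathbb{C}^{N_d}$, $\|v\|_\Gamma^2:=v^H\Gamma^{-1}v$, where $v^H$ is the conjugate transpose. $\|\cdot\|_2$ is the Euclidean ($\ell^2$) norm, $I$ is the identity matrix, and in $\pi^{N_d}$ the symbol $\pi$ is the number $3.14\ldots$ (while $\pi_k$ are the mixture weights). $\mathcal{F}_a'(m)$ is the Fréchet derivative and $\|\cdot\|_{op}$ the operator norm. $B(m,\delta)\subset X$ is the open ball in $X$ with centre $m$ and radius $\delta$ (with respect to $\|\cdot\|_X$).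
   Formalization: The Gaussian measure μ_0 is assumed centred (mean zero); otherwise the claim fails, e.g. for X = ℝ, μ_0 = N(1,1), F_a = 0, where the limit is exp((m_2−1)²/2 − (m_1−1)²/2). *)

theory Defs
  imports "HOL-Probability.Probability"
begin

definition cinner :: "complex ^ 'n \<Rightarrow> complex ^ 'n \<Rightarrow> complex" where
  "cinner v w = (\<Sum>i\<in>UNIV. cnj (v $ i) * w $ i)"

definition hermitian :: "complex ^ 'n ^ 'n \<Rightarrow> bool" where
  "hermitian A \<longleftrightarrow> (\<forall>i j. A $ i $ j = cnj (A $ j $ i))"

(* For Hermitian A the number v^H A v is real, so Re only changes the type. *)
definition positive_definite :: "complex ^ 'n ^ 'n \<Rightarrow> bool" where
  "positive_definite A \<longleftrightarrow> hermitian A \<and> (\<forall>v. v \<noteq> 0 \<longrightarrow> Re (cinner v (A *v v)) > 0)"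

(* The squared weighted norm v^H A^{-1} v; again a real number when A is positive definite. *)
definition weighted_norm_sq :: "complex ^ 'n ^ 'n \<Rightarrow> complex ^ 'n \<Rightarrow> real" where
  "weighted_norm_sq A v = Re (cinner v (matrix_inv A *v v))"

(* Point masses are the degenerate Gaussian laws on the line. *)
definition gaussian_real :: "real measure \<Rightarrow> bool" where
  "gaussian_real P \<longleftrightarrow>
     (\<exists>a. P = return borel a) \<or>
     (\<exists>a s. s > 0 \<and> P = density lborel (\<lambda>x. ennreal (normal_density a s x)))"

definition gaussian_measure :: "'a::real_normed_vector measure \<Rightarrow> bool" where
  "gaussian_measure M \<longleftrightarrow> prob_space M \<and> sets M = sets borel \<and>
     (\<forall>l :: 'a \<Rightarrow> real. bounded_linear l \<longrightarrow> gaussian_real (distr M borel l))"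

definition centred :: "'a::real_normed_vector measure \<Rightarrow> bool" where
  "centred M \<longleftrightarrow> (\<forall>l :: 'a \<Rightarrow> real. bounded_linear l \<longrightarrow> (\<integral>x. l x \<partial>M) = 0)"

(* For a centred Gaussian measure M on X, the functions g are the elements of the closure of the
   dual X* in L^2(M), and h is the mean of x g(x) under M, in the weak sense. The Cameron-Martin
   space is the set of all such h, normed by the L^2 norm of g; this realises inside X the
   completion of the range of the covariance operator of M. *)
definition cameron_martin_rep ::
    "'a::real_normed_vector measure \<Rightarrow> 'a \<Rightarrow> ('a \<Rightarrow> real) \<Rightarrow> bool" where
  "cameron_martin_rep M h g \<longleftrightarrow>
     g \<in> borel_measurable M \<and> integrable M (\<lambda>x. (g x)\<^sup>2) \<and>
     (\<exists>l. (\<forall>n. bounded_linear (l n)) \<and> (\<lambda>n::nat. \<integral>x. (g x - l n x)\<^sup>2 \<partial>M) \<longlonglongrightarrow> 0) \<and>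
     (\<forall>f. bounded_linear f \<longrightarrow> f h = (\<integral>x. f x * g x \<partial>M))"

definition cameron_martin_space :: "'a::real_normed_vector measure \<Rightarrow> 'a set" where
  "cameron_martin_space M = {h. \<exists>g. cameron_martin_rep M h g}"

(* Meaningful on the Cameron-Martin space only; the choice of g does not matter, see
   cameron_martin_norm_eq below. *)
definition cameron_martin_norm :: "'a::real_normed_vector measure \<Rightarrow> 'a \<Rightarrow> real" where
  "cameron_martin_norm M h =
     sqrt (\<integral>x. ((SOME g. cameron_martin_rep M h g) x)\<^sup>2 \<partial>M)"

lemma gaussian_real_integrable_square:
  assumes "gaussian_real P"
  shows "integrable P (\<lambda>x. x\<^sup>2)"
  using assms unfolding gaussian_real_def
proof (elim disjE exE conjE)
  fix a assume P: "P = return borel a"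
  show ?thesis unfolding P
    by (rule integrableI_bounded) (auto simp: nn_integral_return)
next
  fix a s :: real assume s: "s > 0" and P: "P = density lborel (\<lambda>x. ennreal (normal_density a s x))"
  have i: "integrable lborel (\<lambda>x. normal_density a s x * (x - a) ^ k)" for k
    using s by (rule integrable_normal_moment)
  have "integrable lborel (\<lambda>x. normal_density a s x * (x - a) ^ 2
      + 2 * a * (normal_density a s x * (x - a) ^ 1) + a\<^sup>2 * (normal_density a s x * (x - a) ^ 0))"
    by (intro Bochner_Integration.integrable_add integrable_mult_right i)
  also have "(\<lambda>x. normal_density a s x * (x - a) ^ 2
      + 2 * a * (normal_density a s x * (x - a) ^ 1) + a\<^sup>2 * (normal_density a s x * (x - a) ^ 0))
      = (\<lambda>x. normal_density a s x *\<^sub>R x\<^sup>2)"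
    by (auto simp: fun_eq_iff power2_eq_square algebra_simps)
  finally show ?thesis unfolding P
    by (subst integrable_density) auto
qed

lemma gaussian_measure_measurable_functional:
  fixes l :: "'a::real_normed_vector \<Rightarrow> real"
  assumes "gaussian_measure M" and "bounded_linear l"
  shows "l \<in> borel_measurable M"
proof -
  have "l \<in> borel_measurable borel"
    by (intro borel_measurable_continuous_onI linear_continuous_on assms(2))
  then show ?thesis
    using assms(1) unfolding gaussian_measure_def by (metis measurable_cong_sets)
qed

lemma gaussian_measure_integrable_square:
  fixes l :: "'a::real_normed_vector \<Rightarrow> real"
  assumes M: "gaussian_measure M" and l: "bounded_linear l"
  shows "integrable M (\<lambda>x. (l x)\<^sup>2)"
proof -
  have "integrable (distr M borel l) (\<lambda>x. x\<^sup>2)"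
    using M l unfolding gaussian_measure_def by (intro gaussian_real_integrable_square) blast
  then show ?thesis
    by (subst (asm) integrable_distr_eq)
      (auto intro: gaussian_measure_measurable_functional[OF M l])
qed

lemma integrable_mult_square:
  fixes f g :: "'a \<Rightarrow> real"
  assumes "f \<in> borel_measurable M" "g \<in> borel_measurable M"
    and "integrable M (\<lambda>x. (f x)\<^sup>2)" "integrable M (\<lambda>x. (g x)\<^sup>2)"
  shows "integrable M (\<lambda>x. f x * g x)"
proof (rule Bochner_Integration.integrable_bound[where f = "\<lambda>x. (f x)\<^sup>2 + (g x)\<^sup>2"])
  have *: "\<bar>a * b\<bar> \<le> a\<^sup>2 + b\<^sup>2" for a b :: real
  proof -
    have "2 * (\<bar>a\<bar> * \<bar>b\<bar>) \<le> a\<^sup>2 + b\<^sup>2"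
      using sum_squares_bound[of "\<bar>a\<bar>" "\<bar>b\<bar>"] by (simp add: mult.assoc)
    moreover have "0 \<le> \<bar>a\<bar> * \<bar>b\<bar>" by simp
    ultimately show ?thesis unfolding abs_mult by linarith
  qed
  show "AE x in M. norm (f x * g x) \<le> norm ((f x)\<^sup>2 + (g x)\<^sup>2)"
    unfolding real_norm_def
    by (intro AE_I2 order.trans[OF * abs_ge_self])
qed (use assms in auto)

lemma cameron_martin_rep_unique:
  fixes h :: "'a::real_normed_vector"
  assumes M: "gaussian_measure M"
    and g1: "cameron_martin_rep M h g1" and g2: "cameron_martin_rep M h g2"
  shows "AE x in M. g1 x = g2 x"
proof -
  from g1 obtain l1 where
    m1: "g1 \<in> borel_measurable M" and i1: "integrable M (\<lambda>x. (g1 x)\<^sup>2)"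
    and b1: "\<And>n. bounded_linear (l1 n)" and t1: "(\<lambda>n::nat. \<integral>x. (g1 x - l1 n x)\<^sup>2 \<partial>M) \<longlonglongrightarrow> 0"
    and r1: "\<And>f. bounded_linear f \<Longrightarrow> f h = (\<integral>x. f x * g1 x \<partial>M)"
    unfolding cameron_martin_rep_def by blast
  from g2 obtain l2 where
    m2: "g2 \<in> borel_measurable M" and i2: "integrable M (\<lambda>x. (g2 x)\<^sup>2)"
    and b2: "\<And>n. bounded_linear (l2 n)" and t2: "(\<lambda>n::nat. \<integral>x. (g2 x - l2 n x)\<^sup>2 \<partial>M) \<longlonglongrightarrow> 0"
    and r2: "\<And>f. bounded_linear f \<Longrightarrow> f h = (\<integral>x. f x * g2 x \<partial>M)"
    unfolding cameron_martin_rep_def by blast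
  note meas = gaussian_measure_measurable_functional[OF M]
  note sq = gaussian_measure_integrable_square[OF M]
  have sqdiff: "integrable M (\<lambda>x. (f x - g x)\<^sup>2)"
    if "f \<in> borel_measurable M" "g \<in> borel_measurable M"
      "integrable M (\<lambda>x. (f x)\<^sup>2)" "integrable M (\<lambda>x. (g x)\<^sup>2)" for f g :: "'a \<Rightarrow> real"
    unfolding power2_diff using that integrable_mult_square[OF that]
    by (auto simp: mult.assoc)
  define u where "u = (\<lambda>x. g1 x - g2 x)"
  have iu: "integrable M (\<lambda>x. (u x)\<^sup>2)" and mu: "u \<in> borel_measurable M"
    unfolding u_def using sqdiff[OF m1 m2 i1 i2] m1 m2 by auto
  have le: "(\<integral>x. (u x)\<^sup>2 \<partial>M)
      \<le> 2 * (\<integral>x. (g1 x - l1 n x)\<^sup>2 \<partial>M) + 2 * (\<integral>x. (g2 x - l2 n x)\<^sup>2 \<partial>M)" for n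
  proof -
    define p where "p = (\<lambda>x. l1 n x - l2 n x)"
    have p: "bounded_linear p" unfolding p_def by (intro bounded_linear_sub b1 b2)
    have pg1: "integrable M (\<lambda>x. p x * g1 x)" and pg2: "integrable M (\<lambda>x. p x * g2 x)"
      by (intro integrable_mult_square meas p sq m1 m2 i1 i2)+
    have pu: "integrable M (\<lambda>x. p x * u x)" and pu0: "(\<integral>x. p x * u x \<partial>M) = 0"
      using pg1 pg2 r1[OF p] r2[OF p] by (auto simp: u_def right_diff_distrib)
    have d1: "integrable M (\<lambda>x. (g1 x - l1 n x)\<^sup>2)" and d2: "integrable M (\<lambda>x. (g2 x - l2 n x)\<^sup>2)"
      by (intro sqdiff m1 m2 i1 i2 meas sq b1 b2)+
    have pt: "(u x)\<^sup>2 \<le> 2 * (p x * u x) + (2 * (g1 x - l1 n x)\<^sup>2 + 2 * (g2 x - l2 n x)\<^sup>2)" for x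
    proof -
      have "2 * (p x * u x) + (2 * (g1 x - l1 n x)\<^sup>2 + 2 * (g2 x - l2 n x)\<^sup>2) - (u x)\<^sup>2
          = (p x)\<^sup>2 + ((g1 x - l1 n x) + (g2 x - l2 n x))\<^sup>2"
        unfolding p_def u_def by (simp add: power2_eq_square algebra_simps)
      moreover have "0 \<le> (p x)\<^sup>2 + ((g1 x - l1 n x) + (g2 x - l2 n x))\<^sup>2" by simp
      ultimately show ?thesis by linarith
    qed
    have "(\<integral>x. (u x)\<^sup>2 \<partial>M)
        \<le> (\<integral>x. 2 * (p x * u x) + (2 * (g1 x - l1 n x)\<^sup>2 + 2 * (g2 x - l2 n x)\<^sup>2) \<partial>M)"
      by (intro integral_mono iu pt Bochner_Integration.integrable_add integrable_mult_right pu d1 d2)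
    also have "\<dots> = 2 * (\<integral>x. (g1 x - l1 n x)\<^sup>2 \<partial>M) + 2 * (\<integral>x. (g2 x - l2 n x)\<^sup>2 \<partial>M)"
      using pu pu0 d1 d2 by simp
    finally show ?thesis .
  qed
  have "(\<lambda>n. 2 * (\<integral>x. (g1 x - l1 n x)\<^sup>2 \<partial>M) + 2 * (\<integral>x. (g2 x - l2 n x)\<^sup>2 \<partial>M)) \<longlonglongrightarrow> 2 * 0 + 2 * 0"
    by (intro tendsto_intros t1 t2)
  then have "(\<integral>x. (u x)\<^sup>2 \<partial>M) \<le> 0"
    using le by (intro LIMSEQ_le_const) auto
  then have "(\<integral>x. (u x)\<^sup>2 \<partial>M) = 0"
    by (intro antisym integral_nonneg_AE) auto
  then have "AE x in M. (u x)\<^sup>2 = 0"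
    using iu by (subst (asm) integral_nonneg_eq_0_iff_AE) auto
  then show ?thesis
    by eventually_elim (simp add: u_def)
qed

lemma cameron_martin_norm_eq:
  fixes h :: "'a::real_normed_vector"
  assumes M: "gaussian_measure M" and g: "cameron_martin_rep M h g"
  shows "cameron_martin_norm M h = sqrt (\<integral>x. (g x)\<^sup>2 \<partial>M)"
proof -
  define g' where "g' = (SOME g. cameron_martin_rep M h g)"
  have g': "cameron_martin_rep M h g'"
    unfolding g'_def using g by (rule someI[where P = "cameron_martin_rep M h"])
  have "(\<integral>x. (g' x)\<^sup>2 \<partial>M) = (\<integral>x. (g x)\<^sup>2 \<partial>M)"
    by (rule integral_cong_AE)
      (use cameron_martin_rep_unique[OF M g' g] g g' in \<open>auto simp: cameron_martin_rep_def\<close>)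
  then show ?thesis
    unfolding cameron_martin_norm_def g'_def by simp
qed

(* N_d = CARD('n). The determinant of a Hermitian matrix is real, so Re only changes the type. *)
definition log_likelihood ::
    "nat \<Rightarrow> (nat \<Rightarrow> real) \<Rightarrow> (nat \<Rightarrow> complex ^ 'n) \<Rightarrow> (nat \<Rightarrow> complex ^ 'n ^ 'n) \<Rightarrow> real
      \<Rightarrow> ('a \<Rightarrow> complex ^ 'n) \<Rightarrow> complex ^ 'n \<Rightarrow> 'a \<Rightarrow> real" where
  "log_likelihood K w \<zeta> \<Sigma> \<nu> F d m =
     ln (\<Sum>k=1..K. w k
           * (1 / (pi ^ CARD('n) * Re (det (\<Sigma> k + mat (complex_of_real \<nu>)))))
           * exp (- weighted_norm_sq (\<Sigma> k + mat (complex_of_real \<nu>)) (d - F m - \<zeta> k)))"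

definition posterior :: "'a measure \<Rightarrow> ('a \<Rightarrow> real) \<Rightarrow> 'a measure" where
  "posterior M \<Phi> =
     density M (\<lambda>m. ennreal (1 / (\<integral>x. exp (\<Phi> x) \<partial>M) * exp (\<Phi> m)))"

definition onsager_machlup ::
    "'a::real_normed_vector measure \<Rightarrow> ('a \<Rightarrow> real) \<Rightarrow> 'a \<Rightarrow> ereal" where
  "onsager_machlup M \<Phi> m =
     (if m \<in> cameron_martin_space M
      then ereal (- \<Phi> m + 1 / 2 * (cameron_martin_norm M m)\<^sup>2) else \<infinity>)"

end

theory Submission
  imports Defs
begin

text \<open>
  The potential is continuous, so over a small ball the posterior is the prior times a nearly
  constant density, and everything rests on one statement about the prior: for \<open>h\<close> in the
  Cameron--Martin space, with representing function \<open>g\<close>,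
  \<open>\<mu>\<^sub>0 (B(h, \<delta>)) / \<mu>\<^sub>0 (B(0, \<delta>)) \<longlonglongrightarrow> exp (- \<parallel>g\<parallel>\<^sup>2 / 2)\<close>, the norm being that of
  \<open>L\<^sup>2(\<mu>\<^sub>0)\<close> (\<open>shifted_ball_ratio_tendsto\<close>).

  By the Cameron--Martin formula (\<open>cameron_martin_shift\<close>) and the symmetry of \<open>\<mu>\<^sub>0\<close>, the ratio
  is \<open>exp (- \<parallel>g\<parallel>\<^sup>2 / 2)\<close> times the mean of \<open>exp g\<close> over \<open>B(0, \<delta>)\<close>. Again by symmetry this
  mean is also that of \<open>cosh g\<close>, hence at least \<open>1\<close>. For the upper bound write \<open>g = l + r\<close>
  with \<open>l\<close> a continuous linear functional and \<open>r\<close> small in \<open>L\<^sup>2\<close>: on the ball \<open>l\<close> is at most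
  a constant times \<open>\<delta>\<close>, and the mean of \<open>exp r\<close> over the ball is at most
  \<open>exp (\<parallel>r\<parallel>\<^sup>2 / 2)\<close> (\<open>integral_exp_ball_le\<close>). The last bound is Anderson's inequality in
  disguise: weighting by \<open>exp (r - \<parallel>r\<parallel>\<^sup>2 / 2)\<close> translates the measure, and a translated symmetric
  convex set has at most the Gaussian measure of the set itself.

  Anderson's inequality (\<open>anderson\<close>) is reduced to finitely many coordinates, because a ball is
  an intersection of countably many slabs \<open>\<bar>\<phi>\<^sub>i x\<bar> \<le> d\<close>. There a centred Gaussian vector is a
  linear image of independent standard normal variables, and the probability that the vector
  translated by \<open>s c\<close> lies in a symmetric convex set is log-concave in \<open>s\<close> by the
  Prekopa--Leindler inequality, used in one dimension and one coordinate at a time. An even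
  log-concave function is largest at \<open>0\<close>.

  Identities between laws (Cameron--Martin, symmetry, the rotation invariance behind
  \<open>small_ball_pos\<close>) are obtained by comparing characteristic functions. This needs that a
  measure on a separable Banach space is determined by the laws of its continuous linear
  functionals (\<open>borel_measure_eqI_functionals\<close>), which follows from a countable norming family
  supplied by the Hahn--Banach theorem and from the uniqueness of joint laws
  (\<open>joint_law_eqI\<close>). Characteristic functions appear throughout in the real form
  \<open>b \<mapsto> E cos (f + b)\<close>, which carries the same information as \<open>E exp (i f)\<close>.
\<close>

section \<open>Norming functionals\<close>

definition sublinear :: "('a::real_vector \<Rightarrow> real) \<Rightarrow> bool" where
  "sublinear p \<longleftrightarrow> (\<forall>x y. p (x + y) \<le> p x + p y) \<and> (\<forall>t\<ge>0. \<forall>x. p (t *\<^sub>R x) \<le> t * p x)"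

lemma sublinear_add: "sublinear p \<Longrightarrow> p (x + y) \<le> p x + p y"
  and sublinear_scale_le: "sublinear p \<Longrightarrow> 0 \<le> t \<Longrightarrow> p (t *\<^sub>R x) \<le> t * p x"
  by (auto simp: sublinear_def)

lemma sublinear_0: "sublinear p \<Longrightarrow> p 0 = 0"
  using sublinear_add[of p 0 0] sublinear_scale_le[of p 0 0] by simp

lemma sublinear_minus_le: "sublinear p \<Longrightarrow> - p (- x) \<le> p x"
  using sublinear_add[of p x "- x"] by (simp add: sublinear_0)

lemma sublinear_scale:
  assumes p: "sublinear p" and t: "0 \<le> t"
  shows "p (t *\<^sub>R x) = t * p x"
proof (cases "t = 0")
  case False
  with t have "0 < t" by simp
  have "p (inverse t *\<^sub>R (t *\<^sub>R x)) \<le> inverse t * p (t *\<^sub>R x)"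
    by (rule sublinear_scale_le[OF p]) (use t in simp)
  then have "t * p x \<le> p (t *\<^sub>R x)" using \<open>0 < t\<close> by (simp add: field_simps)
  then show ?thesis using sublinear_scale_le[OF p t, of x] by simp
qed (simp add: sublinear_0[OF p])

text \<open>
  Lowers \<open>p\<close> as far as linearity in the direction \<open>- y\<close> demands: the result is sublinear, lies
  below \<open>p\<close>, and its value at \<open>- y\<close> is at most \<open>- p y\<close>. A minimal sublinear functional must
  therefore be odd.
\<close>

definition descent :: "('a::real_vector \<Rightarrow> real) \<Rightarrow> 'a \<Rightarrow> 'a \<Rightarrow> real" where
  "descent p y x = (INF t\<in>{0..}. p (x + t *\<^sub>R y) - t * p y)"

lemma descent_le:
  assumes p: "sublinear p" and t: "0 \<le> t"
  shows "descent p y x \<le> p (x + t *\<^sub>R y) - t * p y"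
  unfolding descent_def
proof (rule cINF_lower[OF bdd_belowI2])
  fix s :: real assume "s \<in> {0..}"
  then have "s * p y = p ((x + s *\<^sub>R y) + (- x))" by (simp add: sublinear_scale[OF p])
  also have "\<dots> \<le> p (x + s *\<^sub>R y) + p (- x)" by (rule sublinear_add[OF p])
  finally show "- p (- x) \<le> p (x + s *\<^sub>R y) - s * p y" by simp
qed (use t in simp)

lemma descent_greatest:
  assumes "\<And>t. 0 \<le> t \<Longrightarrow> c \<le> p (x + t *\<^sub>R y) - t * p y"
  shows "c \<le> descent p y x"
  unfolding descent_def by (rule cINF_greatest) (use assms in auto)

lemma sublinear_descent:
  assumes p: "sublinear p"
  shows "sublinear (descent p y)"
  unfolding sublinear_def
proof safe
  fix a b
  have *: "descent p y (a + b) \<le> (p (a + s *\<^sub>R y) - s * p y) + (p (b + t *\<^sub>R y) - t * p y)"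
    if "0 \<le> s" "0 \<le> t" for s t
  proof -
    have "descent p y (a + b) \<le> p ((a + b) + (s + t) *\<^sub>R y) - (s + t) * p y"
      by (rule descent_le[OF p]) (use that in simp)
    also have "(a + b) + (s + t) *\<^sub>R y = (a + s *\<^sub>R y) + (b + t *\<^sub>R y)"
      by (simp add: algebra_simps)
    finally show ?thesis
      using sublinear_add[OF p, of "a + s *\<^sub>R y" "b + t *\<^sub>R y"] by (simp add: algebra_simps)
  qed
  have "descent p y (a + b) - (p (a + s *\<^sub>R y) - s * p y) \<le> descent p y b" if "0 \<le> s" for s
    by (rule descent_greatest) (use *[OF that] in \<open>simp add: algebra_simps\<close>)
  then have "descent p y (a + b) - descent p y b \<le> descent p y a"
    by (intro descent_greatest) (simp add: algebra_simps)
  then show "descent p y (a + b) \<le> descent p y a + descent p y b" by simp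
next
  fix t :: real and x assume t: "0 \<le> t"
  show "descent p y (t *\<^sub>R x) \<le> t * descent p y x"
  proof (cases "t = 0")
    case True
    then show ?thesis using descent_le[OF p, of 0 y 0] by (simp add: sublinear_0[OF p])
  next
    case False
    with t have "0 < t" by simp
    have "descent p y (t *\<^sub>R x) / t \<le> descent p y x"
    proof (rule descent_greatest)
      fix s :: real assume s: "0 \<le> s"
      have "descent p y (t *\<^sub>R x) \<le> p (t *\<^sub>R x + (t * s) *\<^sub>R y) - (t * s) * p y"
        by (rule descent_le[OF p]) (use s t in simp)
      also have "t *\<^sub>R x + (t * s) *\<^sub>R y = t *\<^sub>R (x + s *\<^sub>R y)" by (simp add: scaleR_add_right)
      finally show "descent p y (t *\<^sub>R x) / t \<le> p (x + s *\<^sub>R y) - s * p y"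
        using \<open>0 < t\<close> unfolding sublinear_scale[OF p t] by (simp add: field_simps del: scaleR_right_distrib)
    qed
    then show ?thesis using \<open>0 < t\<close> by (simp add: field_simps)
  qed
qed

text \<open>
  A minimal sublinear functional below \<open>q\<close> exists by Zorn's lemma, pointwise infima of chains
  being bounded below by \<open>- q (- x)\<close>. It coincides with each of its descents, so it is odd, and
  an odd sublinear functional is linear.
\<close>

theorem hahn_banach_sublinear:
  fixes q :: "'a::real_vector \<Rightarrow> real"
  assumes q: "sublinear q"
  shows "\<exists>f. linear f \<and> (\<forall>x. f x \<le> q x)"
proof -
  define A where "A = {p. sublinear p \<and> p \<le> q}"
  have "\<exists>m\<in>A. \<forall>a\<in>A. a \<le> m \<longrightarrow> a = m"
  proof (rule predicate_Zorn[where P = "\<lambda>p r. r \<le> p"])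
    show "partial_order_on A (relation_of (\<lambda>p r. r \<le> p) A)"
      by (rule partial_order_on_relation_ofI) auto
  next
    fix C assume "C \<in> Chains (relation_of (\<lambda>p r. r \<le> p) A)"
    then have chain: "p \<in> A \<and> (p \<le> r \<or> r \<le> p)" if "p \<in> C" "r \<in> C" for p r
      using that unfolding Chains_def relation_of_def by blast
    have CA: "p \<in> A" if "p \<in> C" for p using chain[OF that that] by simp
    have C: "p \<le> r \<or> r \<le> p" if "p \<in> C" "r \<in> C" for p r using chain[OF that] by simp
    show "\<exists>u\<in>A. \<forall>a\<in>C. u \<le> a"
    proof (cases "C = {}")
      case True
      then show ?thesis using q by (auto simp: A_def)
    next
      case False
      define u where "u x = (INF p\<in>C. p x)" for x
      have sub: "sublinear p" if "p \<in> C" for p using CA[OF that] by (simp add: A_def)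
      have le: "p x \<le> q x" if "p \<in> C" for p x
        using CA[OF that] by (simp add: A_def le_fun_def)
      have lower: "u x \<le> p x" if "p \<in> C" for p x
        unfolding u_def
      proof (rule cINF_lower[OF bdd_belowI2 that])
        fix r assume "r \<in> C"
        show "- q (- x) \<le> r x"
          using sublinear_minus_le[OF sub[OF \<open>r \<in> C\<close>], of x] le[OF \<open>r \<in> C\<close>, of "- x"] by simp
      qed
      have greatest: "c \<le> u x" if "\<And>p. p \<in> C \<Longrightarrow> c \<le> p x" for c x
        unfolding u_def by (rule cINF_greatest) (use False that in auto)
      have "u (x + y) \<le> p x + r y" if "p \<in> C" "r \<in> C" for x y p r
        using C[OF that]
      proof
        assume "p \<le> r"
        have "u (x + y) \<le> p (x + y)" by (rule lower[OF that(1)])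
        also have "\<dots> \<le> p x + p y" by (rule sublinear_add[OF sub[OF that(1)]])
        also have "p y \<le> r y" using \<open>p \<le> r\<close> by (simp add: le_fun_def)
        finally show ?thesis by simp
      next
        assume "r \<le> p"
        have "u (x + y) \<le> r (x + y)" by (rule lower[OF that(2)])
        also have "\<dots> \<le> r x + r y" by (rule sublinear_add[OF sub[OF that(2)]])
        also have "r x \<le> p x" using \<open>r \<le> p\<close> by (simp add: le_fun_def)
        finally show ?thesis by simp
      qed
      note two = this
      have "u (x + y) - p x \<le> u y" if "p \<in> C" for x y p
        by (rule greatest) (use two[OF that] in \<open>simp add: algebra_simps\<close>)
      then have "u (x + y) - u y \<le> u x" for x y
        by (intro greatest) (simp add: algebra_simps)
      then have add: "u (x + y) \<le> u x + u y" for x y by (simp add: algebra_simps)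
      have scale: "u (t *\<^sub>R x) \<le> t * u x" if t: "0 \<le> t" for t x
      proof (cases "t = 0")
        case True
        obtain p where "p \<in> C" using False by auto
        then show ?thesis using lower[of p 0] sublinear_0[OF sub, of p] True by simp
      next
        case False
        with t have "0 < t" by simp
        have "u (t *\<^sub>R x) / t \<le> u x"
        proof (rule greatest)
          fix p assume "p \<in> C"
          then have "u (t *\<^sub>R x) \<le> t * p x"
            using lower[of p "t *\<^sub>R x"] sublinear_scale[OF sub t] by simp
          then show "u (t *\<^sub>R x) / t \<le> p x" using \<open>0 < t\<close> by (simp add: field_simps)
        qed
        then show ?thesis using \<open>0 < t\<close> by (simp add: field_simps)
      qed
      have "u \<in> A"
      proof -
        obtain p where p: "p \<in> C" using False by auto
        have "u x \<le> q x" for x using lower[OF p, of x] le[OF p, of x] by simp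
        then show ?thesis using add scale by (auto simp: A_def sublinear_def le_fun_def)
      qed
      then show ?thesis using lower by (auto simp: le_fun_def)
    qed
  qed
  then obtain m where m: "sublinear m" "m \<le> q" and min: "\<And>a. sublinear a \<Longrightarrow> a \<le> q \<Longrightarrow> a \<le> m \<Longrightarrow> a = m"
    by (auto simp: A_def)
  have odd: "m (- y) = - m y" for y
  proof -
    have "descent m y \<le> m" using descent_le[OF m(1), of 0 y] by (simp add: le_fun_def)
    then have "descent m y = m" using m by (intro min sublinear_descent) auto
    moreover have "descent m y (- y) \<le> m (- y + 1 *\<^sub>R y) - 1 * m y" by (rule descent_le[OF m(1)]) simp
    ultimately have "m (- y) \<le> - m y" by (simp add: sublinear_0[OF m(1)])
    then show ?thesis using sublinear_minus_le[OF m(1), of y] by simp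
  qed
  have "linear m"
  proof
    fix x y
    show "m (x + y) = m x + m y"
      using sublinear_add[OF m(1), of x y] sublinear_add[OF m(1), of "- x" "- y"] odd[of x] odd[of y]
        odd[of "x + y"] by simp
  next
    fix t :: real and x
    show "m (t *\<^sub>R x) = t *\<^sub>R m x"
      using sublinear_scale[OF m(1), of t x] sublinear_scale[OF m(1), of "- t" x] odd[of "t *\<^sub>R x"]
      by (cases "0 \<le> t") auto
  qed
  then show ?thesis using m(2) by (auto simp: le_fun_def)
qed

text \<open>
  Dominating by the descent of the norm at \<open>x0\<close>, instead of by the norm, forces the value
  \<open>norm x0\<close> at \<open>x0\<close>.
\<close>

corollary norming_functional_exists:
  fixes x0 :: "'a::real_normed_vector"
  shows "\<exists>f :: 'a \<Rightarrow> real. bounded_linear f \<and> (\<forall>x. \<bar>f x\<bar> \<le> norm x) \<and> f x0 = norm x0"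
proof -
  have n: "sublinear (norm :: 'a \<Rightarrow> real)"
    by (auto simp: sublinear_def norm_triangle_ineq)
  obtain f where f: "linear f" and le: "\<And>x. f x \<le> descent norm x0 x"
    using hahn_banach_sublinear[OF sublinear_descent[OF n, of x0]] by blast
  have le': "f x \<le> norm x" for x
    using le[of x] descent_le[OF n, of 0 x0 x] by simp
  have abs: "\<bar>f x\<bar> \<le> norm x" for x
    using le'[of x] le'[of "- x"] linear_neg[OF f, of x] by simp
  \<comment> \<open>The choice \<open>t = 1\<close> in the infimum cancels \<open>- x0\<close>.\<close>
  have "f (- x0) \<le> norm (- x0 + 1 *\<^sub>R x0) - 1 * norm x0"
    using le[of "- x0"] descent_le[OF n, of 1 x0 "- x0"] by simp
  then have "norm x0 \<le> f x0" using linear_neg[OF f, of x0] by simp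
  moreover have "bounded_linear f"
    using f abs by (auto intro!: bounded_linear_intro[where K = 1] simp: linear_add linear_scale)
  ultimately show ?thesis using abs le'[of x0] by (intro exI[of _ f]) auto
qed

text \<open>
  It suffices to norm a countable dense set, since the functionals are 1-Lipschitz. The one-sided
  form describes translated balls, the two-sided form exhibits a centred ball as an intersection
  of symmetric slabs.
\<close>

lemma norming_sequence_exists:
  obtains \<phi> :: "nat \<Rightarrow> 'a::{real_normed_vector, second_countable_topology} \<Rightarrow> real"
  where "\<And>i. bounded_linear (\<phi> i)" and "\<And>x r. norm x \<le> r \<longleftrightarrow> (\<forall>i. \<phi> i x \<le> r)"
    and "\<And>x r. norm x \<le> r \<longleftrightarrow> (\<forall>i. \<bar>\<phi> i x\<bar> \<le> r)"
proof -
  obtain D :: "'a set" where D: "countable D" "\<And>X. open X \<Longrightarrow> X \<noteq> {} \<Longrightarrow> \<exists>d\<in>D. d \<in> X"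
    using countable_dense_setE by blast
  then have "D \<noteq> {}" using D(2)[of UNIV] by auto
  define d where "d = from_nat_into D"
  obtain \<phi> :: "'a \<Rightarrow> 'a \<Rightarrow> real" where \<phi>: "\<And>y. bounded_linear (\<phi> y)" "\<And>y x. \<bar>\<phi> y x\<bar> \<le> norm x" "\<And>y. \<phi> y y = norm y"
    using norming_functional_exists by metis
  have up: "norm x \<le> r" if r: "\<And>i. \<phi> (d i) x \<le> r" for x r
  proof (rule field_le_epsilon)
    fix e :: real assume e: "0 < e"
    obtain y where y: "y \<in> D" "y \<in> ball x (e / 2)" using D(2)[of "ball x (e / 2)"] e by auto
    obtain i where i: "y = d i"
      using y(1) D(1) from_nat_into_surj[of D y] unfolding d_def by metis
    have n: "norm (y - x) < e / 2" using y(2) by (simp add: dist_norm norm_minus_commute)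
    have "norm x \<le> norm y + norm (y - x)" using norm_triangle_ineq2[of x y] by (simp add: norm_minus_commute)
    moreover have "norm y = \<phi> y x + \<phi> y (y - x)"
      using \<phi>(3)[of y] linear_diff[OF bounded_linear.linear[OF \<phi>(1)], of y y x] by simp
    moreover have "\<phi> y (y - x) \<le> norm (y - x)" using \<phi>(2)[of y "y - x"] by simp
    ultimately show "norm x \<le> r + e" using n r[of i] i by simp
  qed
  show ?thesis
  proof (rule that[of "\<lambda>i. \<phi> (d i)"])
    show "bounded_linear (\<phi> (d i))" for i by (rule \<phi>)
    show "norm x \<le> r \<longleftrightarrow> (\<forall>i. \<phi> (d i) x \<le> r)" for x r
      using up[of x r] order.trans[OF abs_ge_self order.trans[OF \<phi>(2)]] by blast
    show "norm x \<le> r \<longleftrightarrow> (\<forall>i. \<bar>\<phi> (d i) x\<bar> \<le> r)" for x r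
      using up[of x r] order.trans[OF abs_ge_self] order.trans[OF \<phi>(2)] by blast
  qed
qed

section \<open>Joint laws are determined by their characteristic functions\<close>

text \<open>
  The one-dimensional uniqueness theorem, extended from probability measures to the measures
  obtained by weighting with \<open>p\<close> and \<open>q\<close>. Weights bounded away from \<open>0\<close> can be normalised.
\<close>

lemma weighted_law_eqI:
  fixes f p :: "'a \<Rightarrow> real" and g q :: "'b \<Rightarrow> real"
  assumes "prob_space M" and "prob_space N"
    and f [measurable]: "f \<in> borel_measurable M" and g [measurable]: "g \<in> borel_measurable N"
    and p [measurable]: "p \<in> borel_measurable M" and q [measurable]: "q \<in> borel_measurable N"
    and p_bounds: "\<And>x. 1 \<le> p x" "\<And>x. p x \<le> c" and q_bounds: "\<And>y. 1 \<le> q y" "\<And>y. q y \<le> c"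
    and eq: "\<And>t b. (\<integral>x. p x * cos (t * f x + b) \<partial>M) = (\<integral>y. q y * cos (t * g y + b) \<partial>N)"
    and B [measurable]: "B \<in> sets borel"
  shows "(\<integral>x. p x * indicator B (f x) \<partial>M) = (\<integral>y. q y * indicator B (g y) \<partial>N)"
proof -
  define m where "m = (\<integral>x. p x \<partial>M)"
  have mq: "m = (\<integral>y. q y \<partial>N)" using eq[of 0 0] by (simp add: m_def)
  \<comment> \<open>The phase \<open>- pi / 2\<close> turns the cosine into a sine and so produces the imaginary part.\<close>
  have *: "real_distribution (distr (density P (\<lambda>x. ennreal (r x / m))) borel h) \<and>
      char (distr (density P (\<lambda>x. ennreal (r x / m))) borel h) =
        (\<lambda>t. Complex (\<integral>x. r x * cos (t * h x + 0) \<partial>P) (\<integral>x. r x * cos (t * h x + - pi / 2) \<partial>P) / of_real m) \<and>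
      measure (distr (density P (\<lambda>x. ennreal (r x / m))) borel h) B = (\<integral>x. r x * indicator B (h x) \<partial>P) / m"
    if P: "prob_space P" and [measurable]: "r \<in> borel_measurable P" "h \<in> borel_measurable P"
      and b: "\<And>x. 1 \<le> r x" "\<And>x. r x \<le> c" and m: "m = (\<integral>x. r x \<partial>P)"
    for P :: "'c measure" and r h :: "'c \<Rightarrow> real"
  proof -
    interpret P: prob_space P by fact
    have r0: "0 \<le> r x" for x using b(1)[of x] by simp
    have ir: "integrable P r"
      by (rule P.integrable_const_bound[of _ c]) (use b r0 in auto)
    have int: "integrable P (\<lambda>x. r x * k x)" if [measurable]: "k \<in> borel_measurable P" and "\<And>x. \<bar>k x\<bar> \<le> 1" for k
    proof (rule P.integrable_const_bound[of _ c])
      show "AE x in P. norm (r x * k x) \<le> c"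
      proof (rule AE_I2)
        fix x
        have "r x * \<bar>k x\<bar> \<le> c * 1"
          by (intro mult_mono b that r0) (use b(2)[of x] r0[of x] in auto)
        then show "norm (r x * k x) \<le> c" by (simp add: abs_mult r0)
      qed
    qed measurable
    have "(\<integral>x. 1 \<partial>P) \<le> m" unfolding m by (rule integral_mono) (use ir b in auto)
    then have "1 \<le> m" by (simp add: P.prob_space)
    then have m0: "0 < m" by simp
    interpret D: prob_space "density P (\<lambda>x. ennreal (r x / m))"
    proof
      have "emeasure (density P (\<lambda>x. ennreal (r x / m))) (space P) = (\<integral>\<^sup>+x. ennreal (r x / m) \<partial>P)"
        by (subst emeasure_density) (auto intro!: nn_integral_cong)
      also have "\<dots> = ennreal (\<integral>x. r x / m \<partial>P)"
        by (rule nn_integral_eq_integral) (use ir r0 m0 in auto)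
      also have "\<dots> = 1" using m m0 by simp
      finally show "emeasure (density P (\<lambda>x. ennreal (r x / m))) (space (density P (\<lambda>x. ennreal (r x / m)))) = 1"
        by simp
    qed
    have rd: "real_distribution (distr (density P (\<lambda>x. ennreal (r x / m))) borel h)"
      by (intro real_distribution.intro real_distribution_axioms.intro D.prob_space_distr) auto
    have sw: "(\<integral>x. \<phi> x \<partial>(distr (density P (\<lambda>x. ennreal (r x / m))) borel h)) = (\<integral>x. (r x / m) *\<^sub>R \<phi> (h x) \<partial>P)"
      if [measurable]: "\<phi> \<in> borel_measurable borel" for \<phi> :: "real \<Rightarrow> 'd::{banach, second_countable_topology}"
      using r0 m0 by (subst integral_distr, simp, simp, subst integral_density) auto
    have ch: "char (distr (density P (\<lambda>x. ennreal (r x / m))) borel h) t =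
        Complex (\<integral>x. r x * cos (t * h x + 0) \<partial>P) (\<integral>x. r x * cos (t * h x + - pi / 2) \<partial>P) / of_real m" for t
    proof -
      have "char (distr (density P (\<lambda>x. ennreal (r x / m))) borel h) t = (CLINT x|P. (r x / m) *\<^sub>R iexp (t * h x))"
        unfolding char_def by (rule sw) simp
      also have "(\<lambda>x. (r x / m) *\<^sub>R iexp (t * h x)) =
          (\<lambda>x. (complex_of_real (r x * cos (t * h x)) + \<i> * complex_of_real (r x * sin (t * h x))) / of_real m)"
        by (auto simp: fun_eq_iff complex_eq_iff Re_exp Im_exp)
      also have "(CLINT x|P. (complex_of_real (r x * cos (t * h x)) + \<i> * complex_of_real (r x * sin (t * h x))) / of_real m)
          = (complex_of_real (\<integral>x. r x * cos (t * h x) \<partial>P) + \<i> * complex_of_real (\<integral>x. r x * sin (t * h x) \<partial>P)) / of_real m"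
        using int[of "\<lambda>x. cos (t * h x)"] int[of "\<lambda>x. sin (t * h x)"]
        by (simp del: of_real_mult add: integral_complex_of_real)
      finally show ?thesis by (simp add: complex_eq_iff cos_add cos_diff)
    qed
    have "measure (distr (density P (\<lambda>x. ennreal (r x / m))) borel h) B
        = (\<integral>x. indicator B x \<partial>(distr (density P (\<lambda>x. ennreal (r x / m))) borel h))"
      by simp
    also have "\<dots> = (\<integral>x. (r x / m) *\<^sub>R indicator B (h x) \<partial>P)" by (rule sw) simp
    also have "\<dots> = (\<integral>x. r x * indicator B (h x) \<partial>P) / m" by simp
    finally show ?thesis using rd ch by auto
  qed
  note M = *[OF assms(1) p f p_bounds m_def]
  note N = *[OF assms(2) q g q_bounds mq]
  have "distr (density M (\<lambda>x. ennreal (p x / m))) borel f = distr (density N (\<lambda>x. ennreal (q x / m))) borel g"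
  proof (rule Levy_uniqueness)
    show "char (distr (density M (\<lambda>x. ennreal (p x / m))) borel f) = char (distr (density N (\<lambda>x. ennreal (q x / m))) borel g)"
      unfolding M[THEN conjunct2, THEN conjunct1] N[THEN conjunct2, THEN conjunct1] eq ..
  qed (fact M[THEN conjunct1] N[THEN conjunct1])+
  then have "(\<integral>x. p x * indicator B (f x) \<partial>M) / m = (\<integral>x. q x * indicator B (g x) \<partial>N) / m"
    unfolding M[THEN conjunct2, THEN conjunct2, symmetric] N[THEN conjunct2, THEN conjunct2, symmetric]
    by (rule arg_cong)
  moreover have "m \<noteq> 0"
  proof -
    interpret M: prob_space M by fact
    have "norm (p x) \<le> c" for x using p_bounds[of x] by (simp add: abs_le_iff)
    then have "integrable M p" by (intro M.integrable_const_bound[of _ c]) auto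
    then have "(\<integral>x. 1 \<partial>M) \<le> m" unfolding m_def by (rule integral_mono[rotated]) (use p_bounds in auto)
    then show ?thesis by (simp add: M.prob_space)
  qed
  ultimately show ?thesis by simp
qed

text \<open>
  The indicators of a rectangle are brought in one coordinate at a time. If the integrals of
  \<open>F = (\<Prod>i\<in>L. indicator (B i) (f i)) * cos (\<Sum>a i * f i + b)\<close> are known for all frequencies \<open>a\<close>,
  then so is the characteristic function of \<open>f j\<close> under the positive weight \<open>2 + F\<close>, and the
  one-dimensional uniqueness theorem turns it into the integral of \<open>F * indicator (B j) (f j)\<close>.
\<close>

theorem joint_law_eqI:
  fixes f :: "'i \<Rightarrow> 'a \<Rightarrow> real" and g :: "'i \<Rightarrow> 'b \<Rightarrow> real"
  assumes "prob_space M" and "prob_space N"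
    and f [measurable]: "\<And>i. i \<in> I \<Longrightarrow> f i \<in> borel_measurable M"
    and g [measurable]: "\<And>i. i \<in> I \<Longrightarrow> g i \<in> borel_measurable N"
    and eq: "\<And>J a b. finite J \<Longrightarrow> J \<subseteq> I \<Longrightarrow>
      (\<integral>x. cos ((\<Sum>i\<in>J. a i * f i x) + b) \<partial>M) = (\<integral>y. cos ((\<Sum>i\<in>J. a i * g i y) + b) \<partial>N)"
  shows "distr M (Pi\<^sub>M I (\<lambda>_. borel)) (\<lambda>x. \<lambda>i\<in>I. f i x) = distr N (Pi\<^sub>M I (\<lambda>_. borel)) (\<lambda>y. \<lambda>i\<in>I. g i y)"
proof -
  interpret M: prob_space M by fact
  interpret N: prob_space N by fact
  have mf [measurable]: "(\<lambda>x. \<lambda>i\<in>I. f i x) \<in> measurable M (Pi\<^sub>M I (\<lambda>_. borel))"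
    and mg [measurable]: "(\<lambda>x. \<lambda>i\<in>I. g i x) \<in> measurable N (Pi\<^sub>M I (\<lambda>_. borel))"
    using f g by (auto intro!: measurable_restrict)
  have rect: "(\<integral>x. (\<Prod>i\<in>L. indicator (B i) (f i x)) * cos ((\<Sum>i\<in>J. a i * f i x) + b) \<partial>M)
      = (\<integral>y. (\<Prod>i\<in>L. indicator (B i) (g i y)) * cos ((\<Sum>i\<in>J. a i * g i y) + b) \<partial>N)"
    if J: "finite J" "J \<subseteq> I" and "L \<subseteq> J" and B: "\<And>i. i \<in> L \<Longrightarrow> B i \<in> sets borel" for J L B a b
    using finite_subset[OF \<open>L \<subseteq> J\<close> J(1)] \<open>L \<subseteq> J\<close> B
  proof (induction L arbitrary: a b)
    case empty
    then show ?case using eq[OF J] by simp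
  next
    case (insert j L)
    have j: "j \<in> J" "j \<in> I" and LI: "\<And>i. i \<in> L \<Longrightarrow> i \<in> I" and L: "L \<subseteq> J"
      using insert.prems J by auto
    have Bm [measurable]: "\<And>i. i \<in> L \<Longrightarrow> B i \<in> sets borel" "B j \<in> sets borel" using insert.prems by auto
    have [measurable]: "f j \<in> borel_measurable M" "g j \<in> borel_measurable N" using f g j by auto
    have mS [measurable]: "(\<lambda>x. \<Sum>i\<in>J. a i * f i x) \<in> borel_measurable M" "(\<lambda>x. \<Sum>i\<in>J. a i * g i x) \<in> borel_measurable N" for a
      using J f g by (auto intro!: borel_measurable_sum borel_measurable_times)
    have mL [measurable]: "(\<lambda>x. \<Prod>i\<in>L. indicator (B i) (f i x) :: real) \<in> borel_measurable M"
      "(\<lambda>x. \<Prod>i\<in>L. indicator (B i) (g i x) :: real) \<in> borel_measurable N"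
      using Bm f g LI by (auto intro!: borel_measurable_prod measurable_compose[OF _ borel_measurable_indicator])
    define F where "F x = (\<Prod>i\<in>L. indicator (B i) (f i x)) * cos ((\<Sum>i\<in>J. a i * f i x) + b)" for x
    define G where "G x = (\<Prod>i\<in>L. indicator (B i) (g i x)) * cos ((\<Sum>i\<in>J. a i * g i x) + b)" for x
    have [measurable]: "F \<in> borel_measurable M" "G \<in> borel_measurable N" unfolding F_def G_def by measurable
    have P01: "(\<Prod>i\<in>L. indicator (B i) (h i)) \<in> {0..1::real}" for h :: "'i \<Rightarrow> real"
      by (auto intro!: prod_nonneg prod_le_1 simp: indicator_def)
    have "\<bar>(\<Prod>i\<in>L. indicator (B i) (h i)) * cos z\<bar> \<le> 1" for h :: "'i \<Rightarrow> real" and z :: real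
      using P01[of h] unfolding abs_mult by (intro mult_le_one) auto
    then have F1: "\<bar>F x\<bar> \<le> 1" and G1: "\<bar>G y\<bar> \<le> 1" for x y by (simp_all add: F_def G_def)
    have cosM: "(\<integral>x. cos (t * f j x + c) \<partial>M) = (\<integral>y. cos (t * g j y + c) \<partial>N)" for t c
      using eq[of "{j}" "\<lambda>_. t" c] j by simp
    have iM: "integrable M h" if "h \<in> borel_measurable M" "\<And>x. \<bar>h x\<bar> \<le> 1" for h :: "'a \<Rightarrow> real"
      using that by (intro M.integrable_const_bound[of _ 1]) auto
    have iN: "integrable N h" if "h \<in> borel_measurable N" "\<And>x. \<bar>h x\<bar> \<le> 1" for h :: "'b \<Rightarrow> real"
      using that by (intro N.integrable_const_bound[of _ 1]) auto
    have prod1: "\<bar>u * v\<bar> \<le> 1" if "\<bar>u\<bar> \<le> 1" "\<bar>v\<bar> \<le> 1" for u v :: real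
      using that by (simp add: abs_mult mult_le_one)
    have FG: "(\<integral>x. F x * cos (t * f j x + c) \<partial>M) = (\<integral>y. G y * cos (t * g j y + c) \<partial>N)" for t c
    proof -
      \<comment> \<open>A product of cosines is a half sum of cosines with shifted frequencies at \<open>j\<close>.\<close>
      define a1 where "a1 = a(j := a j + t)"
      define a2 where "a2 = a(j := a j - t)"
      have s: "(\<Sum>i\<in>J. a1 i * h i) = (\<Sum>i\<in>J. a i * h i) + t * h j" "(\<Sum>i\<in>J. a2 i * h i) = (\<Sum>i\<in>J. a i * h i) - t * h j" for h
        using J(1) j(1) by (auto simp: a1_def a2_def sum.remove[of J j] algebra_simps intro!: sum.cong)
      have tr: "cos (X + b) * cos (Y + c) = cos (X + Y + (b + c)) / 2 + cos (X - Y + (b - c)) / 2" for X Y :: real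
        by (simp add: cos_times_cos algebra_simps add_divide_distrib)
      have eF: "F x * cos (t * f j x + c) =
          ((\<Prod>i\<in>L. indicator (B i) (f i x)) * cos ((\<Sum>i\<in>J. a1 i * f i x) + (b + c))) / 2
          + ((\<Prod>i\<in>L. indicator (B i) (f i x)) * cos ((\<Sum>i\<in>J. a2 i * f i x) + (b - c))) / 2" for x
        unfolding F_def s mult.assoc tr by (simp add: algebra_simps)
      have eG: "G x * cos (t * g j x + c) =
          ((\<Prod>i\<in>L. indicator (B i) (g i x)) * cos ((\<Sum>i\<in>J. a1 i * g i x) + (b + c))) / 2
          + ((\<Prod>i\<in>L. indicator (B i) (g i x)) * cos ((\<Sum>i\<in>J. a2 i * g i x) + (b - c))) / 2" for x
        unfolding G_def s mult.assoc tr by (simp add: algebra_simps)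
      have i: "integrable M (\<lambda>x. (\<Prod>i\<in>L. indicator (B i) (f i x)) * cos ((\<Sum>i\<in>J. a i * f i x) + b) :: real)"
         "integrable N (\<lambda>x. (\<Prod>i\<in>L. indicator (B i) (g i x)) * cos ((\<Sum>i\<in>J. a i * g i x) + b) :: real)" for a b
        using P01 by (auto intro!: iM iN prod1)
      show ?thesis unfolding eF eG
        using insert.IH[OF L, of a1 "b + c"] insert.IH[OF L, of a2 "b - c"] Bm(1) i by simp
    qed
    have two: "(\<integral>x. (2 + F x) * indicator (B j) (f j x) \<partial>M) = (\<integral>y. (2 + G y) * indicator (B j) (g j y) \<partial>N)"
    proof (rule weighted_law_eqI[where c = 3])
      fix t c
      have "(\<integral>x. (2 + F x) * cos (t * f j x + c) \<partial>M) = 2 * (\<integral>x. cos (t * f j x + c) \<partial>M) + (\<integral>x. F x * cos (t * f j x + c) \<partial>M)"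
        unfolding distrib_right by (subst Bochner_Integration.integral_add) (auto intro!: integrable_mult_right iM prod1 F1)
      also have "\<dots> = 2 * (\<integral>x. cos (t * g j x + c) \<partial>N) + (\<integral>x. G x * cos (t * g j x + c) \<partial>N)"
        by (simp add: cosM FG)
      also have "\<dots> = (\<integral>x. (2 + G x) * cos (t * g j x + c) \<partial>N)"
        unfolding distrib_right by (subst Bochner_Integration.integral_add) (auto intro!: integrable_mult_right iN prod1 G1)
      finally show "(\<integral>x. (2 + F x) * cos (t * f j x + c) \<partial>M) = (\<integral>x. (2 + G x) * cos (t * g j x + c) \<partial>N)" .
    next
      show "1 \<le> 2 + F x" "2 + F x \<le> 3" for x using F1[of x] by (auto simp: abs_le_iff)
      show "1 \<le> 2 + G x" "2 + G x \<le> 3" for x using G1[of x] by (auto simp: abs_le_iff)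
    qed (use assms(1,2) Bm in auto)
    have one: "(\<integral>x. (1::real) * indicator (B j) (f j x) \<partial>M) = (\<integral>y. (1::real) * indicator (B j) (g j y) \<partial>N)"
      by (rule weighted_law_eqI[where c = 1]) (use assms(1,2) Bm cosM in auto)
    have ind1: "\<bar>indicator S z\<bar> \<le> (1::real)" for S and z :: real by (simp add: indicator_def)
    have sM: "(\<integral>x. (2 + F x) * indicator (B j) (f j x) \<partial>M)
        = 2 * (\<integral>x. 1 * indicator (B j) (f j x) \<partial>M) + (\<integral>x. F x * indicator (B j) (f j x) \<partial>M)"
      unfolding distrib_right mult_1
      by (subst Bochner_Integration.integral_add) (auto intro!: integrable_mult_right iM prod1 F1 ind1 simp del: integrable_mult_right_iff)
    have sN: "(\<integral>x. (2 + G x) * indicator (B j) (g j x) \<partial>N)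
        = 2 * (\<integral>x. 1 * indicator (B j) (g j x) \<partial>N) + (\<integral>x. G x * indicator (B j) (g j x) \<partial>N)"
      unfolding distrib_right mult_1
      by (subst Bochner_Integration.integral_add) (auto intro!: integrable_mult_right iN prod1 G1 ind1 simp del: integrable_mult_right_iff)
    have "(\<integral>x. F x * indicator (B j) (f j x) \<partial>M) = (\<integral>y. G y * indicator (B j) (g j y) \<partial>N)"
      using one two sM sN by linarith
    then show ?case using insert.hyps by (simp add: F_def G_def mult_ac)
  qed
  show ?thesis
  proof (rule measure_eqI_PiM_infinite[where M = "\<lambda>_. borel"])
    show "finite_measure (distr M (Pi\<^sub>M I (\<lambda>_. borel)) (\<lambda>x. \<lambda>i\<in>I. f i x))"
      by (intro prob_space.finite_measure M.prob_space_distr mf)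
    fix B J assume J: "finite J" "J \<subseteq> I" and B: "\<And>i. i \<in> J \<Longrightarrow> B i \<in> sets (borel :: real measure)"
    have *: "emeasure (distr P (Pi\<^sub>M I (\<lambda>_. borel)) (\<lambda>x. \<lambda>i\<in>I. h i x)) (prod_emb I (\<lambda>_. borel) J (Pi\<^sub>E J B))
        = ennreal (\<integral>x. (\<Prod>i\<in>J. indicator (B i) (h i x)) * cos ((\<Sum>i\<in>J. 0 * h i x) + 0) \<partial>P)"
      if P: "prob_space P" and h: "\<And>i. i \<in> I \<Longrightarrow> h i \<in> borel_measurable P" for P :: "'c measure" and h :: "'i \<Rightarrow> 'c \<Rightarrow> real"
    proof -
      interpret P: prob_space P by fact
      have m: "(\<lambda>x. \<lambda>i\<in>I. h i x) \<in> measurable P (Pi\<^sub>M I (\<lambda>_. borel))"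
        using h by (auto intro!: measurable_restrict)
      define S where "S = {x \<in> space P. \<forall>i\<in>J. h i x \<in> B i}"
      have "emeasure (distr P (Pi\<^sub>M I (\<lambda>_. borel)) (\<lambda>x. \<lambda>i\<in>I. h i x)) (prod_emb I (\<lambda>_. borel) J (Pi\<^sub>E J B))
         = emeasure P ((\<lambda>x. \<lambda>i\<in>I. h i x) -` prod_emb I (\<lambda>_. borel) J (Pi\<^sub>E J B) \<inter> space P)"
        by (intro emeasure_distr m sets_PiM_I J) (use B in auto)
      also have "(\<lambda>x. \<lambda>i\<in>I. h i x) -` prod_emb I (\<lambda>_. borel) J (Pi\<^sub>E J B) \<inter> space P = S"
        using J(2) by (auto simp: S_def prod_emb_def PiE_def Pi_def extensional_def)
      also have "emeasure P S = ennreal (\<integral>x. indicator S x \<partial>P)"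
        using P.emeasure_eq_measure[of S] by (simp add: Int_absorb2 S_def)
      also have "(\<integral>x. indicator S x \<partial>P) = (\<integral>x. (\<Prod>i\<in>J. indicator (B i) (h i x)) * cos ((\<Sum>i\<in>J. 0 * h i x) + 0) \<partial>P)"
        using J(1) by (intro Bochner_Integration.integral_cong) (auto simp: S_def indicator_def)
      finally show ?thesis .
    qed
    show "emeasure (distr M (Pi\<^sub>M I (\<lambda>_. borel)) (\<lambda>x. \<lambda>i\<in>I. f i x)) (prod_emb I (\<lambda>_. borel) J (Pi\<^sub>E J B))
      = emeasure (distr N (Pi\<^sub>M I (\<lambda>_. borel)) (\<lambda>y. \<lambda>i\<in>I. g i y)) (prod_emb I (\<lambda>_. borel) J (Pi\<^sub>E J B))"
      using *[OF assms(1) f] *[OF assms(2) g] rect[OF J order.refl, of B "\<lambda>_. 0" 0] B by simp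
  qed auto
qed

text \<open>
  A norming sequence embeds the space into a countable product of lines, and the Borel sets are
  exactly the preimages of measurable sets of the product: every ball is such a preimage, and
  every open set is a countable union of balls.
\<close>

theorem borel_measure_eqI_functionals:
  fixes M N :: "'a::{real_normed_vector, second_countable_topology} measure"
  assumes "prob_space M" and "prob_space N" and sM: "sets M = sets borel" and sN: "sets N = sets borel"
    and eq: "\<And>(l :: 'a \<Rightarrow> real) b. bounded_linear l \<Longrightarrow> (\<integral>x. cos (l x + b) \<partial>M) = (\<integral>x. cos (l x + b) \<partial>N)"
  shows "M = N"
proof -
  obtain \<phi> :: "nat \<Rightarrow> 'a \<Rightarrow> real" where \<phi>: "\<And>i. bounded_linear (\<phi> i)"
    and norming: "\<And>x r. norm x \<le> r \<longleftrightarrow> (\<forall>i. \<phi> i x \<le> r)"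
    using norming_sequence_exists by metis
  define P :: "(nat \<Rightarrow> real) measure" where "P = Pi\<^sub>M UNIV (\<lambda>_. borel)"
  define \<Lambda> where "\<Lambda> = (\<lambda>x. \<lambda>i\<in>UNIV. \<phi> i x)"
  have \<phi>m [measurable]: "\<phi> i \<in> borel_measurable borel" for i
    by (intro borel_measurable_continuous_onI linear_continuous_on \<phi>)
  have mM: "\<phi> i \<in> borel_measurable M" and mN: "\<phi> i \<in> borel_measurable N" for i
    by (simp_all add: measurable_cong_sets[OF sM refl] measurable_cong_sets[OF sN refl])
  have \<Lambda>: "\<Lambda> \<in> measurable borel P" unfolding \<Lambda>_def P_def by (intro measurable_restrict \<phi>m)
  have \<Lambda>M: "\<Lambda> \<in> measurable M P" and \<Lambda>N: "\<Lambda> \<in> measurable N P"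
    using \<Lambda> by (simp_all add: measurable_cong_sets[OF sM refl] measurable_cong_sets[OF sN refl])
  have law: "distr M P \<Lambda> = distr N P \<Lambda>"
    unfolding P_def \<Lambda>_def
  proof (rule joint_law_eqI[OF assms(1,2)])
    fix J :: "nat set" and a b assume "finite J"
    show "(\<integral>x. cos ((\<Sum>i\<in>J. a i * \<phi> i x) + b) \<partial>M) = (\<integral>x. cos ((\<Sum>i\<in>J. a i * \<phi> i x) + b) \<partial>N)"
      by (rule eq[of "\<lambda>x. \<Sum>i\<in>J. a i * \<phi> i x"]) (intro bounded_linear_sum bounded_linear_const_mult \<phi>)
  qed (use mM mN in auto)
  define V where "V = vimage_algebra UNIV \<Lambda> P"
  have [simp]: "space V = UNIV" by (simp add: V_def)
  have sets_V: "sets V = {\<Lambda> -` S \<inter> UNIV | S. S \<in> sets P}"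
    unfolding V_def by (rule sets_vimage_algebra2) (auto simp: P_def space_PiM)
  have "\<Lambda> \<in> measurable V P" unfolding V_def by (rule measurable_vimage_algebra1) (auto simp: P_def space_PiM)
  then have "(\<lambda>x. \<Lambda> x i) \<in> borel_measurable V" for i
    unfolding P_def by (rule measurable_compose) (rule measurable_component_singleton, simp)
  then have \<phi>V [measurable]: "\<phi> i \<in> borel_measurable V" for i by (simp add: \<Lambda>_def)
  have nV: "(\<lambda>x. norm (x - c)) \<in> borel_measurable V" for c
    unfolding borel_measurable_iff_le
  proof safe
    fix s
    have "{x \<in> space V. norm (x - c) \<le> s} = {x \<in> space V. \<forall>i. \<phi> i x - \<phi> i c \<le> s}"
      by (simp add: norming linear_diff[OF bounded_linear.linear[OF \<phi>]])
    also have "\<dots> \<in> sets V" by measurable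
    finally show "{x \<in> space V. norm (x - c) \<le> s} \<in> sets V" .
  qed
  have ballV: "ball c r \<in> sets V" for c r
  proof -
    have "{x \<in> space V. norm (x - c) < r} \<in> sets V" using nV[of c] by measurable
    also have "{x \<in> space V. norm (x - c) < r} = ball c r" by (auto simp: dist_norm norm_minus_commute)
    finally show ?thesis .
  qed
  have openV: "U \<in> sets V" if "open U" for U
  proof -
    define F where "F = {ball c r |c r. ball c r \<subseteq> U}"
    have "\<And>S. S \<in> F \<Longrightarrow> open S" by (auto simp: F_def)
    then obtain F' where F': "F' \<subseteq> F" "countable F'" "\<Union>F' = \<Union>F" using Lindelof[of F] by metis
    have "\<Union>F = U"
    proof
      show "U \<subseteq> \<Union>F"
      proof
        fix x assume "x \<in> U"
        then obtain r where "0 < r" "ball x r \<subseteq> U" using \<open>open U\<close> unfolding open_contains_ball by blast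
        then have "ball x r \<in> F" "x \<in> ball x r" by (auto simp: F_def)
        then show "x \<in> \<Union>F" by blast
      qed
    qed (auto simp: F_def)
    moreover have "\<Union>F' \<in> sets V"
      using F' by (intro sets.countable_Union) (auto simp: F_def ballV)
    ultimately show ?thesis using F' by simp
  qed
  show ?thesis
  proof (rule measure_eqI)
    fix A assume "A \<in> sets M"
    then have "A \<in> sigma_sets UNIV {S. open S}" by (simp add: sM borel_def)
    then have "A \<in> sets V"
      using sets.sigma_sets_subset[of "{S. open S}" V] openV by auto
    then obtain S where S: "S \<in> sets P" "A = \<Lambda> -` S"
      unfolding sets_V by auto
    have "emeasure (distr M P \<Lambda>) S = emeasure M A" "emeasure (distr N P \<Lambda>) S = emeasure N A"
      using S sets_eq_imp_space_eq[OF sM] sets_eq_imp_space_eq[OF sN]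
      by (simp_all add: emeasure_distr \<Lambda>M \<Lambda>N)
    then show "emeasure M A = emeasure N A" by (simp add: law)
  qed (simp add: sM sN)
qed

section \<open>Gaussian families\<close>

text \<open>
  Cholesky factorisation by induction on the Schur complement. In terms of random variables the
  matrix \<open>A\<close> expresses a Gaussian vector with covariance \<open>C\<close> through independent standard normal
  variables; \<open>C\<close> may be singular.
\<close>

lemma gram_factorization:
  fixes C :: "nat \<Rightarrow> nat \<Rightarrow> real"
  assumes sym: "\<And>i j. C i j = C j i"
    and psd: "\<And>x. 0 \<le> (\<Sum>i<n. \<Sum>j<n. x i * x j * C i j)"
  shows "\<exists>A. \<forall>i<n. \<forall>k<n. C i k = (\<Sum>j<n. A i j * A k j)"
  using assms
proof (induction n arbitrary: C)
  case 0
  then show ?case by simp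
next
  case (Suc n)
  define c where "c = C n n"
  have quad: "(\<Sum>i<Suc n. \<Sum>j<Suc n. x i * x j * C i j)
      = (\<Sum>i<n. \<Sum>j<n. x i * x j * C i j) + 2 * x n * (\<Sum>i<n. x i * C i n) + (x n)\<^sup>2 * c" for x
    using Suc.prems(1)
    by (simp add: sum.distrib sum_distrib_left algebra_simps power2_eq_square c_def)
  have c0: "0 \<le> c" using Suc.prems(2)[of "\<lambda>i. if i = n then 1 else 0"] by (simp add: quad c_def)
  \<comment> \<open>The Schur complement of the last diagonal entry; when \<open>c = 0\<close> the division yields \<open>0\<close>.\<close>
  define D where "D i j = C i j - C i n * C j n / c" for i j
  have Dsym: "D i j = D j i" for i j using Suc.prems(1) by (simp add: D_def mult.commute)
  have Dpsd: "0 \<le> (\<Sum>i<n. \<Sum>j<n. x i * x j * D i j)" for x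
  proof -
    define s where "s = (\<Sum>i<n. x i * C i n)"
    have ss: "(\<Sum>i<n. \<Sum>j<n. x i * x j * (C i n * C j n / c)) = s\<^sup>2 / c"
      unfolding s_def power2_eq_square sum_product sum_divide_distrib by (simp add: mult_ac)
    have "(\<Sum>i<n. \<Sum>j<n. x i * x j * D i j) = (\<Sum>i<n. \<Sum>j<n. x i * x j * C i j) - s\<^sup>2 / c"
      unfolding ss[symmetric] D_def by (simp add: right_diff_distrib sum_subtractf)
    moreover have "0 \<le> (\<Sum>i<n. \<Sum>j<n. x i * x j * C i j) + 2 * y * s + y\<^sup>2 * c" for y
      using Suc.prems(2)[of "x(n := y)"] unfolding quad by (simp add: s_def)
    from this[of "- s / c"] have "0 \<le> (\<Sum>i<n. \<Sum>j<n. x i * x j * C i j) - s\<^sup>2 / c"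
      by (cases "c = 0") (simp_all add: field_simps power2_eq_square)
    ultimately show ?thesis by simp
  qed
  have zero: "C i n = 0" if "c = 0" "i < n" for i
  proof (rule ccontr)
    assume nz: "C i n \<noteq> 0"
    \<comment> \<open>The quadratic form takes the value \<open>- 1\<close> at this vector.\<close>
    define x where "x = (\<lambda>k. if k = i then 1 else if k = n then - (C i i + 1) / (2 * C i n) else (0::real))"
    have "(\<Sum>k<n. x k * C k n) = (\<Sum>k<n. if k = i then C i n else 0)"
      using that by (intro sum.cong) (auto simp: x_def)
    then have 1: "(\<Sum>k<n. x k * C k n) = C i n" using that by simp
    have "(\<Sum>k<n. \<Sum>j<n. x k * x j * C k j) = (\<Sum>k<n. \<Sum>j<n. if k = i then if j = i then C i i else 0 else 0)"
      using that by (intro sum.cong) (auto simp: x_def)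
    also have "\<dots> = (\<Sum>k<n. if k = i then C i i else 0)" using that by (intro sum.cong) auto
    finally have 2: "(\<Sum>k<n. \<Sum>j<n. x k * x j * C k j) = C i i" using that by simp
    have "0 \<le> C i i + 2 * x n * C i n + (x n)\<^sup>2 * c" using Suc.prems(2)[of x] unfolding quad 1 2 .
    then show False using that nz by (simp add: x_def field_simps)
  qed
  obtain A where A: "\<And>i k. i < n \<Longrightarrow> k < n \<Longrightarrow> D i k = (\<Sum>j<n. A i j * A k j)"
    using Suc.IH[OF Dsym Dpsd] by blast
  define B where "B i j = (if j = n then C i n / sqrt c else if i = n then 0 else A i j)" for i j
  have "C i k = (\<Sum>j<Suc n. B i j * B k j)" if "i < Suc n" "k < Suc n" for i k
  proof -
    have cc: "C i n / sqrt c * (C k n / sqrt c) = C i n * C k n / c" using c0 by simp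
    have "(\<Sum>j<n. B i j * B k j) = (if i = n \<or> k = n then 0 else D i k)"
      using that A[of i k] by (auto simp: B_def intro!: sum.cong)
    moreover have "B i n * B k n = C i n * C k n / c" using cc by (simp add: B_def)
    ultimately show ?thesis
      using that zero[of i] zero[of k] Suc.prems(1)[of n k] by (cases "c = 0") (auto simp: D_def c_def less_Suc_eq)
  qed
  then show ?case by blast
qed

abbreviation "stdN \<equiv> (density lborel (\<lambda>x. ennreal (std_normal_density x)) :: real measure)"

lemma prob_space_stdN: "prob_space stdN"
  using real_dist_normal_dist by (simp add: real_distribution_def)

lemma integral_cos_stdN: "(\<integral>t. cos (s * t + b) \<partial>stdN) = exp (- s\<^sup>2 / 2) * cos b"
proof -
  interpret prob_space stdN by (rule prob_space_stdN)
  have i: "integrable stdN (\<lambda>t. iexp (s * t))"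
    by (rule integrable_const_bound[of _ 1]) auto
  have "Re (char stdN s) = (\<integral>t. cos (s * t) \<partial>stdN)" "Im (char stdN s) = (\<integral>t. sin (s * t) \<partial>stdN)"
    unfolding char_def using integral_Re[OF i] integral_Im[OF i] by (simp_all add: Re_exp Im_exp)
  then have c: "(\<integral>t. cos (s * t) \<partial>stdN) = exp (- s\<^sup>2 / 2)" and s: "(\<integral>t. sin (s * t) \<partial>stdN) = 0"
    by (simp_all add: char_std_normal_distribution)
  have "integrable stdN (\<lambda>t. cos (s * t))" "integrable stdN (\<lambda>t. sin (s * t))"
    by (rule integrable_const_bound[of _ 1]; simp)+
  then show ?thesis using c s by (simp add: cos_add)
qed

lemma std_normal_density_exp: "std_normal_density t * exp (c * t) = exp (c\<^sup>2 / 2) * normal_density c 1 t"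
  by (simp add: normal_density_def exp_add[symmetric] power2_eq_square field_simps)

lemma integrable_exp_stdN: "integrable stdN (\<lambda>t. exp (c * t))"
  by (subst integrable_density) (auto simp: std_normal_density_exp)

text \<open>
  The factor \<open>exp (c * t)\<close> translates the standard normal density by \<open>c\<close>.
\<close>

lemma integral_exp_cos_stdN:
  "(\<integral>t. exp (c * t) * cos (s * t + b) \<partial>stdN) = exp ((c\<^sup>2 - s\<^sup>2) / 2) * cos (s * c + b)"
proof -
  have "(\<integral>t. exp (c * t) * cos (s * t + b) \<partial>stdN) = (\<integral>t. std_normal_density t * exp (c * t) * cos (s * t + b) \<partial>lborel)"
    by (subst integral_density) (auto simp: mult.assoc)
  also have "\<dots> = exp (c\<^sup>2 / 2) * (\<integral>t. normal_density c 1 t * cos (s * t + b) \<partial>lborel)"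
    by (simp add: std_normal_density_exp mult.assoc)
  also have "(\<integral>t. normal_density c 1 t * cos (s * t + b) \<partial>lborel)
      = (\<integral>t. std_normal_density t * cos (s * t + (s * c + b)) \<partial>lborel)"
    by (subst lborel_integral_real_affine[of 1 _ c]) (simp_all add: normal_density_def algebra_simps)
  also have "\<dots> = (\<integral>t. cos (s * t + (s * c + b)) \<partial>stdN)"
    by (subst integral_density) auto
  also have "\<dots> = exp (- s\<^sup>2 / 2) * cos (s * c + b)" by (rule integral_cos_stdN)
  finally show ?thesis by (simp add: exp_add[symmetric] diff_divide_distrib mult.assoc[symmetric])
qed

lemma linear_form_measurable [measurable]:
  "J \<subseteq> I \<Longrightarrow> (\<lambda>\<xi>. \<Sum>i\<in>J. c i * \<xi> i) \<in> borel_measurable (Pi\<^sub>M I (\<lambda>_. stdN))"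
proof (intro borel_measurable_sum borel_measurable_times borel_measurable_const)
  fix i assume "J \<subseteq> I" "i \<in> J"
  then have "(\<lambda>\<xi>. \<xi> i) \<in> measurable (Pi\<^sub>M I (\<lambda>_. stdN)) stdN"
    by (intro measurable_component_singleton) auto
  then show "(\<lambda>\<xi>. \<xi> i) \<in> borel_measurable (Pi\<^sub>M I (\<lambda>_. stdN))" by (simp cong: measurable_cong_sets)
qed

lemma integral_exp_cos_product:
  assumes "finite I"
  shows "integrable (Pi\<^sub>M I (\<lambda>_. stdN)) (\<lambda>\<xi>. exp (\<Sum>i\<in>I. c i * \<xi> i))" (is "integrable _ ?E")
    and "(\<integral>\<xi>. exp (\<Sum>i\<in>I. c i * \<xi> i) * cos ((\<Sum>i\<in>I. s i * \<xi> i) + b) \<partial>Pi\<^sub>M I (\<lambda>_. stdN))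
      = exp ((\<Sum>i\<in>I. (c i)\<^sup>2 - (s i)\<^sup>2) / 2) * cos ((\<Sum>i\<in>I. s i * c i) + b)"
proof -
  interpret N: prob_space stdN by (rule prob_space_stdN)
  interpret product_sigma_finite "\<lambda>_. stdN" by standard
  have int: "integrable (Pi\<^sub>M I (\<lambda>_. stdN)) (\<lambda>\<xi>. exp (\<Sum>i\<in>I. c i * \<xi> i))" if "finite I" for I
    using product_integrable_prod[OF that, of "\<lambda>i t. exp (c i * t)"] integrable_exp_stdN that
    by (simp add: exp_sum)
  show "integrable (Pi\<^sub>M I (\<lambda>_. stdN)) ?E" by (rule int[OF assms])
  show "(\<integral>\<xi>. exp (\<Sum>i\<in>I. c i * \<xi> i) * cos ((\<Sum>i\<in>I. s i * \<xi> i) + b) \<partial>Pi\<^sub>M I (\<lambda>_. stdN))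
      = exp ((\<Sum>i\<in>I. (c i)\<^sup>2 - (s i)\<^sup>2) / 2) * cos ((\<Sum>i\<in>I. s i * c i) + b)"
    using assms
  proof (induction I arbitrary: b)
    case empty
    then show ?case by (simp add: PiM_empty)
  next
    case (insert j I)
    have "integrable (Pi\<^sub>M (insert j I) (\<lambda>_. stdN)) (\<lambda>\<xi>. exp (\<Sum>i\<in>insert j I. c i * \<xi> i) * cos ((\<Sum>i\<in>insert j I. s i * \<xi> i) + b))"
    proof (rule Bochner_Integration.integrable_bound[OF int])
      show "AE \<xi> in Pi\<^sub>M (insert j I) (\<lambda>_. stdN). norm (exp (\<Sum>i\<in>insert j I. c i * \<xi> i) * cos ((\<Sum>i\<in>insert j I. s i * \<xi> i) + b))
          \<le> norm (exp (\<Sum>i\<in>insert j I. c i * \<xi> i))"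
        by (simp add: abs_mult mult_left_le)
    qed (use insert.hyps in simp, measurable)
    then have "(\<integral>\<xi>. exp (\<Sum>i\<in>insert j I. c i * \<xi> i) * cos ((\<Sum>i\<in>insert j I. s i * \<xi> i) + b) \<partial>Pi\<^sub>M (insert j I) (\<lambda>_. stdN))
      = (\<integral>\<xi>. (\<integral>t. exp (\<Sum>i\<in>insert j I. c i * (\<xi>(j := t)) i) * cos ((\<Sum>i\<in>insert j I. s i * (\<xi>(j := t)) i) + b) \<partial>stdN) \<partial>Pi\<^sub>M I (\<lambda>_. stdN))"
      by (rule product_integral_insert[OF insert.hyps])
    also have "\<dots> = (\<integral>\<xi>. exp (((c j)\<^sup>2 - (s j)\<^sup>2) / 2) * (exp (\<Sum>i\<in>I. c i * \<xi> i) * cos ((\<Sum>i\<in>I. s i * \<xi> i) + (s j * c j + b))) \<partial>Pi\<^sub>M I (\<lambda>_. stdN))"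
    proof (intro Bochner_Integration.integral_cong refl)
      fix \<xi> :: "'a \<Rightarrow> real"
      have e: "(\<Sum>i\<in>insert j I. d i * (\<xi>(j := t)) i) = d j * t + (\<Sum>i\<in>I. d i * \<xi> i)" for d t
        using insert.hyps by (auto intro!: sum.cong)
      have "(\<integral>t. exp (\<Sum>i\<in>insert j I. c i * (\<xi>(j := t)) i) * cos ((\<Sum>i\<in>insert j I. s i * (\<xi>(j := t)) i) + b) \<partial>stdN)
        = (\<integral>t. exp (\<Sum>i\<in>I. c i * \<xi> i) * (exp (c j * t) * cos (s j * t + ((\<Sum>i\<in>I. s i * \<xi> i) + b))) \<partial>stdN)"
        unfolding e by (simp add: exp_add mult_ac add_ac)
      also have "\<dots> = exp (((c j)\<^sup>2 - (s j)\<^sup>2) / 2) * (exp (\<Sum>i\<in>I. c i * \<xi> i) * cos ((\<Sum>i\<in>I. s i * \<xi> i) + (s j * c j + b)))"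
        by (subst integral_mult_right_zero, subst integral_exp_cos_stdN) (simp add: add_ac)
      finally show "(\<integral>t. exp (\<Sum>i\<in>insert j I. c i * (\<xi>(j := t)) i) * cos ((\<Sum>i\<in>insert j I. s i * (\<xi>(j := t)) i) + b) \<partial>stdN)
        = exp (((c j)\<^sup>2 - (s j)\<^sup>2) / 2) * (exp (\<Sum>i\<in>I. c i * \<xi> i) * cos ((\<Sum>i\<in>I. s i * \<xi> i) + (s j * c j + b)))" .
    qed
    also have "\<dots> = exp ((\<Sum>i\<in>insert j I. (c i)\<^sup>2 - (s i)\<^sup>2) / 2) * cos ((\<Sum>i\<in>insert j I. s i * c i) + b)"
      unfolding integral_mult_right_zero insert.IH using insert.hyps
      by (simp add: exp_add[symmetric] add_divide_distrib add_ac mult.assoc[symmetric])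
    finally show ?case .
  qed
qed

text \<open>
  A Gaussian Hilbert space without the completeness requirement: a linear space of square
  integrable functions each of which is centred normal, expressed by its characteristic function.
  Linearity makes every finite family in \<open>H\<close> jointly Gaussian.
\<close>

locale gaussian_space = prob_space M for M :: "'a measure" +
  fixes H :: "('a \<Rightarrow> real) set"
  assumes meas: "f \<in> H \<Longrightarrow> f \<in> borel_measurable M"
    and square_integrable: "f \<in> H \<Longrightarrow> integrable M (\<lambda>x. (f x)\<^sup>2)"
    and zero_mem: "(\<lambda>_. 0) \<in> H"
    and add_mem: "f \<in> H \<Longrightarrow> g \<in> H \<Longrightarrow> (\<lambda>x. f x + g x) \<in> H"
    and scale_mem: "f \<in> H \<Longrightarrow> (\<lambda>x. a * f x) \<in> H"
    and integral_cos: "f \<in> H \<Longrightarrow> (\<integral>x. cos (f x + b) \<partial>M) = exp (- (\<integral>x. (f x)\<^sup>2 \<partial>M) / 2) * cos b"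
begin

lemma sum_mem:
  assumes "finite J" "\<And>i. i \<in> J \<Longrightarrow> f i \<in> H"
  shows "(\<lambda>x. \<Sum>i\<in>J. a i * f i x) \<in> H"
  using assms by (induction J) (auto simp: zero_mem intro!: add_mem scale_mem)

lemma mult_integrable: "f \<in> H \<Longrightarrow> g \<in> H \<Longrightarrow> integrable M (\<lambda>x. f x * g x)"
  by (intro integrable_mult_square meas square_integrable)

lemma integral_square_sum:
  assumes "finite J" "\<And>i. i \<in> J \<Longrightarrow> f i \<in> H"
  shows "(\<integral>x. (\<Sum>i\<in>J. a i * f i x)\<^sup>2 \<partial>M) = (\<Sum>i\<in>J. \<Sum>k\<in>J. a i * a k * (\<integral>x. f i x * f k x \<partial>M))"
proof -
  have "(\<integral>x. (\<Sum>i\<in>J. a i * f i x)\<^sup>2 \<partial>M) = (\<integral>x. (\<Sum>i\<in>J. \<Sum>k\<in>J. a i * a k * (f i x * f k x)) \<partial>M)"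
    by (simp add: power2_eq_square sum_product mult_ac)
  also have "\<dots> = (\<Sum>i\<in>J. \<Sum>k\<in>J. a i * a k * (\<integral>x. f i x * f k x \<partial>M))"
    using assms by (simp add: mult_integrable)
  finally show ?thesis .
qed

text \<open>
  Both sides have the same characteristic function, because this function depends on the
  covariances only and the factorisation reproduces them.
\<close>

lemma law_linear_image_std_normal:
  fixes f :: "nat \<Rightarrow> 'a \<Rightarrow> real"
  assumes f: "\<And>i. i < n \<Longrightarrow> f i \<in> H"
  obtains A where "\<And>i k. i < n \<Longrightarrow> k < n \<Longrightarrow> (\<integral>x. f i x * f k x \<partial>M) = (\<Sum>j<n. A i j * A k j)"
    and "distr M (Pi\<^sub>M {..<n} (\<lambda>_. borel)) (\<lambda>x. \<lambda>i\<in>{..<n}. f i x)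
      = distr (Pi\<^sub>M {..<n} (\<lambda>_. stdN)) (Pi\<^sub>M {..<n} (\<lambda>_. borel)) (\<lambda>\<xi>. \<lambda>i\<in>{..<n}. \<Sum>j<n. A i j * \<xi> j)"
proof -
  define C where "C i k = (\<integral>x. f i x * f k x \<partial>M)" for i k
  have "0 \<le> (\<Sum>i<n. \<Sum>j<n. x i * x j * C i j)" for x
    unfolding C_def using f by (subst integral_square_sum[symmetric]) auto
  moreover have "C i k = C k i" for i k by (simp add: C_def mult.commute)
  ultimately obtain A where A: "\<And>i k. i < n \<Longrightarrow> k < n \<Longrightarrow> C i k = (\<Sum>j<n. A i j * A k j)"
    using gram_factorization[of C n] by blast
  have mA: "(\<lambda>\<xi>. \<Sum>j<n. A i j * \<xi> j) \<in> borel_measurable (Pi\<^sub>M {..<n} (\<lambda>_. stdN))" for i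
    by measurable
  have "distr M (Pi\<^sub>M {..<n} (\<lambda>_. borel)) (\<lambda>x. \<lambda>i\<in>{..<n}. f i x)
      = distr (Pi\<^sub>M {..<n} (\<lambda>_. stdN)) (Pi\<^sub>M {..<n} (\<lambda>_. borel)) (\<lambda>\<xi>. \<lambda>i\<in>{..<n}. \<Sum>j<n. A i j * \<xi> j)"
  proof (rule joint_law_eqI)
    show "prob_space M" by (rule prob_space_axioms)
    show "prob_space (Pi\<^sub>M {..<n} (\<lambda>_. stdN))" by (intro prob_space_PiM prob_space_stdN)
    fix J :: "nat set" and a b assume J: "finite J" "J \<subseteq> {..<n}"
    have fJ: "f i \<in> H" if "i \<in> J" for i using f that J by auto
    define s where "s j = (\<Sum>i\<in>J. a i * A i j)" for j
    have "(\<integral>x. cos ((\<Sum>i\<in>J. a i * f i x) + b) \<partial>M) = exp (- (\<Sum>i\<in>J. \<Sum>k\<in>J. a i * a k * C i k) / 2) * cos b"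
      using integral_cos[OF sum_mem[OF J(1) fJ]] integral_square_sum[OF J(1) fJ] by (simp add: C_def)
    also have "(\<Sum>i\<in>J. \<Sum>k\<in>J. a i * a k * C i k) = (\<Sum>i\<in>J. \<Sum>k\<in>J. \<Sum>j<n. (a i * A i j) * (a k * A k j))"
      using J A by (intro sum.cong refl) (auto simp: sum_distrib_left mult_ac subset_eq)
    also have "\<dots> = (\<Sum>i\<in>J. \<Sum>j<n. \<Sum>k\<in>J. (a i * A i j) * (a k * A k j))"
      by (intro sum.cong refl sum.swap)
    also have "\<dots> = (\<Sum>j<n. \<Sum>i\<in>J. \<Sum>k\<in>J. (a i * A i j) * (a k * A k j))"
      by (rule sum.swap)
    also have "\<dots> = (\<Sum>j<n. (s j)\<^sup>2)"
      unfolding s_def power2_eq_square sum_product ..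
    also have "exp (- (\<Sum>j<n. (s j)\<^sup>2) / 2) * cos b = (\<integral>\<xi>. cos ((\<Sum>j<n. s j * \<xi> j) + b) \<partial>Pi\<^sub>M {..<n} (\<lambda>_. stdN))"
      using integral_exp_cos_product(2)[of "{..<n}" "\<lambda>_. 0" s b] by (simp add: sum_negf)
    also have "\<dots> = (\<integral>\<xi>. cos ((\<Sum>i\<in>J. a i * (\<Sum>j<n. A i j * \<xi> j)) + b) \<partial>Pi\<^sub>M {..<n} (\<lambda>_. stdN))"
    proof (intro Bochner_Integration.integral_cong refl)
      fix \<xi> :: "nat \<Rightarrow> real"
      have "(\<Sum>j<n. s j * \<xi> j) = (\<Sum>i\<in>J. a i * (\<Sum>j<n. A i j * \<xi> j))"
        unfolding s_def sum_distrib_left sum_distrib_right mult.assoc by (rule sum.swap)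
      then show "cos ((\<Sum>j<n. s j * \<xi> j) + b) = cos ((\<Sum>i\<in>J. a i * (\<Sum>j<n. A i j * \<xi> j)) + b)" by simp
    qed
    finally show "(\<integral>x. cos ((\<Sum>i\<in>J. a i * f i x) + b) \<partial>M)
      = (\<integral>\<xi>. cos ((\<Sum>i\<in>J. a i * (\<Sum>j<n. A i j * \<xi> j)) + b) \<partial>Pi\<^sub>M {..<n} (\<lambda>_. stdN))" .
  qed (use f meas mA in auto)
  then show ?thesis using that[of A] A by (simp add: C_def)
qed

lemma integral_exp_cos:
  assumes r: "r \<in> H" and f: "f \<in> H"
  shows "integrable M (\<lambda>x. exp (r x))"
    and "(\<integral>x. exp (r x) * cos (f x + b) \<partial>M)
      = exp (((\<integral>x. (r x)\<^sup>2 \<partial>M) - (\<integral>x. (f x)\<^sup>2 \<partial>M)) / 2) * cos ((\<integral>x. r x * f x \<partial>M) + b)"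
proof -
  \<comment> \<open>The pair \<open>(r, f)\<close> is a linear image of two independent standard normal variables.\<close>
  define h where "h i = (if i = 0 then r else f)" for i :: nat
  have h: "h i \<in> H" for i using r f by (simp add: h_def)
  obtain A where A: "\<And>i k. i < 2 \<Longrightarrow> k < 2 \<Longrightarrow> (\<integral>x. h i x * h k x \<partial>M) = (\<Sum>j<2::nat. A i j * A k j)"
    and law: "distr M (Pi\<^sub>M {..<2} (\<lambda>_. borel)) (\<lambda>x. \<lambda>i\<in>{..<2}. h i x)
      = distr (Pi\<^sub>M {..<2} (\<lambda>_. stdN)) (Pi\<^sub>M {..<2} (\<lambda>_. borel)) (\<lambda>\<xi>. \<lambda>i\<in>{..<2}. \<Sum>j<2::nat. A i j * \<xi> j)"
    using law_linear_image_std_normal[of 2 h] h by blast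
  have m1 [measurable]: "(\<lambda>x. \<lambda>i\<in>{..<2}. h i x) \<in> measurable M (Pi\<^sub>M {..<2} (\<lambda>_. borel))"
    using h meas by (intro measurable_restrict) auto
  have m2 [measurable]: "(\<lambda>\<xi>. \<lambda>i\<in>{..<2}. \<Sum>j<2::nat. A i j * \<xi> j) \<in> measurable (Pi\<^sub>M {..<2::nat} (\<lambda>_. stdN)) (Pi\<^sub>M {..<2} (\<lambda>_. borel))"
    by (intro measurable_restrict linear_form_measurable) simp
  have c0 [measurable]: "(\<lambda>z. z 0) \<in> borel_measurable (Pi\<^sub>M {..<2::nat} (\<lambda>_. borel :: real measure))"
    and c1 [measurable]: "(\<lambda>z. z 1) \<in> borel_measurable (Pi\<^sub>M {..<2::nat} (\<lambda>_. borel :: real measure))"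
    by (auto intro!: measurable_component_singleton)
  have c0e: "(\<lambda>z. exp (z 0)) \<in> borel_measurable (Pi\<^sub>M {..<2::nat} (\<lambda>_. borel :: real measure))"
    by measurable
  have "integrable (distr (Pi\<^sub>M {..<2} (\<lambda>_. stdN)) (Pi\<^sub>M {..<2} (\<lambda>_. borel)) (\<lambda>\<xi>. \<lambda>i\<in>{..<2}. \<Sum>j<2::nat. A i j * \<xi> j)) (\<lambda>z. exp (z 0))"
    using integral_exp_cos_product(1)[of "{..<2}" "A 0"] by (subst integrable_distr_eq) auto
  then show "integrable M (\<lambda>x. exp (r x))"
    unfolding law[symmetric] by (subst (asm) integrable_distr_eq[OF m1 c0e]) (simp add: h_def)
  have "(\<integral>x. exp (r x) * cos (f x + b) \<partial>M)
      = (\<integral>z. exp (z 0) * cos (z 1 + b) \<partial>distr M (Pi\<^sub>M {..<2} (\<lambda>_. borel)) (\<lambda>x. \<lambda>i\<in>{..<2}. h i x))"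
    by (subst integral_distr[OF m1]) (measurable, simp add: h_def)
  also have "\<dots> = (\<integral>\<xi>. exp (\<Sum>j<2::nat. A 0 j * \<xi> j) * cos ((\<Sum>j<2::nat. A 1 j * \<xi> j) + b) \<partial>Pi\<^sub>M {..<2} (\<lambda>_. stdN))"
    unfolding law by (subst integral_distr) auto
  also have "\<dots> = exp ((\<Sum>j<2::nat. (A 0 j)\<^sup>2 - (A 1 j)\<^sup>2) / 2) * cos ((\<Sum>j<2::nat. A 1 j * A 0 j) + b)"
    by (rule integral_exp_cos_product(2)) simp
  also have "(\<Sum>j<2::nat. (A 0 j)\<^sup>2 - (A 1 j)\<^sup>2) = (\<integral>x. (r x)\<^sup>2 \<partial>M) - (\<integral>x. (f x)\<^sup>2 \<partial>M)"
    using A[of 0 0] A[of 1 1] by (simp add: h_def sum_subtractf power2_eq_square)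
  also have "(\<Sum>j<2::nat. A 1 j * A 0 j) = (\<integral>x. r x * f x \<partial>M)"
    using A[of 0 1] by (simp add: h_def mult.commute)
  finally show "(\<integral>x. exp (r x) * cos (f x + b) \<partial>M)
      = exp (((\<integral>x. (r x)\<^sup>2 \<partial>M) - (\<integral>x. (f x)\<^sup>2 \<partial>M)) / 2) * cos ((\<integral>x. r x * f x \<partial>M) + b)" .
qed

lemma integral_exp: "r \<in> H \<Longrightarrow> (\<integral>x. exp (r x) \<partial>M) = exp ((\<integral>x. (r x)\<^sup>2 \<partial>M) / 2)"
  using integral_exp_cos(2)[OF _ zero_mem, of r 0] by simp

text \<open>
  The subtracted constant normalises the total mass to \<open>1\<close>, by \<open>integral_exp\<close>. When \<open>r\<close> represents
  a Cameron--Martin vector \<open>h\<close> of a Gaussian measure, this is the translate of that measure by \<open>h\<close>.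
\<close>

definition tilted :: "('a \<Rightarrow> real) \<Rightarrow> 'a measure" where
  "tilted r = density M (\<lambda>x. ennreal (exp (r x - (\<integral>x. (r x)\<^sup>2 \<partial>M) / 2)))"

lemma prob_space_tilted:
  assumes r: "r \<in> H"
  shows "prob_space (tilted r)"
proof
  have [measurable]: "r \<in> borel_measurable M" by (rule meas[OF r])
  have "emeasure (tilted r) (space M) = (\<integral>\<^sup>+x. ennreal (exp (r x - (\<integral>x. (r x)\<^sup>2 \<partial>M) / 2)) \<partial>M)"
    unfolding tilted_def by (subst emeasure_density) (auto intro!: nn_integral_cong)
  also have "\<dots> = ennreal (\<integral>x. exp (r x - (\<integral>x. (r x)\<^sup>2 \<partial>M) / 2) \<partial>M)"
    by (rule nn_integral_eq_integral) (auto simp: exp_diff integral_exp_cos(1)[OF r zero_mem])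
  also have "\<dots> = 1" by (simp add: exp_diff integral_exp[OF r])
  finally show "emeasure (tilted r) (space (tilted r)) = 1" by (simp add: tilted_def)
qed

lemma integral_cos_tilted:
  assumes r: "r \<in> H" and f: "f \<in> H"
  shows "(\<integral>x. cos (f x + b) \<partial>tilted r) = (\<integral>x. cos (f x + (\<integral>x. r x * f x \<partial>M) + b) \<partial>M)"
proof -
  have [measurable]: "r \<in> borel_measurable M" "f \<in> borel_measurable M" using meas r f by auto
  have e: "exp ((u - v) / 2) * c / exp (u / 2) = exp (- v / 2) * c" for u v c :: real
  proof -
    have "exp ((u - v) / 2) = exp (- v / 2) * exp (u / 2)"
      unfolding exp_add[symmetric] by (simp add: diff_divide_distrib)
    then show ?thesis by simp
  qed
  have "(\<integral>x. cos (f x + b) \<partial>tilted r) = (\<integral>x. exp (r x - (\<integral>x. (r x)\<^sup>2 \<partial>M) / 2) * cos (f x + b) \<partial>M)"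
    unfolding tilted_def by (subst integral_density) auto
  also have "\<dots> = (\<integral>x. exp (r x) * cos (f x + b) \<partial>M) / exp ((\<integral>x. (r x)\<^sup>2 \<partial>M) / 2)"
    by (simp add: exp_diff)
  also have "\<dots> = exp (- (\<integral>x. (f x)\<^sup>2 \<partial>M) / 2) * cos ((\<integral>x. r x * f x \<partial>M) + b)"
    unfolding integral_exp_cos(2)[OF r f] by (rule e)
  also have "\<dots> = (\<integral>x. cos (f x + ((\<integral>x. r x * f x \<partial>M) + b)) \<partial>M)"
    by (rule integral_cos[OF f, symmetric])
  finally show ?thesis by (simp add: add_ac)
qed

text \<open>
  The Cameron--Martin formula. Tilting leaves the modulus of the characteristic function of a member
  of \<open>H\<close> unchanged and shifts its phase by the covariance with \<open>r\<close>, and a phase that is linear in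
  the frequencies is a translation.
\<close>

theorem cameron_martin_law:
  assumes r: "r \<in> H" and f: "\<And>i. i \<in> I \<Longrightarrow> f i \<in> H"
  shows "distr (tilted r) (Pi\<^sub>M I (\<lambda>_. borel)) (\<lambda>x. \<lambda>i\<in>I. f i x)
    = distr M (Pi\<^sub>M I (\<lambda>_. borel)) (\<lambda>x. \<lambda>i\<in>I. f i x + (\<integral>x. r x * f i x \<partial>M))"
proof (rule joint_law_eqI)
  show "prob_space (tilted r)" by (rule prob_space_tilted[OF r])
  show "prob_space M" by (rule prob_space_axioms)
  fix J a b assume J: "finite J" "J \<subseteq> I"
  have fJ: "f i \<in> H" if "i \<in> J" for i using f that J by auto
  have "(\<integral>x. r x * (\<Sum>i\<in>J. a i * f i x) \<partial>M) = (\<integral>x. (\<Sum>i\<in>J. a i * (r x * f i x)) \<partial>M)"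
    by (simp add: sum_distrib_left mult_ac)
  also have "\<dots> = (\<Sum>i\<in>J. a i * (\<integral>x. r x * f i x \<partial>M))"
    using fJ r by (simp add: mult_integrable)
  finally show "(\<integral>x. cos ((\<Sum>i\<in>J. a i * f i x) + b) \<partial>tilted r)
      = (\<integral>x. cos ((\<Sum>i\<in>J. a i * (f i x + (\<integral>x. r x * f i x \<partial>M))) + b) \<partial>M)"
    using integral_cos_tilted[OF r sum_mem[OF J(1) fJ, where a = a], where b = b]
    by (simp add: distrib_left sum.distrib)
next
  fix i assume "i \<in> I"
  then have m: "f i \<in> borel_measurable M" by (intro meas f)
  show "f i \<in> borel_measurable (tilted r)" using m by (simp add: tilted_def)
  show "(\<lambda>x. f i x + (\<integral>x. r x * f i x \<partial>M)) \<in> borel_measurable M"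
    by (intro borel_measurable_add m borel_measurable_const)
qed

lemma law_symmetric:
  assumes f: "\<And>i. i \<in> I \<Longrightarrow> f i \<in> H"
  shows "distr M (Pi\<^sub>M I (\<lambda>_. borel)) (\<lambda>x. \<lambda>i\<in>I. - f i x) = distr M (Pi\<^sub>M I (\<lambda>_. borel)) (\<lambda>x. \<lambda>i\<in>I. f i x)"
proof (rule joint_law_eqI)
  fix J a b assume J: "finite J" "J \<subseteq> I"
  have fJ: "f i \<in> H" if "i \<in> J" for i using f that J by auto
  show "(\<integral>x. cos ((\<Sum>i\<in>J. a i * - f i x) + b) \<partial>M) = (\<integral>x. cos ((\<Sum>i\<in>J. a i * f i x) + b) \<partial>M)"
    using integral_cos[OF sum_mem[OF J(1) fJ, where a = "\<lambda>i. - a i"]] integral_cos[OF sum_mem[OF J(1) fJ, where a = a]]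
    by (simp add: sum_negf)
next
  fix i assume "i \<in> I"
  then show m: "f i \<in> borel_measurable M" by (intro meas f)
  then show "(\<lambda>x. - f i x) \<in> borel_measurable M" by (rule borel_measurable_uminus)
qed (rule prob_space_axioms)+

end

section \<open>Log-concavity and Anderson's inequality\<close>

text \<open>
  The Brunn--Minkowski inequality on the line. Every set lies in an interval of length its
  diameter, and a convex set is itself an interval, so that measures can be compared through
  diameters.
\<close>

lemma emeasure_convex_combination_le:
  fixes A B C :: "real set"
  assumes t: "0 < t" "t < 1" and "A \<noteq> {}" "B \<noteq> {}"
    and C: "convex C" "C \<in> sets lborel"
    and ABC: "\<And>x y. x \<in> A \<Longrightarrow> y \<in> B \<Longrightarrow> (1 - t) * x + t * y \<in> C"
  shows "ennreal (1 - t) * emeasure lborel A + ennreal t * emeasure lborel B \<le> emeasure lborel C"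
proof (cases "emeasure lborel C")
  case top
  then show ?thesis by simp
next
  case (real L)
  have diam: "z' - z \<le> L" if "z \<in> C" "z' \<in> C" for z z'
  proof (cases "z \<le> z'")
    case True
    then have "{z..z'} \<subseteq> C"
      using C(1) that by (metis closed_segment_eq_real_ivl convex_contains_segment)
    then have "emeasure lborel {z..z'} \<le> ennreal L" using emeasure_mono[OF _ C(2)] real by metis
    then show ?thesis using True real(1) by (simp add: ennreal_le_iff)
  qed (use real(1) in simp)
  have comb: "(1 - t) * x' + t * y' \<le> L + (1 - t) * x + t * y"
    if "x \<in> A" "x' \<in> A" "y \<in> B" "y' \<in> B" for x x' y y'
    using diam[OF ABC[OF that(1,3)] ABC[OF that(2,4)]] by simp
  obtain a b where ab: "a \<in> A" "b \<in> B" using assms(3,4) by auto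
  have bA: "\<bar>x' - a\<bar> \<le> L / (1 - t)" if "x' \<in> A" for x'
    using comb[of a x' b b] comb[of x' a b b] ab that t by (auto simp: field_simps abs_le_iff)
  have bB: "\<bar>y' - b\<bar> \<le> L / t" if "y' \<in> B" for y'
    using comb[of a a b y'] comb[of a a y' b] ab that t by (auto simp: field_simps abs_le_iff)
  have bdd: "bdd_above A" "bdd_below A" "bdd_above B" "bdd_below B"
  proof -
    show "bdd_above A" using bA by (intro bdd_aboveI[of _ "a + L / (1 - t)"]) (fastforce simp: abs_le_iff)
    show "bdd_below A" using bA by (intro bdd_belowI[of _ "a - L / (1 - t)"]) (fastforce simp: abs_le_iff)
    show "bdd_above B" using bB by (intro bdd_aboveI[of _ "b + L / t"]) (fastforce simp: abs_le_iff)
    show "bdd_below B" using bB by (intro bdd_belowI[of _ "b - L / t"]) (fastforce simp: abs_le_iff)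
  qed
  have sup: "k * Sup S \<le> d" if "0 < k" "S \<noteq> {}" "\<And>x. x \<in> S \<Longrightarrow> k * x \<le> d" for S and k d :: real
    using cSup_least[of S "d / k"] that by (simp add: pos_le_divide_eq mult.commute)
  have inf: "d \<le> k * Inf S" if "0 < k" "S \<noteq> {}" "\<And>x. x \<in> S \<Longrightarrow> d \<le> k * x" for S and k d :: real
    using cInf_greatest[of S "d / k"] that by (simp add: pos_divide_le_eq mult.commute)
  have t': "0 < 1 - t" using t by simp
  have "(1 - t) * Sup A \<le> L + (1 - t) * x + t * y - t * y'" if "x \<in> A" "y \<in> B" "y' \<in> B" for x y y'
    using comb[OF that(1) _ that(2,3)] by (intro sup t' assms) (simp add: algebra_simps)
  note s1 = this
  have "t * y' \<le> L + (1 - t) * x + t * y - (1 - t) * Sup A" if "x \<in> A" "y \<in> B" "y' \<in> B" for x y y'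
    using s1[OF that] by simp
  then have "t * Sup B \<le> L + (1 - t) * x + t * y - (1 - t) * Sup A" if "x \<in> A" "y \<in> B" for x y
    using that by (intro sup t(1) assms) auto
  note s2 = this
  have "(1 - t) * Sup A + t * Sup B - L - t * y \<le> (1 - t) * x" if "x \<in> A" "y \<in> B" for x y
    using s2[OF that] by simp
  then have "(1 - t) * Sup A + t * Sup B - L - t * y \<le> (1 - t) * Inf A" if "y \<in> B" for y
    using that by (intro inf t' assms) auto
  note s3 = this
  have "(1 - t) * Sup A + t * Sup B - L - (1 - t) * Inf A \<le> t * y" if "y \<in> B" for y
    using s3[OF that] by simp
  then have "(1 - t) * Sup A + t * Sup B - L - (1 - t) * Inf A \<le> t * Inf B"
    by (intro inf t(1) assms) auto
  then have 4: "(1 - t) * (Sup A - Inf A) + t * (Sup B - Inf B) \<le> L"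
    by (simp add: algebra_simps)
  have len: "emeasure lborel S \<le> ennreal (Sup S - Inf S)" "0 \<le> Sup S - Inf S"
    if "bdd_above S" "bdd_below S" "S \<noteq> {}" for S :: "real set"
  proof -
    from that(3) obtain z where "z \<in> S" by auto
    then have "Inf S \<le> Sup S" using that(1,2) by (meson cInf_lower cSup_upper order.trans)
    moreover have "S \<subseteq> {Inf S..Sup S}" using that by (auto intro: cInf_lower cSup_upper)
    then have "emeasure lborel S \<le> emeasure lborel {Inf S..Sup S}" by (rule emeasure_mono) simp
    ultimately show "emeasure lborel S \<le> ennreal (Sup S - Inf S)" "0 \<le> Sup S - Inf S" by simp_all
  qed
  have "ennreal (1 - t) * emeasure lborel A + ennreal t * emeasure lborel B
      \<le> ennreal (1 - t) * ennreal (Sup A - Inf A) + ennreal t * ennreal (Sup B - Inf B)"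
    by (intro add_mono mult_left_mono len bdd assms) auto
  also have "\<dots> = ennreal ((1 - t) * (Sup A - Inf A) + t * (Sup B - Inf B))"
    using t len(2)[OF bdd(1,2) assms(3)] len(2)[OF bdd(3,4) assms(4)]
    by (simp add: ennreal_mult ennreal_plus)
  also have "\<dots> \<le> ennreal L" by (rule ennreal_leI[OF 4])
  finally show ?thesis using real by simp
qed

lemma nn_integral_layer_cake:
  fixes u :: "real \<Rightarrow> real"
  assumes [measurable]: "u \<in> borel_measurable borel" and "\<And>x. 0 \<le> u x"
  shows "(\<integral>\<^sup>+x. ennreal (u x) \<partial>lborel) = (\<integral>\<^sup>+s. indicator {0<..} s * emeasure lborel {x. s < u x} \<partial>lborel)"
proof -
  have [measurable]: "(\<lambda>(x, s). indicator {0<..<u x} s :: ennreal) \<in> borel_measurable (lborel \<Otimes>\<^sub>M lborel)"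
  proof -
    have "{p \<in> space (lborel \<Otimes>\<^sub>M lborel). 0 < snd p \<and> snd p < u (fst p)} \<in> sets (lborel \<Otimes>\<^sub>M lborel)"
      by measurable
    then have "(indicator {p \<in> space (lborel \<Otimes>\<^sub>M lborel). 0 < snd p \<and> snd p < u (fst p)} :: real \<times> real \<Rightarrow> ennreal)
        \<in> borel_measurable (lborel \<Otimes>\<^sub>M lborel)" by (rule borel_measurable_indicator)
    also have "indicator {p \<in> space (lborel \<Otimes>\<^sub>M lborel). 0 < snd p \<and> snd p < u (fst p)}
        = (\<lambda>(x, s). indicator {0<..<u x} s :: ennreal)"
      by (auto simp: indicator_def space_pair_measure fun_eq_iff)
    finally show ?thesis .
  qed
  have "(\<integral>\<^sup>+x. ennreal (u x) \<partial>lborel) = (\<integral>\<^sup>+x. (\<integral>\<^sup>+s. indicator {0<..<u x} s \<partial>lborel) \<partial>lborel)"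
    using assms(2) by (intro nn_integral_cong) simp
  also have "\<dots> = (\<integral>\<^sup>+s. (\<integral>\<^sup>+x. indicator {0<..<u x} s \<partial>lborel) \<partial>lborel)"
    using lborel_pair.Fubini'[of "\<lambda>x s. indicator {0<..<u x} s"] by simp
  also have "\<dots> = (\<integral>\<^sup>+s. indicator {0<..} s * emeasure lborel {x. s < u x} \<partial>lborel)"
  proof (intro nn_integral_cong)
    fix s :: real
    have "(\<integral>\<^sup>+x. indicator {0<..<u x} s \<partial>lborel) = (\<integral>\<^sup>+x. indicator {0<..} s * indicator {x. s < u x} x \<partial>lborel)"
      by (intro nn_integral_cong) (auto simp: indicator_def)
    also have "\<dots> = indicator {0<..} s * emeasure lborel {x. s < u x}"
      by (subst nn_integral_cmult_indicator) auto
    finally show "(\<integral>\<^sup>+x. indicator {0<..<u x} s \<partial>lborel) = indicator {0<..} s * emeasure lborel {x. s < u x}" .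
  qed
  finally show ?thesis .
qed

text \<open>
  After normalising the suprema of \<open>f\<close> and \<open>g\<close> to \<open>1\<close>, all their level sets below height \<open>1\<close> are
  nonempty, and the Brunn--Minkowski inequality applies to them. Integrating over the levels gives
  the arithmetic mean of the integrals as a lower bound, which is at least the geometric mean.
  Quasiconcavity of \<open>h\<close> makes its level sets intervals, whose measures dominate those of the
  level sets of \<open>f\<close> and \<open>g\<close>.
\<close>

theorem prekopa_leindler_real:
  fixes f g h :: "real \<Rightarrow> real"
  assumes t: "0 < t" "t < 1"
    and m [measurable]: "f \<in> borel_measurable borel" "g \<in> borel_measurable borel" "h \<in> borel_measurable borel"
    and int: "integrable lborel f" "integrable lborel g" "integrable lborel h"
    and nonneg: "\<And>x. 0 \<le> f x" "\<And>x. 0 \<le> g x" "\<And>x. 0 \<le> h x"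
    and bounded: "\<And>x. f x \<le> c" "\<And>x. g x \<le> c"
    and quasiconcave: "\<And>s. convex {x. s < h x}"
    and fgh: "\<And>x y. f x powr (1 - t) * g y powr t \<le> h ((1 - t) * x + t * y)"
  shows "(\<integral>x. f x \<partial>lborel) powr (1 - t) * (\<integral>x. g x \<partial>lborel) powr t \<le> (\<integral>x. h x \<partial>lborel)"
proof -
  define a where "a = Sup (range f)"
  define b where "b = Sup (range g)"
  have bdd: "bdd_above (range f)" "bdd_above (range g)" using bounded by (auto intro!: bdd_aboveI[of _ c])
  have fa: "f x \<le> a" and gb: "g x \<le> b" for x
    unfolding a_def b_def using bdd by (auto intro: cSup_upper)
  show ?thesis
  proof (cases "a = 0 \<or> b = 0")
    case True
    then have "(\<forall>x. f x = 0) \<or> (\<forall>x. g x = 0)" using fa gb nonneg by (metis order.antisym)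
    then have "(\<integral>x. f x \<partial>lborel) = 0 \<or> (\<integral>x. g x \<partial>lborel) = 0" by auto
    then show ?thesis using t nonneg by auto
  next
    case False
    then have a0: "0 < a" and b0: "0 < b" using order.trans[OF nonneg(1) fa[of 0]] order.trans[OF nonneg(2) gb[of 0]] by auto
    define k where "k = a powr (1 - t) * b powr t"
    have k0: "0 < k" using a0 b0 by (simp add: k_def)
    \<comment> \<open>For \<open>s \<ge> 1\<close> both level sets on the left are empty, while below \<open>1\<close> neither is.\<close>
    have level: "ennreal (1 - t) * emeasure lborel {x. s < f x / a} + ennreal t * emeasure lborel {x. s < g x / b}
        \<le> emeasure lborel {x. s < h x / k}" if s: "0 < s" for s
    proof (cases "s < 1")
      case True
      show ?thesis
      proof (rule emeasure_convex_combination_le[OF t])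
        have "s * a < a" "s * b < b" using True a0 b0 by simp_all
        then have "\<exists>y\<in>range f. s * a < y" "\<exists>y\<in>range g. s * b < y"
          unfolding a_def b_def by (metis less_cSup_iff bdd UNIV_not_empty image_is_empty)+
        then show "{x. s < f x / a} \<noteq> {}" "{x. s < g x / b} \<noteq> {}"
          using a0 b0 by (auto simp: field_simps)
        have "{x. s < h x / k} = {x. s * k < h x}" using k0 by (simp add: pos_less_divide_eq)
        then show "convex {x. s < h x / k}" using quasiconcave by simp
        show "{x. s < h x / k} \<in> sets lborel" by simp
      next
        fix x y assume "x \<in> {x. s < f x / a}" "y \<in> {x. s < g x / b}"
        then have "s * a < f x" "s * b < g y" using a0 b0 by (simp_all add: pos_less_divide_eq)
        then have "(s * a) powr (1 - t) < f x powr (1 - t)" "(s * b) powr t < g y powr t"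
          using s a0 b0 t by (auto intro!: powr_less_mono2)
        then have "(s * a) powr (1 - t) * (s * b) powr t < f x powr (1 - t) * g y powr t"
          by (rule mult_strict_mono') auto
        also have "(s * a) powr (1 - t) * (s * b) powr t = (s powr (1 - t) * s powr t) * k"
          using s a0 b0 by (simp add: powr_mult k_def)
        also have "s powr (1 - t) * s powr t = s" using s by (simp add: powr_add[symmetric])
        finally have "s * k < h ((1 - t) * x + t * y)" using fgh[of x y] by linarith
        then show "(1 - t) * x + t * y \<in> {x. s < h x / k}" using k0 by (simp add: pos_less_divide_eq)
      qed
    next
      case False
      have "f x / a \<le> 1" "g x / b \<le> 1" for x using fa[of x] gb[of x] a0 b0 by simp_all
      then have "{x. s < f x / a} = {}" "{x. s < g x / b} = {}" using False by (auto simp: not_less intro: order.trans)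
      then show ?thesis by simp
    qed
    have lay: "ennreal (\<integral>x. u x / d \<partial>lborel) = (\<integral>\<^sup>+s. indicator {0<..} s * emeasure lborel {x. s < u x / d} \<partial>lborel)"
      if "u \<in> borel_measurable borel" "integrable lborel u" "\<And>x. 0 \<le> u x" "0 < d" for u :: "real \<Rightarrow> real" and d
    proof -
      have "ennreal (\<integral>x. u x / d \<partial>lborel) = (\<integral>\<^sup>+x. ennreal (u x / d) \<partial>lborel)"
        by (rule nn_integral_eq_integral[symmetric]) (use that in auto)
      also have "\<dots> = (\<integral>\<^sup>+s. indicator {0<..} s * emeasure lborel {x. s < u x / d} \<partial>lborel)"
        by (rule nn_integral_layer_cake) (use that in auto)
      finally show ?thesis .
    qed
    define F where "F = (\<integral>x. f x \<partial>lborel) / a"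
    define G where "G = (\<integral>x. g x \<partial>lborel) / b"
    have F0: "0 \<le> F" and G0: "0 \<le> G" using nonneg a0 b0 by (simp_all add: F_def G_def)
    have em: "(\<lambda>s. emeasure lborel {x. s < u x / d}) \<in> borel_measurable borel" if [measurable]: "u \<in> borel_measurable borel"
      for u :: "real \<Rightarrow> real" and d
    proof -
      have "{p \<in> space (borel \<Otimes>\<^sub>M lborel). fst p < u (snd p) / d} \<in> sets (borel \<Otimes>\<^sub>M lborel)" by measurable
      from lborel.measurable_emeasure_Pair[OF this] show ?thesis by (simp add: space_pair_measure vimage_def)
    qed
    note [measurable] = em[OF m(1), of a] em[OF m(2), of b] em[OF m(3), of k]
    have "ennreal ((1 - t) * F + t * G) = ennreal (1 - t) * ennreal F + ennreal t * ennreal G"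
      using t F0 G0 by (simp add: ennreal_mult)
    also have "\<dots> = (\<integral>\<^sup>+s. ennreal (1 - t) * (indicator {0<..} s * emeasure lborel {x. s < f x / a})
        + ennreal t * (indicator {0<..} s * emeasure lborel {x. s < g x / b}) \<partial>lborel)"
      using lay[OF m(1) int(1) nonneg(1) a0] lay[OF m(2) int(2) nonneg(2) b0]
      by (subst nn_integral_add) (simp_all add: nn_integral_cmult F_def G_def)
    also have "\<dots> \<le> (\<integral>\<^sup>+s. indicator {0<..} s * emeasure lborel {x. s < h x / k} \<partial>lborel)"
      by (rule nn_integral_mono) (use level in \<open>auto simp: indicator_def\<close>)
    also have "\<dots> = ennreal ((\<integral>x. h x \<partial>lborel) / k)"
      using lay[OF m(3) int(3) nonneg(3) k0] by simp
    finally have "(1 - t) * F + t * G \<le> (\<integral>x. h x \<partial>lborel) / k"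
      using nonneg k0 by (subst (asm) ennreal_le_iff) auto
    moreover have "F powr (1 - t) * G powr t \<le> (1 - t) * F + t * G"
      using Youngs_inequality_0[of "1 - t" t F G] t F0 G0 by (cases "F = 0 \<or> G = 0") auto
    ultimately have "F powr (1 - t) * G powr t \<le> (\<integral>x. h x \<partial>lborel) / k" by simp
    moreover have "F powr (1 - t) * G powr t = ((\<integral>x. f x \<partial>lborel) powr (1 - t) * (\<integral>x. g x \<partial>lborel) powr t) / k"
      using a0 b0 nonneg by (simp add: F_def G_def k_def powr_divide)
    ultimately show ?thesis using k0 by (simp add: divide_le_cancel)
  qed
qed

text \<open>
  Stated for functions of families of reals with pointwise combinations, so that coordinates can
  be integrated out one at a time. The exponents are positive, hence \<open>0 powr _ = 0\<close> and points
  where \<open>u\<close> vanishes impose nothing.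
\<close>

definition log_concave :: "(('i \<Rightarrow> real) \<Rightarrow> real) \<Rightarrow> bool" where
  "log_concave u \<longleftrightarrow> (\<forall>x. 0 \<le> u x) \<and>
    (\<forall>x y t. 0 < t \<and> t < 1 \<longrightarrow> u x powr (1 - t) * u y powr t \<le> u (\<lambda>i. (1 - t) * x i + t * y i))"

lemma log_concaveD: "log_concave u \<Longrightarrow> 0 < t \<Longrightarrow> t < 1 \<Longrightarrow>
    u x powr (1 - t) * u y powr t \<le> u (\<lambda>i. (1 - t) * x i + t * y i)"
  and log_concave_nonneg: "log_concave u \<Longrightarrow> 0 \<le> u x"
  by (auto simp: log_concave_def)

lemma std_normal_density_log_concave:
  assumes t: "0 < t" "t < 1"
  shows "std_normal_density x powr (1 - t) * std_normal_density y powr t \<le> std_normal_density ((1 - t) * x + t * y)"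
proof -
  define k where "k = 1 / sqrt (2 * pi)"
  have k: "0 < k" by (simp add: k_def)
  have "std_normal_density x powr (1 - t) * std_normal_density y powr t
      = (k powr (1 - t) * k powr t) * (exp (- x\<^sup>2 / 2) powr (1 - t) * exp (- y\<^sup>2 / 2) powr t)"
    using k by (simp add: std_normal_density_def k_def[symmetric] powr_mult)
  also have "k powr (1 - t) * k powr t = k" using k by (simp add: powr_add[symmetric])
  also have "exp (- x\<^sup>2 / 2) powr (1 - t) * exp (- y\<^sup>2 / 2) powr t = exp (- ((1 - t) * x\<^sup>2 + t * y\<^sup>2) / 2)"
    by (simp add: powr_def exp_add[symmetric] field_simps)
  also have "\<dots> \<le> exp (- ((1 - t) * x + t * y)\<^sup>2 / 2)"
  proof -
    have "(1 - t) * x\<^sup>2 + t * y\<^sup>2 - ((1 - t) * x + t * y)\<^sup>2 = t * (1 - t) * (x - y)\<^sup>2"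
      by (simp add: power2_eq_square algebra_simps)
    also have "\<dots> \<ge> 0" using t by simp
    finally show ?thesis by simp
  qed
  finally show ?thesis using k by (simp add: std_normal_density_def k_def[symmetric])
qed

text \<open>
  Prekopa's theorem for one coordinate: the normal density is itself log-concave, so that the
  Prekopa--Leindler inequality applies to its product with a section of \<open>u\<close>.
\<close>

lemma log_concave_marginal:
  fixes u :: "('i \<Rightarrow> real) \<Rightarrow> real"
  assumes u: "log_concave u" and le1: "\<And>x. u x \<le> 1"
    and m [measurable]: "u \<in> borel_measurable (Pi\<^sub>M UNIV (\<lambda>_. borel))"
  shows "log_concave (\<lambda>x. \<integral>s. u (x(j := s)) \<partial>stdN)"
    and "(\<integral>s. u (x(j := s)) \<partial>stdN) \<le> 1"
    and "(\<lambda>x. \<integral>s. u (x(j := s)) \<partial>stdN) \<in> borel_measurable (Pi\<^sub>M UNIV (\<lambda>_. borel))"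
proof -
  interpret N: prob_space stdN by (rule prob_space_stdN)
  have [measurable]: "(\<lambda>p. (fst p)(j := snd p)) \<in> measurable (Pi\<^sub>M UNIV (\<lambda>_. borel) \<Otimes>\<^sub>M stdN) (Pi\<^sub>M (UNIV :: 'i set) (\<lambda>_. borel :: real measure))"
    by (rule measurable_PiM_single') (auto simp: space_pair_measure space_PiM cong: measurable_cong_sets)
  have [measurable]: "(\<lambda>s. x(j := s)) \<in> measurable borel (Pi\<^sub>M (UNIV :: 'i set) (\<lambda>_. borel :: real measure))" for x
    by (rule measurable_PiM_single') auto
  have mu [measurable]: "(\<lambda>s. u (x(j := s))) \<in> borel_measurable borel" for x
    by measurable
  have nn: "0 \<le> u x" for x by (rule log_concave_nonneg[OF u])
  have i: "integrable stdN (\<lambda>s. u (x(j := s)))" for x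
    by (rule N.integrable_const_bound[of _ 1]) (use nn le1 in auto)
  have "(\<integral>s. u (x(j := s)) \<partial>stdN) \<le> (\<integral>s. 1 \<partial>stdN)"
    by (rule integral_mono[OF i]) (use le1 in auto)
  then show "(\<integral>s. u (x(j := s)) \<partial>stdN) \<le> 1" using N.prob_space by simp
  have "(\<lambda>p. u ((fst p)(j := snd p))) \<in> borel_measurable (Pi\<^sub>M UNIV (\<lambda>_. borel) \<Otimes>\<^sub>M stdN)"
    by measurable
  then show "(\<lambda>x. \<integral>s. u (x(j := s)) \<partial>stdN) \<in> borel_measurable (Pi\<^sub>M UNIV (\<lambda>_. borel))"
    by (intro N.borel_measurable_lebesgue_integral) (simp add: case_prod_beta')
  define f where "f x s = std_normal_density s * u (x(j := s))" for x s
  have fi: "(\<integral>s. u (x(j := s)) \<partial>stdN) = (\<integral>s. f x s \<partial>lborel)" for x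
    by (subst integral_density) (auto simp: f_def[abs_def])
  have fint: "integrable lborel (f x)" for x
    using i[of x] by (subst (asm) integrable_density) (auto simp: f_def[abs_def])
  have key: "f x a powr (1 - t) * f y b powr t \<le> f (\<lambda>i. (1 - t) * x i + t * y i) ((1 - t) * a + t * b)"
    if t: "0 < t" "t < 1" for x y a b t
  proof -
    have "f x a powr (1 - t) * f y b powr t
        = (std_normal_density a powr (1 - t) * std_normal_density b powr t) * (u (x(j := a)) powr (1 - t) * u (y(j := b)) powr t)"
      by (simp add: f_def powr_mult nn)
    also have "\<dots> \<le> std_normal_density ((1 - t) * a + t * b) * u (\<lambda>i. (1 - t) * (x(j := a)) i + t * (y(j := b)) i)"
      by (intro mult_mono std_normal_density_log_concave log_concaveD[OF u] t) auto
    also have "(\<lambda>i. (1 - t) * (x(j := a)) i + t * (y(j := b)) i) = (\<lambda>i. (1 - t) * x i + t * y i)(j := (1 - t) * a + t * b)"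
      by auto
    finally show ?thesis unfolding f_def .
  qed
  have fnn: "0 \<le> f x s" for x s by (simp add: f_def nn)
  have conv: "convex {s. c < f z s}" for c z
    unfolding convex_alt
  proof safe
    fix p q t :: real assume c: "c < f z p" "c < f z q" and t: "0 \<le> t" "t \<le> 1"
    show "c < f z ((1 - t) *\<^sub>R p + t *\<^sub>R q)"
    proof (cases "t = 0 \<or> t = 1")
      case False
      with t have t': "0 < t" "t < 1" by auto
      define n where "n = min (f z p) (f z q)"
      have n: "0 \<le> n" "c < n" "n \<le> f z p" "n \<le> f z q" using c fnn by (auto simp: n_def)
      have "n = n powr (1 - t) * n powr t" using n by (simp add: powr_add[symmetric])
      also have "\<dots> \<le> f z p powr (1 - t) * f z q powr t"
        using n t' by (intro mult_mono powr_mono2) auto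
      also have "\<dots> \<le> f (\<lambda>i. (1 - t) * z i + t * z i) ((1 - t) * p + t * q)" by (rule key[OF t'])
      also have "(\<lambda>i. (1 - t) * z i + t * z i) = z" by (auto simp: algebra_simps)
      finally show ?thesis using n by simp
    qed (use c in auto)
  qed
  have fb: "f x s \<le> 1 / sqrt (2 * pi)" for x s
  proof -
    have "f x s \<le> std_normal_density s * 1" unfolding f_def by (rule mult_left_mono[OF le1]) simp
    also have "\<dots> \<le> 1 / sqrt (2 * pi)" by (simp add: std_normal_density_def divide_right_mono)
    finally show ?thesis .
  qed
  show "log_concave (\<lambda>x. \<integral>s. u (x(j := s)) \<partial>stdN)"
    unfolding log_concave_def fi
  proof safe
    fix x y and t :: real assume t: "0 < t" "t < 1"
    show "(\<integral>s. f x s \<partial>lborel) powr (1 - t) * (\<integral>s. f y s \<partial>lborel) powr t \<le> (\<integral>s. f (\<lambda>i. (1 - t) * x i + t * y i) s \<partial>lborel)"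
      by (rule prekopa_leindler_real[OF t _ _ _ fint fint fint fnn fnn fnn fb fb conv key[OF t]])
        (auto simp: f_def[abs_def])
  qed (simp add: fnn)
qed

lemma log_concave_gaussian_marginals:
  fixes u :: "('i \<Rightarrow> real) \<Rightarrow> real"
  assumes "finite I" and "log_concave u" and "\<And>x. u x \<le> 1"
    and "u \<in> borel_measurable (Pi\<^sub>M UNIV (\<lambda>_. borel))"
  shows "log_concave (\<lambda>y. \<integral>\<xi>. u (\<lambda>i. if i \<in> I then \<xi> i else y i) \<partial>Pi\<^sub>M I (\<lambda>_. stdN))"
  using assms
proof (induction I arbitrary: u)
  case empty
  then show ?case by (simp add: PiM_empty)
next
  case (insert j I)
  interpret N: prob_space stdN by (rule prob_space_stdN)
  interpret product_sigma_finite "\<lambda>_. stdN" by standard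
  interpret P: prob_space "Pi\<^sub>M (insert j I) (\<lambda>_. stdN)" by (intro prob_space_PiM prob_space_stdN)
  have step: "(\<integral>\<xi>. u (\<lambda>i. if i \<in> insert j I then \<xi> i else y i) \<partial>Pi\<^sub>M (insert j I) (\<lambda>_. stdN))
      = (\<integral>\<xi>. (\<integral>s. u ((\<lambda>i. if i \<in> I then \<xi> i else y i)(j := s)) \<partial>stdN) \<partial>Pi\<^sub>M I (\<lambda>_. stdN))" for y
  proof -
    have "(\<lambda>\<xi> i. if i \<in> insert j I then \<xi> i else y i) \<in> measurable (Pi\<^sub>M (insert j I) (\<lambda>_. stdN)) (Pi\<^sub>M UNIV (\<lambda>_. borel))"
    proof (rule measurable_PiM_single')
      fix i
      show "(\<lambda>\<xi>. if i \<in> insert j I then \<xi> i else y i) \<in> borel_measurable (Pi\<^sub>M (insert j I) (\<lambda>_. stdN))"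
        using linear_form_measurable[of "{i}" "insert j I" "\<lambda>_. 1"] by (cases "i \<in> insert j I") auto
    qed auto
    then have "(\<lambda>\<xi>. u (\<lambda>i. if i \<in> insert j I then \<xi> i else y i)) \<in> borel_measurable (Pi\<^sub>M (insert j I) (\<lambda>_. stdN))"
      by (rule measurable_compose[OF _ insert.prems(3)])
    then have "integrable (Pi\<^sub>M (insert j I) (\<lambda>_. stdN)) (\<lambda>\<xi>. u (\<lambda>i. if i \<in> insert j I then \<xi> i else y i))"
      by (intro P.integrable_const_bound[of _ 1]) (use insert.prems log_concave_nonneg[OF insert.prems(1)] in auto)
    then have "(\<integral>\<xi>. u (\<lambda>i. if i \<in> insert j I then \<xi> i else y i) \<partial>Pi\<^sub>M (insert j I) (\<lambda>_. stdN))
      = (\<integral>\<xi>. (\<integral>s. u (\<lambda>i. if i \<in> insert j I then (\<xi>(j := s)) i else y i) \<partial>stdN) \<partial>Pi\<^sub>M I (\<lambda>_. stdN))"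
      by (rule product_integral_insert[OF insert.hyps])
    moreover have "(\<lambda>i. if i \<in> insert j I then (\<xi>(j := s)) i else y i) = (\<lambda>i. if i \<in> I then \<xi> i else y i)(j := s)" for \<xi> s
      by auto
    ultimately show ?thesis by (simp only:)
  qed
  show ?case
    unfolding step by (rule insert.IH[OF log_concave_marginal[OF insert.prems]])
qed

text \<open>
  Let \<open>p s\<close> be the probability that \<open>f + s c\<close> lies in the cube. In terms of the standard normal
  variables \<open>z\<^sub>j\<close>, \<open>j < n\<close>, and of \<open>s\<close>, kept as the coordinate \<open>z\<^sub>n\<close>, the event is a convex set
  \<open>S\<close>, so \<open>p\<close> is a marginal of a log-concave function. Being even as well, it satisfies
  \<open>p 1 = sqrt (p 1 * p (- 1)) \<le> p 0\<close>.
\<close>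

lemma (in gaussian_space) anderson_finite:
  fixes f :: "nat \<Rightarrow> 'a \<Rightarrow> real"
  assumes f: "\<And>i. i < n \<Longrightarrow> f i \<in> H"
  shows "prob {x \<in> space M. \<forall>i<n. \<bar>f i x + c i\<bar> \<le> d} \<le> prob {x \<in> space M. \<forall>i<n. \<bar>f i x\<bar> \<le> d}"
proof -
  interpret N: prob_space stdN by (rule prob_space_stdN)
  interpret P: prob_space "Pi\<^sub>M {..<n} (\<lambda>_. stdN)" by (intro prob_space_PiM prob_space_stdN)
  let ?B = "Pi\<^sub>M {..<n} (\<lambda>_. borel) :: (nat \<Rightarrow> real) measure"
  obtain A where "\<And>i k. i < n \<Longrightarrow> k < n \<Longrightarrow> (\<integral>x. f i x * f k x \<partial>M) = (\<Sum>j<n. A i j * A k j)"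
    and law: "distr M ?B (\<lambda>x. \<lambda>i\<in>{..<n}. f i x)
      = distr (Pi\<^sub>M {..<n} (\<lambda>_. stdN)) ?B (\<lambda>\<xi>. \<lambda>i\<in>{..<n}. \<Sum>j<n. A i j * \<xi> j)"
    by (rule law_linear_image_std_normal[of n f, OF f]) (assumption, rule that)
  have mf: "(\<lambda>x. \<lambda>i\<in>{..<n}. f i x) \<in> measurable M ?B"
    and mf': "(\<lambda>x. \<lambda>i\<in>{..<n}. - f i x) \<in> measurable M ?B"
    using f meas by (auto intro!: measurable_restrict)
  have mA: "(\<lambda>\<xi>. \<lambda>i\<in>{..<n}. \<Sum>j<n. A i j * \<xi> j) \<in> measurable (Pi\<^sub>M {..<n} (\<lambda>_. stdN)) ?B"
    by (intro measurable_restrict linear_form_measurable) simp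
  define E where "E s = {z \<in> space ?B. \<forall>i<n. \<bar>z i + s * c i\<bar> \<le> d}" for s
  have E [measurable]: "E s \<in> sets ?B" for s
  proof -
    have "{z \<in> space ?B. \<bar>z i + s * c i\<bar> \<le> d} \<in> sets ?B" if "i < n" for i
    proof -
      have [measurable]: "(\<lambda>z. z i) \<in> borel_measurable ?B"
        using that by (intro measurable_component_singleton) simp
      show ?thesis by measurable
    qed
    then have "{z \<in> space ?B. \<forall>i\<in>{..<n}. \<bar>z i + s * c i\<bar> \<le> d} \<in> sets ?B"
      by (intro sets.sets_Collect_finite_All) auto
    then show ?thesis by (simp add: E_def Ball_def)
  qed
  define p where "p s = measure (distr M ?B (\<lambda>x. \<lambda>i\<in>{..<n}. f i x)) (E s)" for s
  have p: "p s = prob {x \<in> space M. \<forall>i<n. \<bar>f i x + s * c i\<bar> \<le> d}" for s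
    unfolding p_def
    by (subst measure_distr[OF mf E]) (auto simp: E_def space_PiM intro!: arg_cong[where f = prob])
  have even: "p (- s) = p s" for s
  proof -
    have "p (- s) = measure (distr M ?B (\<lambda>x. \<lambda>i\<in>{..<n}. - f i x)) (E (- s))"
      unfolding p_def using law_symmetric[of "{..<n}" f] f by simp
    also have "\<dots> = prob {x \<in> space M. \<forall>i<n. \<bar>- f i x + (- s) * c i\<bar> \<le> d}"
      by (subst measure_distr[OF mf' E]) (auto simp: E_def space_PiM intro!: arg_cong[where f = prob])
    also have "\<dots> = p s"
    proof -
      have "\<bar>- f i x + (- s) * c i\<bar> = \<bar>f i x + s * c i\<bar>" for i x
        using abs_minus_cancel[of "f i x + s * c i"] by simp
      then show ?thesis unfolding p by (simp only:)
    qed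
    finally show ?thesis .
  qed
  define S where "S = {z :: nat \<Rightarrow> real. \<forall>i<n. \<bar>(\<Sum>j<n. A i j * z j) + z n * c i\<bar> \<le> d}"
  have S_conv: "(\<lambda>i. (1 - t) * x i + t * y i) \<in> S" if "x \<in> S" "y \<in> S" and t: "0 < t" "t < 1" for x y t
    unfolding S_def
  proof safe
    fix i assume "i < n"
    define X where "X = (\<Sum>j<n. A i j * x j) + x n * c i"
    define Y where "Y = (\<Sum>j<n. A i j * y j) + y n * c i"
    have "(\<Sum>j<n. A i j * ((1 - t) * x j + t * y j)) + ((1 - t) * x n + t * y n) * c i = (1 - t) * X + t * Y"
      by (simp add: X_def Y_def algebra_simps sum.distrib sum_distrib_left sum_subtractf)
    moreover have "\<bar>(1 - t) * X + t * Y\<bar> \<le> (1 - t) * \<bar>X\<bar> + t * \<bar>Y\<bar>"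
      using abs_triangle_ineq[of "(1 - t) * X" "t * Y"] t by (simp add: abs_mult)
    moreover have "(1 - t) * \<bar>X\<bar> + t * \<bar>Y\<bar> \<le> d"
      by (rule convex_bound_le) (use that \<open>i < n\<close> in \<open>auto simp: S_def X_def Y_def\<close>)
    ultimately show "\<bar>(\<Sum>j<n. A i j * ((1 - t) * x j + t * y j)) + ((1 - t) * x n + t * y n) * c i\<bar> \<le> d"
      by simp
  qed
  have "log_concave (indicator S)"
    using S_conv by (auto simp: log_concave_def indicator_def)
  moreover have "indicator S \<in> borel_measurable (Pi\<^sub>M UNIV (\<lambda>_. borel :: real measure))"
  proof -
    have [measurable]: "(\<lambda>z. \<Sum>j<n. A i j * z j) \<in> borel_measurable (Pi\<^sub>M UNIV (\<lambda>_::nat. borel :: real measure))" for i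
      by measurable
    have "{z \<in> space (Pi\<^sub>M UNIV (\<lambda>_. borel)). \<forall>i<n. \<bar>(\<Sum>j<n. A i j * z j) + z n * c i\<bar> \<le> d} \<in> sets (Pi\<^sub>M UNIV (\<lambda>_::nat. borel :: real measure))"
      by measurable
    then have "S \<in> sets (Pi\<^sub>M UNIV (\<lambda>_::nat. borel :: real measure))" by (simp add: S_def space_PiM)
    then show ?thesis by (rule borel_measurable_indicator)
  qed
  ultimately have lc: "log_concave (\<lambda>y. \<integral>\<xi>. indicator S (\<lambda>i. if i \<in> {..<n} then \<xi> i else y i) \<partial>Pi\<^sub>M {..<n} (\<lambda>_. stdN))"
    by (intro log_concave_gaussian_marginals) (simp_all add: indicator_le_1)
  have pS: "(\<integral>\<xi>. indicator S (\<lambda>i. if i \<in> {..<n} then \<xi> i else y i) \<partial>Pi\<^sub>M {..<n} (\<lambda>_. stdN)) = p (y n)" for y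
  proof -
    have "p (y n) = P.prob ((\<lambda>\<xi>. \<lambda>i\<in>{..<n}. \<Sum>j<n. A i j * \<xi> j) -` E (y n) \<inter> space (Pi\<^sub>M {..<n} (\<lambda>_. stdN)))"
      unfolding p_def law by (rule measure_distr[OF mA E])
    also have "\<dots> = (\<integral>\<xi>. indicator ((\<lambda>\<xi>. \<lambda>i\<in>{..<n}. \<Sum>j<n. A i j * \<xi> j) -` E (y n) \<inter> space (Pi\<^sub>M {..<n} (\<lambda>_. stdN))) \<xi> \<partial>Pi\<^sub>M {..<n} (\<lambda>_. stdN))"
      by (subst Bochner_Integration.integral_indicator) (simp add: Int_assoc)
    also have "\<dots> = (\<integral>\<xi>. indicator S (\<lambda>i. if i \<in> {..<n} then \<xi> i else y i) \<partial>Pi\<^sub>M {..<n} (\<lambda>_. stdN))"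
      by (intro Bochner_Integration.integral_cong refl) (auto simp: indicator_def E_def S_def space_PiM)
    finally show ?thesis by simp
  qed
  have "p 1 powr (1 - 1/2) * p (- 1) powr (1/2) \<le> p 0"
    using log_concaveD[OF lc, of "1/2" "\<lambda>_. 1" "\<lambda>_. - 1"] unfolding pS by simp
  moreover have "p 1 powr (1 - 1/2) * p 1 powr (1/2) = p 1"
    unfolding powr_add[symmetric] by (simp add: p)
  ultimately have "p 1 \<le> p 0" by (simp only: even)
  then show ?thesis by (simp add: p)
qed

lemma (in gaussian_space) anderson:
  fixes f :: "nat \<Rightarrow> 'a \<Rightarrow> real"
  assumes f: "\<And>i. f i \<in> H"
  shows "prob {x \<in> space M. \<forall>i. \<bar>f i x + c i\<bar> \<le> d} \<le> prob {x \<in> space M. \<forall>i. \<bar>f i x\<bar> \<le> d}"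
proof -
  have [measurable]: "f i \<in> borel_measurable M" for i by (rule meas[OF f])
  have lim: "(\<lambda>n. prob {x \<in> space M. \<forall>i<n. \<bar>f i x + c i\<bar> \<le> d}) \<longlonglongrightarrow> prob {x \<in> space M. \<forall>i. \<bar>f i x + c i\<bar> \<le> d}" for c
  proof -
    have "(\<lambda>n. prob {x \<in> space M. \<forall>i<n. \<bar>f i x + c i\<bar> \<le> d})
        \<longlonglongrightarrow> prob (\<Inter>n. {x \<in> space M. \<forall>i<n. \<bar>f i x + c i\<bar> \<le> d})"
      by (rule finite_Lim_measure_decseq) (auto simp: decseq_def)
    also have "(\<Inter>n. {x \<in> space M. \<forall>i<n. \<bar>f i x + c i\<bar> \<le> d}) = {x \<in> space M. \<forall>i. \<bar>f i x + c i\<bar> \<le> d}"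
      by auto
    finally show ?thesis .
  qed
  show ?thesis
    using lim[of "\<lambda>_. 0"] by (intro LIMSEQ_le[OF lim]) (auto intro!: anderson_finite f)
qed

text \<open>
  Tilting acts on the family \<open>f\<close> as a translation, to which Anderson's inequality applies.
\<close>

lemma (in gaussian_space) tilted_symmetric_slab_le:
  fixes f :: "nat \<Rightarrow> 'a \<Rightarrow> real"
  assumes r: "r \<in> H" and f: "\<And>i. f i \<in> H"
  shows "measure (tilted r) {x \<in> space M. \<forall>i. \<bar>f i x\<bar> \<le> d} \<le> prob {x \<in> space M. \<forall>i. \<bar>f i x\<bar> \<le> d}"
proof -
  let ?B = "Pi\<^sub>M UNIV (\<lambda>_. borel) :: (nat \<Rightarrow> real) measure"
  have fm: "f i \<in> borel_measurable M" for i by (rule meas[OF f])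
  have m1: "(\<lambda>x. \<lambda>i\<in>UNIV. f i x) \<in> measurable (tilted r) ?B"
    by (intro measurable_restrict) (simp add: tilted_def fm)
  have m2: "(\<lambda>x. \<lambda>i\<in>UNIV. f i x + (\<integral>x. r x * f i x \<partial>M)) \<in> measurable M ?B"
    by (intro measurable_restrict borel_measurable_add fm borel_measurable_const)
  define E where "E = {z \<in> space ?B. \<forall>i. \<bar>z i\<bar> \<le> d}"
  have E [measurable]: "E \<in> sets ?B" unfolding E_def by measurable
  have "measure (tilted r) {x \<in> space M. \<forall>i. \<bar>f i x\<bar> \<le> d} = measure (distr (tilted r) ?B (\<lambda>x. \<lambda>i\<in>UNIV. f i x)) E"
    by (subst measure_distr[OF m1 E]) (auto simp: E_def space_PiM tilted_def intro!: arg_cong2[where f = measure])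
  also have "\<dots> = measure (distr M ?B (\<lambda>x. \<lambda>i\<in>UNIV. f i x + (\<integral>x. r x * f i x \<partial>M))) E"
    by (subst cameron_martin_law[OF r f]) simp
  also have "\<dots> = prob {x \<in> space M. \<forall>i. \<bar>f i x + (\<integral>x. r x * f i x \<partial>M)\<bar> \<le> d}"
    by (subst measure_distr[OF m2 E]) (auto simp: E_def space_PiM intro!: arg_cong2[where f = measure])
  also have "\<dots> \<le> prob {x \<in> space M. \<forall>i. \<bar>f i x\<bar> \<le> d}" by (rule anderson[OF f])
  finally show ?thesis .
qed

section \<open>Centred Gaussian measures on a separable Banach space\<close>

lemma integral_cauchy_schwarz:
  fixes u v :: "'a \<Rightarrow> real"
  assumes m: "u \<in> borel_measurable M" "v \<in> borel_measurable M"
    and i: "integrable M (\<lambda>x. (u x)\<^sup>2)" "integrable M (\<lambda>x. (v x)\<^sup>2)"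
  shows "\<bar>\<integral>x. u x * v x \<partial>M\<bar> \<le> sqrt (\<integral>x. (u x)\<^sup>2 \<partial>M) * sqrt (\<integral>x. (v x)\<^sup>2 \<partial>M)"
proof -
  define U where "U = (\<integral>x. (u x)\<^sup>2 \<partial>M)"
  define V where "V = (\<integral>x. (v x)\<^sup>2 \<partial>M)"
  define W where "W = (\<integral>x. u x * v x \<partial>M)"
  have "0 \<le> (\<integral>x. (t * u x + v x)\<^sup>2 \<partial>M)" for t by simp
  also have "(\<integral>x. (t * u x + v x)\<^sup>2 \<partial>M) = (\<integral>x. t\<^sup>2 * (u x)\<^sup>2 + 2 * t * (u x * v x) + (v x)\<^sup>2 \<partial>M)" for t
    by (simp add: power2_eq_square algebra_simps)
  also have "(\<integral>x. t\<^sup>2 * (u x)\<^sup>2 + 2 * t * (u x * v x) + (v x)\<^sup>2 \<partial>M) = t\<^sup>2 * U + 2 * t * W + V" for t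
    using i integrable_mult_square[OF m i] by (simp add: U_def V_def W_def)
  finally have q: "0 \<le> t\<^sup>2 * U + 2 * t * W + V" for t .
  have U0: "0 \<le> U" by (simp add: U_def)
  have "W\<^sup>2 \<le> U * V"
  proof (cases "U = 0")
    case True
    have "W = 0"
    proof (rule ccontr)
      assume "W \<noteq> 0"
      then show False using q[of "- (V + 1) / (2 * W)"] True by (simp add: field_simps)
    qed
    then show ?thesis using True by simp
  next
    case False
    then have "0 \<le> V - W\<^sup>2 / U" using q[of "- W / U"] by (simp add: power2_eq_square field_simps)
    then show ?thesis using False U0 by (simp add: field_simps)
  qed
  then have "\<bar>W\<bar> \<le> sqrt (U * V)" using real_le_rsqrt[of "\<bar>W\<bar>" "U * V"] by simp
  then show ?thesis by (simp add: U_def V_def W_def real_sqrt_mult)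
qed

lemma gaussian_real_integral_cos:
  assumes P: "gaussian_real P" and mean: "(\<integral>x. x \<partial>P) = 0"
  shows "(\<integral>x. cos (x + b) \<partial>P) = exp (- (\<integral>x. x\<^sup>2 \<partial>P) / 2) * cos b"
  using P unfolding gaussian_real_def
proof (elim disjE exE conjE)
  fix a :: real assume P: "P = return borel a"
  have "(\<integral>x. x \<partial>P) = a" unfolding P by (subst integral_return) auto
  then have "P = return borel 0" using mean P by simp
  then show ?thesis by (simp add: integral_return)
next
  fix a s :: real assume s: "s > 0" and P: "P = density lborel (\<lambda>x. ennreal (normal_density a s x))"
  have "(\<integral>x. x \<partial>P) = (\<integral>x. normal_density a s x * x \<partial>lborel)"
    unfolding P by (subst integral_density) auto
  then have a: "a = 0" using mean integral_normal_moment_nz_1[OF s, of a] by simp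
  have "(\<integral>x. x\<^sup>2 \<partial>P) = (\<integral>x. normal_density a s x * (x - a) ^ (2 * 1) \<partial>lborel)"
    unfolding P a by (subst integral_density) auto
  also have "\<dots> = s\<^sup>2" using s by (subst integral_normal_moment_even) (auto simp: field_simps)
  finally have var: "(\<integral>x. x\<^sup>2 \<partial>P) = s\<^sup>2" .
  have "(\<integral>x. cos (x + b) \<partial>P) = (\<integral>x. normal_density 0 s x * cos (x + b) \<partial>lborel)"
    unfolding P a by (subst integral_density) auto
  also have "\<dots> = (\<integral>x. std_normal_density x * cos (s * x + b) \<partial>lborel)"
  proof -
    have "s * normal_density 0 s (s * x) = std_normal_density x" for x
      using s by (simp add: normal_density_def real_sqrt_mult power_mult_distrib)
    then have e: "\<bar>s\<bar> *\<^sub>R (normal_density 0 s (0 + s * x) * cos ((0 + s * x) + b)) = std_normal_density x * cos (s * x + b)" for x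
      using s by (simp add: mult.assoc[symmetric])
    show ?thesis
      using s by (subst lborel_integral_real_affine[of s _ 0], simp, subst integral_scaleR_right[symmetric], subst e) simp
  qed
  also have "\<dots> = (\<integral>x. cos (s * x + b) \<partial>stdN)" by (subst integral_density) auto
  also have "\<dots> = exp (- s\<^sup>2 / 2) * cos b" by (rule integral_cos_stdN)
  finally show ?thesis by (simp add: var)
qed

text \<open>
  The \<open>L\<^sup>2\<close> closure of the dual space, which contains the functions that represent
  Cameron--Martin vectors.
\<close>

definition functional_closure :: "'a::real_normed_vector measure \<Rightarrow> ('a \<Rightarrow> real) set" where
  "functional_closure M = {g. g \<in> borel_measurable M \<and> integrable M (\<lambda>x. (g x)\<^sup>2) \<and>
     (\<exists>l. (\<forall>n. bounded_linear (l n)) \<and> (\<lambda>n::nat. \<integral>x. (g x - l n x)\<^sup>2 \<partial>M) \<longlonglongrightarrow> 0)}"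

lemma square_integrable_add:
  fixes f g :: "'a \<Rightarrow> real"
  assumes "f \<in> borel_measurable M" "g \<in> borel_measurable M"
    "integrable M (\<lambda>x. (f x)\<^sup>2)" "integrable M (\<lambda>x. (g x)\<^sup>2)"
  shows "integrable M (\<lambda>x. (f x + g x)\<^sup>2)" "integrable M (\<lambda>x. (f x - g x)\<^sup>2)"
  unfolding power2_sum power2_diff using assms integrable_mult_square[OF assms]
  by (auto simp: mult.assoc)

locale centred_gaussian =
  fixes M :: "'a::{banach, second_countable_topology} measure"
  assumes gaussian: "gaussian_measure M" and centred: "centred M"
begin

sublocale prob_space M
  using gaussian by (simp add: gaussian_measure_def)

lemma sets_M: "sets M = sets borel"
  using gaussian by (simp add: gaussian_measure_def)

lemma space_M: "space M = UNIV"
  using sets_eq_imp_space_eq[OF sets_M] by simp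

lemma measurable_M: "f \<in> borel_measurable borel \<Longrightarrow> f \<in> borel_measurable M"
  by (simp add: measurable_cong_sets[OF sets_M refl])

lemma functional_measurable: "bounded_linear l \<Longrightarrow> l \<in> borel_measurable M" for l :: "'a \<Rightarrow> real"
  by (rule gaussian_measure_measurable_functional[OF gaussian])

lemma functional_square_integrable: "bounded_linear l \<Longrightarrow> integrable M (\<lambda>x. (l x)\<^sup>2)" for l :: "'a \<Rightarrow> real"
  by (rule gaussian_measure_integrable_square[OF gaussian])

lemma functional_in_closure: "bounded_linear l \<Longrightarrow> l \<in> functional_closure M"
  by (auto simp: functional_closure_def functional_measurable functional_square_integrable intro!: exI[of _ "\<lambda>_. l"])

lemma functional_integral_cos:
  fixes l :: "'a \<Rightarrow> real"
  assumes l: "bounded_linear l"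
  shows "(\<integral>x. cos (l x + b) \<partial>M) = exp (- (\<integral>x. (l x)\<^sup>2 \<partial>M) / 2) * cos b"
proof -
  have [measurable]: "l \<in> borel_measurable M" by (rule functional_measurable[OF l])
  have "gaussian_real (distr M borel l)" using gaussian l by (simp add: gaussian_measure_def)
  moreover have "(\<integral>x. x \<partial>distr M borel l) = 0"
    using centred l by (subst integral_distr) (auto simp: centred_def)
  ultimately have "(\<integral>x. cos (x + b) \<partial>distr M borel l) = exp (- (\<integral>x. x\<^sup>2 \<partial>distr M borel l) / 2) * cos b"
    by (rule gaussian_real_integral_cos)
  then show ?thesis by (simp add: integral_distr)
qed

text \<open>
  Both sides are continuous in \<open>L\<^sup>2\<close>, and they agree on the functionals.
\<close>

lemma closure_integral_cos:
  assumes g: "g \<in> functional_closure M"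
  shows "(\<integral>x. cos (g x + b) \<partial>M) = exp (- (\<integral>x. (g x)\<^sup>2 \<partial>M) / 2) * cos b"
proof -
  obtain l where gm [measurable]: "g \<in> borel_measurable M" and gi: "integrable M (\<lambda>x. (g x)\<^sup>2)"
    and l: "\<And>n. bounded_linear (l n)" and lim: "(\<lambda>n::nat. \<integral>x. (g x - l n x)\<^sup>2 \<partial>M) \<longlonglongrightarrow> 0"
    using g by (auto simp: functional_closure_def)
  have lm [measurable]: "l n \<in> borel_measurable M" for n by (rule functional_measurable[OF l])
  define e where "e n = sqrt (\<integral>x. (g x - l n x)\<^sup>2 \<partial>M)" for n
  have e: "e \<longlonglongrightarrow> 0" unfolding e_def using tendsto_real_sqrt[OF lim] by simp
  have di: "integrable M (\<lambda>x. (g x - l n x)\<^sup>2)" for n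
    by (intro square_integrable_add gm lm gi functional_square_integrable l)
  have d1: "integrable M (\<lambda>x. \<bar>g x - l n x\<bar>)" "(\<integral>x. \<bar>g x - l n x\<bar> \<partial>M) \<le> e n" for n
    using integral_cauchy_schwarz[of "\<lambda>x. \<bar>g x - l n x\<bar>" M "\<lambda>_. 1"] integrable_mult_square[of "\<lambda>x. \<bar>g x - l n x\<bar>" M "\<lambda>_. 1"] di[of n]
    by (simp_all add: e_def prob_space)
  have ci: "integrable M (\<lambda>x. cos (h x + b))" if [measurable]: "h \<in> borel_measurable M" for h
    by (rule integrable_const_bound[of _ 1]) auto
  have "(\<lambda>n. \<integral>x. cos (l n x + b) \<partial>M) \<longlonglongrightarrow> (\<integral>x. cos (g x + b) \<partial>M)"
  proof (rule Lim_transform_bound[OF _ e, of "\<lambda>n. (\<integral>x. cos (l n x + b) \<partial>M) - (\<integral>x. cos (g x + b) \<partial>M)", THEN LIM_zero_cancel])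
    show "\<forall>\<^sub>F n in sequentially. norm ((\<integral>x. cos (l n x + b) \<partial>M) - (\<integral>x. cos (g x + b) \<partial>M)) \<le> norm (e n)"
    proof (rule always_eventually, rule allI)
      fix n
      have lip: "\<bar>cos s - cos t\<bar> \<le> \<bar>t - s\<bar>" for s t :: real
      proof -
        have "\<bar>cos s - cos t\<bar> = 2 * \<bar>sin ((s + t) / 2)\<bar> * \<bar>sin ((t - s) / 2)\<bar>"
          by (simp add: cos_diff_cos abs_mult)
        also have "\<dots> \<le> 2 * 1 * \<bar>(t - s) / 2\<bar>"
          by (intro mult_mono abs_sin_x_le_abs_x) auto
        finally show ?thesis by simp
      qed
      have "\<bar>(\<integral>x. cos (l n x + b) \<partial>M) - (\<integral>x. cos (g x + b) \<partial>M)\<bar> = \<bar>\<integral>x. cos (l n x + b) - cos (g x + b) \<partial>M\<bar>"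
        by (simp add: ci)
      also have "\<dots> \<le> (\<integral>x. \<bar>cos (l n x + b) - cos (g x + b)\<bar> \<partial>M)" by (rule integral_abs_bound)
      also have "\<dots> \<le> (\<integral>x. \<bar>g x - l n x\<bar> \<partial>M)"
        by (rule integral_mono) (use lip[of "l n x + b" "g x + b" for x] in \<open>auto simp: ci d1\<close>)
      also have "\<dots> \<le> e n" by (rule d1)
      finally show "norm ((\<integral>x. cos (l n x + b) \<partial>M) - (\<integral>x. cos (g x + b) \<partial>M)) \<le> norm (e n)" by simp
    qed
  qed
  moreover have "(\<lambda>n. \<integral>x. (l n x)\<^sup>2 \<partial>M) \<longlonglongrightarrow> (\<integral>x. (g x)\<^sup>2 \<partial>M)"
  proof -
    define G where "G = sqrt (\<integral>x. (g x)\<^sup>2 \<partial>M)"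
    have c: "\<bar>\<integral>x. g x * (g x - l n x) \<partial>M\<bar> \<le> G * e n" for n
      unfolding G_def e_def by (intro integral_cauchy_schwarz gm gi di) simp
    have "(\<lambda>n. \<integral>x. g x * (g x - l n x) \<partial>M) \<longlonglongrightarrow> 0"
      by (rule Lim_null_comparison[OF always_eventually tendsto_mult_right_zero[OF e, of G]]) (use c in simp)
    then have "(\<lambda>n. (\<integral>x. (g x)\<^sup>2 \<partial>M) - 2 * (\<integral>x. g x * (g x - l n x) \<partial>M) + (\<integral>x. (g x - l n x)\<^sup>2 \<partial>M))
        \<longlonglongrightarrow> (\<integral>x. (g x)\<^sup>2 \<partial>M) - 2 * 0 + 0"
      by (intro tendsto_intros lim)
    moreover have "(\<integral>x. (g x)\<^sup>2 \<partial>M) - 2 * (\<integral>x. g x * (g x - l n x) \<partial>M) + (\<integral>x. (g x - l n x)\<^sup>2 \<partial>M) = (\<integral>x. (l n x)\<^sup>2 \<partial>M)" for n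
    proof -
      have "integrable M (\<lambda>x. g x * (g x - l n x))"
        by (intro integrable_mult_square gm gi di) simp
      then have "(\<integral>x. (g x)\<^sup>2 \<partial>M) - 2 * (\<integral>x. g x * (g x - l n x) \<partial>M) + (\<integral>x. (g x - l n x)\<^sup>2 \<partial>M)
          = (\<integral>x. (g x)\<^sup>2 - 2 * (g x * (g x - l n x)) + (g x - l n x)\<^sup>2 \<partial>M)"
        using gi di by simp
      also have "\<dots> = (\<integral>x. (l n x)\<^sup>2 \<partial>M)" by (simp add: power2_eq_square algebra_simps)
      finally show ?thesis .
    qed
    ultimately show ?thesis by simp
  qed
  then have "(\<lambda>n. exp (- (\<integral>x. (l n x)\<^sup>2 \<partial>M) / 2) * cos b) \<longlonglongrightarrow> exp (- (\<integral>x. (g x)\<^sup>2 \<partial>M) / 2) * cos b"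
    by (auto intro!: tendsto_intros)
  ultimately show ?thesis
    unfolding functional_integral_cos[OF l] by (rule LIMSEQ_unique)
qed

sublocale gaussian_space M "functional_closure M"
proof
  show "(\<lambda>_. 0) \<in> functional_closure M" by (rule functional_in_closure) (rule bounded_linear_zero)
next
  fix f g assume "f \<in> functional_closure M" "g \<in> functional_closure M"
  then obtain k l where f: "f \<in> borel_measurable M" "integrable M (\<lambda>x. (f x)\<^sup>2)"
    and k: "\<And>n. bounded_linear (k n)" and limk: "(\<lambda>n::nat. \<integral>x. (f x - k n x)\<^sup>2 \<partial>M) \<longlonglongrightarrow> 0"
    and g: "g \<in> borel_measurable M" "integrable M (\<lambda>x. (g x)\<^sup>2)"
    and l: "\<And>n. bounded_linear (l n)" and liml: "(\<lambda>n::nat. \<integral>x. (g x - l n x)\<^sup>2 \<partial>M) \<longlonglongrightarrow> 0"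
    unfolding functional_closure_def by blast
  have "(\<integral>x. (f x + g x - (k n x + l n x))\<^sup>2 \<partial>M) \<le> 2 * (\<integral>x. (f x - k n x)\<^sup>2 \<partial>M) + 2 * (\<integral>x. (g x - l n x)\<^sup>2 \<partial>M)" for n
  proof -
    note [simp] = square_integrable_add functional_square_integrable functional_measurable k l f g
    have pw: "(f x + g x - (k n x + l n x))\<^sup>2 \<le> 2 * (f x - k n x)\<^sup>2 + 2 * (g x - l n x)\<^sup>2" for x
    proof -
      have "2 * (f x - k n x)\<^sup>2 + 2 * (g x - l n x)\<^sup>2 - (f x + g x - (k n x + l n x))\<^sup>2
          = ((f x - k n x) - (g x - l n x))\<^sup>2" by (simp add: power2_eq_square algebra_simps)
      moreover have "0 \<le> ((f x - k n x) - (g x - l n x))\<^sup>2" by simp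
      ultimately show ?thesis by linarith
    qed
    have "(\<integral>x. (f x + g x - (k n x + l n x))\<^sup>2 \<partial>M) \<le> (\<integral>x. 2 * (f x - k n x)\<^sup>2 + 2 * (g x - l n x)\<^sup>2 \<partial>M)"
    proof (rule integral_mono)
      show "integrable M (\<lambda>x. (f x + g x - (k n x + l n x))\<^sup>2)"
        by (intro square_integrable_add borel_measurable_add functional_measurable functional_square_integrable k l f g)
    qed (simp_all add: pw)
    then show ?thesis by simp
  qed
  note bound = this
  have "(\<lambda>n. 2 * (\<integral>x. (f x - k n x)\<^sup>2 \<partial>M) + 2 * (\<integral>x. (g x - l n x)\<^sup>2 \<partial>M)) \<longlonglongrightarrow> 0"
    using tendsto_add[OF tendsto_mult_right_zero[OF limk, of 2] tendsto_mult_right_zero[OF liml, of 2]] by simp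
  then have lim: "(\<lambda>n. \<integral>x. (f x + g x - (k n x + l n x))\<^sup>2 \<partial>M) \<longlonglongrightarrow> 0"
    by (rule tendsto_sandwich[OF _ _ tendsto_const, rotated 2]) (auto intro!: always_eventually bound)
  have "(\<lambda>x. f x + g x) \<in> borel_measurable M" "integrable M (\<lambda>x. (f x + g x)\<^sup>2)"
    using f g by (auto intro: square_integrable_add)
  moreover have "\<forall>n. bounded_linear (\<lambda>x. k n x + l n x)" using k l by (auto intro: bounded_linear_add)
  ultimately show "(\<lambda>x. f x + g x) \<in> functional_closure M"
    using lim unfolding functional_closure_def by (intro CollectI conjI exI[of _ "\<lambda>n x. k n x + l n x"])
next
  fix f and a :: real assume "f \<in> functional_closure M"
  then obtain k where f: "f \<in> borel_measurable M" "integrable M (\<lambda>x. (f x)\<^sup>2)"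
    and k: "\<And>n. bounded_linear (k n)" and limk: "(\<lambda>n::nat. \<integral>x. (f x - k n x)\<^sup>2 \<partial>M) \<longlonglongrightarrow> 0"
    unfolding functional_closure_def by blast
  have "(\<integral>x. (a * f x - a * k n x)\<^sup>2 \<partial>M) = a\<^sup>2 * (\<integral>x. (f x - k n x)\<^sup>2 \<partial>M)" for n
    by (simp add: right_diff_distrib[symmetric] power_mult_distrib)
  then have "(\<lambda>n. \<integral>x. (a * f x - a * k n x)\<^sup>2 \<partial>M) \<longlonglongrightarrow> 0"
    using tendsto_mult_right_zero[OF limk, of "a\<^sup>2"] by simp
  moreover have "(\<lambda>x. a * f x) \<in> borel_measurable M" "integrable M (\<lambda>x. (a * f x)\<^sup>2)"
    using f by (auto simp: power_mult_distrib)
  moreover have "\<forall>n. bounded_linear (\<lambda>x. a * k n x)" using k by (auto intro: bounded_linear_const_mult)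
  ultimately show "(\<lambda>x. a * f x) \<in> functional_closure M"
    unfolding functional_closure_def by (intro CollectI conjI exI[of _ "\<lambda>n x. a * k n x"])
qed (auto simp: functional_closure_def closure_integral_cos)

lemma cameron_martin_rep_in_closure: "cameron_martin_rep M h g \<Longrightarrow> g \<in> functional_closure M"
  by (simp add: cameron_martin_rep_def functional_closure_def)

text \<open>
  Under \<open>tilted g\<close> a functional \<open>l\<close> is translated by the integral of \<open>l * g\<close>, which is \<open>l h\<close> by
  the choice of \<open>g\<close>.
\<close>

theorem cameron_martin_shift:
  assumes rep: "cameron_martin_rep M h g"
  shows "tilted g = distr M borel (\<lambda>x. x + h)"
proof (rule borel_measure_eqI_functionals)
  note g = cameron_martin_rep_in_closure[OF rep]
  have m: "(\<lambda>x. x + h) \<in> measurable M borel" by (rule measurable_M) simp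
  show "prob_space (tilted g)" by (rule prob_space_tilted[OF g])
  show "prob_space (distr M borel (\<lambda>x. x + h))" by (rule prob_space_distr[OF m])
  show "sets (tilted g) = sets borel" by (simp add: tilted_def sets_M)
  fix l :: "'a \<Rightarrow> real" and b assume l: "bounded_linear l"
  have lb: "l \<in> borel_measurable borel"
    by (intro borel_measurable_continuous_onI linear_continuous_on l)
  have "l h = (\<integral>x. l x * g x \<partial>M)" using rep l by (simp add: cameron_martin_rep_def)
  then show "(\<integral>x. cos (l x + b) \<partial>tilted g) = (\<integral>x. cos (l x + b) \<partial>distr M borel (\<lambda>x. x + h))"
    using lb by (subst integral_cos_tilted[OF g functional_in_closure[OF l]], subst integral_distr[OF m])
      (auto simp: mult.commute linear_add[OF bounded_linear.linear[OF l]])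
qed simp

lemma law_uminus: "distr M borel uminus = M"
proof (rule borel_measure_eqI_functionals)
  have m: "uminus \<in> measurable M borel" by (rule measurable_M) simp
  show "prob_space (distr M borel uminus)" by (rule prob_space_distr[OF m])
  fix l :: "'a \<Rightarrow> real" and b assume l: "bounded_linear l"
  have lb: "l \<in> borel_measurable borel"
    by (intro borel_measurable_continuous_onI linear_continuous_on l)
  have "(\<integral>x. cos (l x + b) \<partial>distr M borel uminus) = (\<integral>x. cos (- l x + b) \<partial>M)"
    using lb by (subst integral_distr[OF m]) (auto simp: linear_neg[OF bounded_linear.linear[OF l]])
  also have "\<dots> = (\<integral>x. cos (l x + b) \<partial>M)"
    using functional_integral_cos[OF bounded_linear_minus[OF l], of b] functional_integral_cos[OF l, of b] by simp
  finally show "(\<integral>x. cos (l x + b) \<partial>distr M borel uminus) = (\<integral>x. cos (l x + b) \<partial>M)" .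
qed (simp_all add: sets_M prob_space_axioms)

lemma measure_ball_uminus: "measure M (ball (- h) \<delta>) = measure M (ball h \<delta>)"
proof -
  have "measure M (ball (- h) \<delta>) = measure (distr M borel uminus) (ball (- h) \<delta>)" by (simp add: law_uminus)
  also have "\<dots> = measure M (uminus -` ball (- h) \<delta> \<inter> space M)"
    by (rule measure_distr) (auto intro: measurable_M)
  also have "uminus -` ball (- h) \<delta> \<inter> space M = ball h \<delta>"
  proof -
    have "dist (- h) (- x) = dist h x" for x by (simp add: dist_norm norm_minus_commute)
    then show ?thesis by (auto simp: space_M)
  qed
  finally show ?thesis .
qed

text \<open>
  The variance of a functional doubles in the difference of two independent copies, and the factor
  \<open>1 / sqrt 2\<close> restores it; a centred Gaussian law is determined by these variances.
\<close>

lemma law_rotation: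
  "distr (M \<Otimes>\<^sub>M M) borel (\<lambda>p. (fst p - snd p) /\<^sub>R sqrt 2) = M"
proof (rule borel_measure_eqI_functionals)
  interpret PP: pair_prob_space M M ..
  have sMM: "sets (M \<Otimes>\<^sub>M M) = sets (borel \<Otimes>\<^sub>M borel)" by (intro sets_pair_measure_cong sets_M)
  have m: "(\<lambda>p. (fst p - snd p) /\<^sub>R sqrt 2) \<in> measurable (M \<Otimes>\<^sub>M M) borel"
    unfolding measurable_cong_sets[OF sMM refl] by measurable
  show "prob_space (distr (M \<Otimes>\<^sub>M M) borel (\<lambda>p. (fst p - snd p) /\<^sub>R sqrt 2))"
    by (rule PP.P.prob_space_distr[OF m])
  fix l :: "'a \<Rightarrow> real" and b assume l: "bounded_linear l"
  have lb [measurable]: "l \<in> borel_measurable borel"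
    by (intro borel_measurable_continuous_onI linear_continuous_on l)
  define k where "k x = (1 / sqrt 2) * l x" for x
  have k: "bounded_linear k" unfolding k_def by (rule bounded_linear_const_mult[OF l])
  have [measurable]: "k \<in> borel_measurable borel"
    by (intro borel_measurable_continuous_onI linear_continuous_on k)
  have kk: "(\<integral>x. (k x)\<^sup>2 \<partial>M) = (\<integral>x. (l x)\<^sup>2 \<partial>M) / 2"
    by (simp add: k_def power_divide)
  have i: "integrable (M \<Otimes>\<^sub>M M) (\<lambda>p. cos (k (fst p) - k (snd p) + b))"
  proof (rule PP.P.integrable_const_bound[of _ 1])
    show "(\<lambda>p. cos (k (fst p) - k (snd p) + b)) \<in> borel_measurable (M \<Otimes>\<^sub>M M)"
      unfolding measurable_cong_sets[OF sMM refl] by measurable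
  qed simp
  have "(\<integral>x. cos (l x + b) \<partial>distr (M \<Otimes>\<^sub>M M) borel (\<lambda>p. (fst p - snd p) /\<^sub>R sqrt 2))
      = (\<integral>p. cos (k (fst p) - k (snd p) + b) \<partial>(M \<Otimes>\<^sub>M M))"
    using lb by (subst integral_distr[OF m])
      (auto simp: k_def linear_scale[OF bounded_linear.linear[OF l]] linear_diff[OF bounded_linear.linear[OF l]] field_simps)
  also have "\<dots> = (\<integral>x. (\<integral>y. cos (k x - k y + b) \<partial>M) \<partial>M)"
    using PP.integral_fst'[OF i] by simp
  also have "\<dots> = (\<integral>x. exp (- (\<integral>x. (k x)\<^sup>2 \<partial>M) / 2) * cos (k x + b) \<partial>M)"
    using functional_integral_cos[OF bounded_linear_minus[OF k], of "k _ + b"] by (simp add: algebra_simps)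
  also have "\<dots> = exp (- (\<integral>x. (l x)\<^sup>2 \<partial>M) / 2) * cos b"
    using functional_integral_cos[OF k, of b] by (simp add: kk mult_exp_exp mult.assoc[symmetric])
  also have "\<dots> = (\<integral>x. cos (l x + b) \<partial>M)" by (rule functional_integral_cos[OF l, symmetric])
  finally show "(\<integral>x. cos (l x + b) \<partial>distr (M \<Otimes>\<^sub>M M) borel (\<lambda>p. (fst p - snd p) /\<^sub>R sqrt 2)) = (\<integral>x. cos (l x + b) \<partial>M)" .
qed (simp_all add: sets_M prob_space_axioms)

text \<open>
  By separability some ball \<open>B(c, \<delta>/2)\<close> has positive measure. Two independent points of it differ
  by less than \<open>\<delta>\<close>, and their difference divided by \<open>sqrt 2\<close> has law \<open>M\<close>.
\<close>

theorem small_ball_pos: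
  assumes \<delta>: "0 < \<delta>"
  shows "0 < measure M (ball 0 \<delta>)"
proof -
  interpret PP: pair_prob_space M M ..
  obtain D :: "'a set" where D: "countable D" "\<And>X. open X \<Longrightarrow> X \<noteq> {} \<Longrightarrow> \<exists>d\<in>D. d \<in> X"
    using countable_dense_setE by blast
  have bs: "ball c r \<in> sets M" for c r by (simp add: sets_M)
  have "\<exists>c\<in>D. emeasure M (ball c (\<delta> / 2)) \<noteq> 0"
  proof (rule ccontr)
    assume "\<not> ?thesis"
    then have "(\<Union>c\<in>D. ball c (\<delta> / 2)) \<in> null_sets M"
      by (intro null_sets_UN' D(1)) (auto simp: null_sets_def bs)
    moreover have "(\<Union>c\<in>D. ball c (\<delta> / 2)) = UNIV"
      using D(2)[of "ball _ (\<delta> / 2)"] \<delta> by (fastforce simp: dist_commute)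
    ultimately show False using emeasure_space_1 by (simp add: space_M null_sets_def)
  qed
  then obtain c where c: "emeasure M (ball c (\<delta> / 2)) \<noteq> 0" by blast
  have sMM: "sets (M \<Otimes>\<^sub>M M) = sets (borel \<Otimes>\<^sub>M borel)" by (intro sets_pair_measure_cong sets_M)
  have m: "(\<lambda>p. (fst p - snd p) /\<^sub>R sqrt 2) \<in> measurable (M \<Otimes>\<^sub>M M) borel"
    unfolding measurable_cong_sets[OF sMM refl] by measurable
  have "0 < emeasure M (ball c (\<delta> / 2)) * emeasure M (ball c (\<delta> / 2))"
    using c by (simp add: ennreal_zero_less_mult_iff zero_less_iff_neq_zero)
  also have "\<dots> = emeasure (M \<Otimes>\<^sub>M M) (ball c (\<delta> / 2) \<times> ball c (\<delta> / 2))"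
    by (simp add: emeasure_pair_measure_Times bs)
  also have "\<dots> \<le> emeasure (M \<Otimes>\<^sub>M M) ((\<lambda>p. (fst p - snd p) /\<^sub>R sqrt 2) -` ball 0 \<delta> \<inter> space (M \<Otimes>\<^sub>M M))"
  proof (rule emeasure_mono)
    show "ball c (\<delta> / 2) \<times> ball c (\<delta> / 2) \<subseteq> (\<lambda>p. (fst p - snd p) /\<^sub>R sqrt 2) -` ball 0 \<delta> \<inter> space (M \<Otimes>\<^sub>M M)"
    proof safe
      fix x y assume "x \<in> ball c (\<delta> / 2)" "y \<in> ball c (\<delta> / 2)"
      then have "dist x y < \<delta>" using dist_triangle_half_r[of c x \<delta> y] by simp
      moreover have "\<delta> * 1 \<le> \<delta> * sqrt 2" using \<delta> by (intro mult_left_mono) auto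
      ultimately have "norm (x - y) < \<delta> * sqrt 2" by (simp only: dist_norm mult_1_right)
      then have "norm ((x - y) /\<^sub>R sqrt 2) < \<delta>"
        unfolding norm_scaleR by (simp add: pos_divide_less_eq divide_inverse[symmetric] mult.commute[of "inverse (sqrt 2)"])
      then show "(x, y) \<in> (\<lambda>p. (fst p - snd p) /\<^sub>R sqrt 2) -` ball 0 \<delta>"
        by simp
    qed (simp_all add: space_pair_measure space_M)
    show "(\<lambda>p. (fst p - snd p) /\<^sub>R sqrt 2) -` ball 0 \<delta> \<inter> space (M \<Otimes>\<^sub>M M) \<in> sets (M \<Otimes>\<^sub>M M)"
      by (rule measurable_sets[OF m]) simp
  qed
  also have "\<dots> = emeasure (distr (M \<Otimes>\<^sub>M M) borel (\<lambda>p. (fst p - snd p) /\<^sub>R sqrt 2)) (ball 0 \<delta>)"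
    by (rule emeasure_distr[OF m, symmetric]) simp
  also have "\<dots> = emeasure M (ball 0 \<delta>)" by (simp add: law_rotation)
  finally show ?thesis by (simp add: emeasure_eq_measure)
qed

lemma measure_tilted:
  assumes r: "r \<in> functional_closure M" and B: "B \<in> sets borel"
  shows "integrable M (\<lambda>x. indicator B x * exp (r x))"
    and "measure (tilted r) B = (\<integral>x. indicator B x * exp (r x) \<partial>M) / exp ((\<integral>x. (r x)\<^sup>2 \<partial>M) / 2)"
proof -
  have [measurable]: "r \<in> borel_measurable M" by (rule meas[OF r])
  have [measurable]: "B \<in> sets M" using B by (simp add: sets_M)
  show "integrable M (\<lambda>x. indicator B x * exp (r x))"
    by (rule Bochner_Integration.integrable_bound[OF integral_exp_cos(1)[OF r zero_mem]]) (auto simp: indicator_def)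
  have "measure (tilted r) B = (\<integral>x. indicator B x \<partial>tilted r)"
    by (simp add: tilted_def space_M)
  also have "\<dots> = (\<integral>x. exp (r x - (\<integral>x. (r x)\<^sup>2 \<partial>M) / 2) *\<^sub>R indicator B x \<partial>M)"
    unfolding tilted_def by (rule integral_density) auto
  also have "\<dots> = (\<integral>x. indicator B x * exp (r x) \<partial>M) / exp ((\<integral>x. (r x)\<^sup>2 \<partial>M) / 2)"
    by (simp add: exp_diff mult.commute)
  finally show "measure (tilted r) B = (\<integral>x. indicator B x * exp (r x) \<partial>M) / exp ((\<integral>x. (r x)\<^sup>2 \<partial>M) / 2)" .
qed

text \<open>
  Closed balls are countable intersections of symmetric slabs, and open balls are increasing
  unions of closed ones.
\<close>

lemma tilted_ball_le:
  assumes r: "r \<in> functional_closure M"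
  shows "measure (tilted r) (ball 0 \<delta>) \<le> measure M (ball 0 \<delta>)"
proof -
  interpret T: prob_space "tilted r" by (rule prob_space_tilted[OF r])
  obtain \<phi> :: "nat \<Rightarrow> 'a \<Rightarrow> real" where \<phi>: "\<And>i. bounded_linear (\<phi> i)"
    and norming: "\<And>x r. norm x \<le> r \<longleftrightarrow> (\<forall>i. \<bar>\<phi> i x\<bar> \<le> r)"
    using norming_sequence_exists by metis
  have cb: "cball 0 d = {x \<in> space M. \<forall>i. \<bar>\<phi> i x\<bar> \<le> d}" for d
    by (auto simp: space_M norming)
  have le: "measure (tilted r) (cball 0 d) \<le> measure M (cball 0 d)" for d
    unfolding cb by (intro tilted_symmetric_slab_le r functional_in_closure \<phi>)
  define d where "d n = \<delta> - 1 / real (Suc n)" for n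
  have inc: "incseq (\<lambda>n. cball (0::'a) (d n))"
  proof (rule incseq_SucI)
    fix n show "cball (0::'a) (d n) \<subseteq> cball 0 (d (Suc n))"
      unfolding d_def by (intro subset_cball diff_left_mono frac_le) auto
  qed
  have un: "(\<Union>n. cball (0::'a) (d n)) = ball 0 \<delta>"
  proof (intro set_eqI iffI)
    fix x :: 'a assume "x \<in> ball 0 \<delta>"
    then have "0 < \<delta> - norm x" by simp
    then obtain n where "1 / real (Suc n) < \<delta> - norm x" using nat_approx_posE by blast
    then show "x \<in> (\<Union>n. cball 0 (d n))" by (auto simp: d_def intro!: exI[of _ n])
  next
    fix x :: 'a assume "x \<in> (\<Union>n. cball 0 (d n))"
    then obtain n where "norm x \<le> \<delta> - 1 / real (Suc n)" by (auto simp: d_def)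
    then have "norm x < \<delta>" using divide_pos_pos[of 1 "real (Suc n)"] by linarith
    then show "x \<in> ball 0 \<delta>" by simp
  qed
  have "(\<lambda>n. measure M (cball 0 (d n))) \<longlonglongrightarrow> measure M (ball 0 \<delta>)"
    unfolding un[symmetric] by (rule finite_Lim_measure_incseq[OF _ inc]) (auto simp: sets_M)
  moreover have "(\<lambda>n. measure (tilted r) (cball 0 (d n))) \<longlonglongrightarrow> measure (tilted r) (ball 0 \<delta>)"
    unfolding un[symmetric] by (rule T.finite_Lim_measure_incseq[OF _ inc]) (auto simp: sets_M tilted_def)
  ultimately show ?thesis using le by (intro LIMSEQ_le) auto
qed

lemma integral_exp_ball_le:
  assumes r: "r \<in> functional_closure M"
  shows "(\<integral>x. indicator (ball 0 \<delta>) x * exp (r x) \<partial>M) \<le> exp ((\<integral>x. (r x)\<^sup>2 \<partial>M) / 2) * measure M (ball 0 \<delta>)"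
  using tilted_ball_le[OF r, of \<delta>] by (simp add: measure_tilted[OF r] pos_divide_le_eq mult.commute)

lemma measure_shifted_ball:
  assumes rep: "cameron_martin_rep M h g"
  shows "measure M (ball h \<delta>) = (\<integral>x. indicator (ball 0 \<delta>) x * exp (g x) \<partial>M) / exp ((\<integral>x. (g x)\<^sup>2 \<partial>M) / 2)"
proof -
  have "measure M (ball h \<delta>) = measure M (ball (- h) \<delta>)" by (rule measure_ball_uminus[symmetric])
  also have "ball (- h) \<delta> = (\<lambda>x. x + h) -` ball 0 \<delta> \<inter> space M"
  proof -
    have "dist (- h) x = norm (x + h)" for x
      using norm_minus_cancel[of "h + x"] by (simp add: dist_norm add.commute)
    then show ?thesis by (auto simp: space_M)
  qed
  also have "measure M \<dots> = measure (distr M borel (\<lambda>x. x + h)) (ball 0 \<delta>)"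
    by (rule measure_distr[symmetric]) (auto intro: measurable_M)
  also have "\<dots> = measure (tilted g) (ball 0 \<delta>)" by (simp add: cameron_martin_shift[OF rep])
  finally show ?thesis by (simp add: measure_tilted[OF cameron_martin_rep_in_closure[OF rep]])
qed

lemma cameron_martin_rep_uminus:
  assumes "cameron_martin_rep M h g"
  shows "cameron_martin_rep M (- h) (\<lambda>x. - g x)"
proof -
  from assms obtain l where l: "\<And>n. bounded_linear (l n)" and lim: "(\<lambda>n::nat. \<integral>x. (g x - l n x)\<^sup>2 \<partial>M) \<longlonglongrightarrow> 0"
    and g: "g \<in> borel_measurable M" "integrable M (\<lambda>x. (g x)\<^sup>2)"
    and f: "\<And>f. bounded_linear f \<Longrightarrow> f h = (\<integral>x. f x * g x \<partial>M)"
    unfolding cameron_martin_rep_def by blast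
  have "(- g x - - l n x)\<^sup>2 = (g x - l n x)\<^sup>2" for x n
    by (simp add: power2_eq_square algebra_simps)
  then have "(\<lambda>n. \<integral>x. (- g x - - l n x)\<^sup>2 \<partial>M) \<longlonglongrightarrow> 0" using lim by (simp only:)
  then show ?thesis
    unfolding cameron_martin_rep_def using g l f
    by (auto simp: linear_neg[OF bounded_linear.linear] intro!: exI[of _ "\<lambda>n x. - l n x"] bounded_linear_minus)
qed

text \<open>
  With \<open>I \<delta>\<close> the integral of \<open>exp g\<close> over \<open>B(0, \<delta>)\<close>, the claim is that \<open>I \<delta>\<close> is asymptotic to
  the measure of that ball. The integral of \<open>exp (- g)\<close> has the same value, since \<open>- g\<close>
  represents \<open>- h\<close> and \<open>B(- h, \<delta>)\<close> has the same measure as \<open>B(h, \<delta>)\<close>.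
\<close>

theorem shifted_ball_ratio_tendsto:
  assumes rep: "cameron_martin_rep M h g"
  shows "((\<lambda>\<delta>. measure M (ball h \<delta>) / measure M (ball 0 \<delta>)) \<longlongrightarrow> exp (- (\<integral>x. (g x)\<^sup>2 \<partial>M) / 2)) (at_right 0)"
proof -
  define N where "N = (\<integral>x. (g x)\<^sup>2 \<partial>M)"
  define I where "I \<delta> = (\<integral>x. indicator (ball 0 \<delta>) x * exp (g x) \<partial>M)" for \<delta>
  note g = cameron_martin_rep_in_closure[OF rep]
  note rep' = cameron_martin_rep_uminus[OF rep]
  note g' = cameron_martin_rep_in_closure[OF rep']
  have Ih: "measure M (ball h \<delta>) = I \<delta> / exp (N / 2)" for \<delta>
    using measure_shifted_ball[OF rep] by (simp add: I_def N_def)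
  have I': "(\<integral>x. indicator (ball 0 \<delta>) x * exp (- g x) \<partial>M) = I \<delta>" for \<delta>
    using measure_shifted_ball[OF rep', of \<delta>] measure_ball_uminus[of h \<delta>] Ih[of \<delta>] by (simp add: N_def)
  have lower: "measure M (ball 0 \<delta>) \<le> I \<delta>" for \<delta>
  proof -
    have i: "integrable M (\<lambda>x. indicator (ball 0 \<delta>) x * exp (g x))" "integrable M (\<lambda>x. indicator (ball 0 \<delta>) x * exp (- g x))"
      using measure_tilted(1)[OF g] measure_tilted(1)[OF g'] by simp_all
    have two: "2 \<le> exp t + exp (- t)" for t :: real
      using exp_ge_add_one_self[of t] exp_ge_add_one_self[of "- t"] by linarith
    have "2 * measure M (ball 0 \<delta>) = (\<integral>x. indicator (ball 0 \<delta>) x * 2 \<partial>M)"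
      by (simp add: space_M)
    also have "\<dots> \<le> (\<integral>x. indicator (ball 0 \<delta>) x * exp (g x) + indicator (ball 0 \<delta>) x * exp (- g x) \<partial>M)"
      unfolding distrib_left[symmetric]
    proof (rule integral_mono)
      show "integrable M (\<lambda>x. indicator (ball 0 \<delta>) x * 2 :: real)" by (simp add: sets_M emeasure_eq_measure)
      show "integrable M (\<lambda>x. indicator (ball 0 \<delta>) x * (exp (g x) + exp (- g x)))"
        unfolding distrib_left using i by simp
      show "indicator (ball 0 \<delta>) x * 2 \<le> indicator (ball 0 \<delta>) x * (exp (g x) + exp (- g x))" for x
        by (rule mult_left_mono[OF two]) simp
    qed
    also have "\<dots> = I \<delta> + I \<delta>" using i I'[of \<delta>] by (simp add: I_def)
    finally show ?thesis by simp
  qed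
  have upper: "eventually (\<lambda>\<delta>. I \<delta> \<le> exp \<epsilon> * measure M (ball 0 \<delta>)) (at_right 0)" if \<epsilon>: "0 < \<epsilon>" for \<epsilon>
  proof -
    obtain l where l: "\<And>n. bounded_linear (l n)" and lim: "(\<lambda>n::nat. \<integral>x. (g x - l n x)\<^sup>2 \<partial>M) \<longlonglongrightarrow> 0"
      using rep by (auto simp: cameron_martin_rep_def)
    obtain n where n: "(\<integral>x. (g x - l n x)\<^sup>2 \<partial>M) < \<epsilon>"
      using order_tendstoD(2)[OF lim \<epsilon>] by (auto simp: eventually_sequentially)
    \<comment> \<open>Written as a combination to match the sums and multiples under which the Gaussian space is closed.\<close>
    define r where "r x = g x + (- 1) * l n x" for x
    have r: "r \<in> functional_closure M"
      unfolding r_def by (intro add_mem scale_mem g functional_in_closure l)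
    obtain K where K: "0 < K" "\<And>x. norm (l n x) \<le> norm x * K"
      using bounded_linear.pos_bounded[OF l] by blast
    have *: "I \<delta> \<le> exp \<epsilon> * measure M (ball 0 \<delta>)" if \<delta>: "0 < \<delta>" "\<delta> < \<epsilon> / (2 * K)" for \<delta>
    proof -
      have "I \<delta> \<le> (\<integral>x. exp (\<epsilon> / 2) * (indicator (ball 0 \<delta>) x * exp (r x)) \<partial>M)"
        unfolding I_def
      proof (rule integral_mono)
        fix x
        show "indicator (ball 0 \<delta>) x * exp (g x) \<le> exp (\<epsilon> / 2) * (indicator (ball 0 \<delta>) x * exp (r x))"
        proof (cases "x \<in> ball 0 \<delta>")
          case True
          have "l n x \<le> norm x * K" using K(2)[of x] by simp
          also have "\<dots> \<le> \<delta> * K" using True K(1) by (intro mult_right_mono) auto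
          also have "\<dots> \<le> \<epsilon> / 2" using \<delta>(2) K(1) by (simp add: field_simps)
          finally have "g x \<le> \<epsilon> / 2 + r x" by (simp add: r_def)
          then show ?thesis using True by (simp add: exp_add[symmetric])
        qed simp
      qed (use measure_tilted(1)[OF g] measure_tilted(1)[OF r] in auto)
      also have "\<dots> = exp (\<epsilon> / 2) * (\<integral>x. indicator (ball 0 \<delta>) x * exp (r x) \<partial>M)" by simp
      also have "\<dots> \<le> exp (\<epsilon> / 2) * (exp ((\<integral>x. (r x)\<^sup>2 \<partial>M) / 2) * measure M (ball 0 \<delta>))"
        by (intro mult_left_mono integral_exp_ball_le r) simp
      also have "\<dots> \<le> exp (\<epsilon> / 2) * (exp (\<epsilon> / 2) * measure M (ball 0 \<delta>))"
        using n by (intro mult_left_mono mult_right_mono) (simp_all add: r_def)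
      also have "\<dots> = exp \<epsilon> * measure M (ball 0 \<delta>)" by (simp add: exp_add[symmetric] mult.assoc[symmetric])
      finally show ?thesis .
    qed
    show ?thesis
      unfolding eventually_at_right_field using * K(1) \<epsilon> by (intro exI[of _ "\<epsilon> / (2 * K)"]) auto
  qed
  have pos: "eventually (\<lambda>\<delta>. 0 < measure M (ball 0 \<delta>)) (at_right 0)"
    unfolding eventually_at_right_field using small_ball_pos by (intro exI[of _ 1]) auto
  have "((\<lambda>\<delta>. I \<delta> / measure M (ball 0 \<delta>)) \<longlongrightarrow> 1) (at_right 0)"
  proof (rule order_tendstoI)
    fix a :: real assume "a < 1"
    show "eventually (\<lambda>\<delta>. a < I \<delta> / measure M (ball 0 \<delta>)) (at_right 0)"
      using pos
    proof eventually_elim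
      case (elim \<delta>)
      then have "1 \<le> I \<delta> / measure M (ball 0 \<delta>)" using lower[of \<delta>] by simp
      then show ?case using \<open>a < 1\<close> by simp
    qed
  next
    fix a :: real assume a: "1 < a"
    then have "eventually (\<lambda>\<delta>. I \<delta> \<le> exp (ln a / 2) * measure M (ball 0 \<delta>)) (at_right 0)"
      by (intro upper) simp
    with pos show "eventually (\<lambda>\<delta>. I \<delta> / measure M (ball 0 \<delta>) < a) (at_right 0)"
    proof eventually_elim
      case (elim \<delta>)
      have "ln a / 2 < ln a" using a by simp
      then have "exp (ln a / 2) < exp (ln a)" by (rule exp_less_mono)
      also have "exp (ln a) = a" using a by simp
      finally have "exp (ln a / 2) < a" .
      then have "exp (ln a / 2) * measure M (ball 0 \<delta>) < a * measure M (ball 0 \<delta>)"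
        by (rule mult_strict_right_mono) (rule elim)
      then have "I \<delta> < a * measure M (ball 0 \<delta>)" using elim(2) by linarith
      then show ?case using elim(1) by (simp add: pos_divide_less_eq)
    qed
  qed
  then have "((\<lambda>\<delta>. (I \<delta> / measure M (ball 0 \<delta>)) / exp (N / 2)) \<longlongrightarrow> 1 / exp (N / 2)) (at_right 0)"
    by (intro tendsto_intros) simp_all
  then show ?thesis by (simp add: Ih N_def exp_minus inverse_eq_divide mult.commute)
qed

end

section \<open>The mixture likelihood\<close>

lemma cinner_commute: "cinner v w = cnj (cinner w v)"
  by (simp add: cinner_def cnj_sum mult.commute)

lemma cinner_self_pos:
  assumes "v \<noteq> 0"
  shows "0 < Re (cinner v v)"
proof -
  obtain i where "v $ i \<noteq> 0" using assms by (auto simp: vec_eq_iff)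
  have "Re (cinner v v) = (\<Sum>i\<in>UNIV. (cmod (v $ i))\<^sup>2)"
    by (simp add: cinner_def cmod_power2) (simp add: power2_eq_square)
  also have "\<dots> > 0"
    by (rule sum_pos2[of _ i]) (use \<open>v $ i \<noteq> 0\<close> in auto)
  finally show ?thesis .
qed

text \<open>
  The matrix \<open>a I + b A\<close>. It yields both the regularised covariance and the path from the identity
  to \<open>A\<close> along which the determinant is followed.
\<close>

definition pencil :: "real \<Rightarrow> real \<Rightarrow> complex ^ 'n ^ 'n \<Rightarrow> complex ^ 'n ^ 'n" where
  "pencil a b A = (\<chi> i j. (if i = j then of_real a else 0) + of_real b * A $ i $ j)"

lemma pencil_mult_vector: "(pencil a b A *v v) $ i = of_real a * v $ i + of_real b * (A *v v) $ i"
proof -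
  have "(pencil a b A *v v) $ i = (\<Sum>j\<in>UNIV. (if i = j then of_real a * v $ j else 0) + of_real b * (A $ i $ j * v $ j))"
    unfolding matrix_vector_mult_def pencil_def by (auto intro!: sum.cong simp: algebra_simps)
  then show ?thesis by (simp add: sum.distrib sum_distrib_left matrix_vector_mult_def)
qed

lemma hermitian_cnj: "hermitian A \<Longrightarrow> cnj (A $ i $ j) = A $ j $ i"
  unfolding hermitian_def by metis

lemma positive_definite_pencil:
  assumes A: "positive_definite A" and ab: "0 \<le> a" "0 \<le> b" "0 < a + b"
  shows "positive_definite (pencil a b A)"
  unfolding positive_definite_def
proof safe
  have "cnj (A $ i $ j) = A $ j $ i" for i j
    using A by (intro hermitian_cnj) (simp add: positive_definite_def)
  then show "hermitian (pencil a b A)" by (auto simp: hermitian_def pencil_def)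
next
  fix v :: "complex ^ 'a" assume v: "v \<noteq> 0"
  have "cinner v (pencil a b A *v v) = of_real a * cinner v v + of_real b * cinner v (A *v v)"
    by (simp add: cinner_def pencil_mult_vector sum.distrib sum_distrib_left algebra_simps)
  moreover have "0 < Re (cinner v v)" "0 < Re (cinner v (A *v v))"
    using cinner_self_pos[OF v] A v by (auto simp: positive_definite_def)
  moreover have "0 < a * s + b * t" if "0 < s" "0 < t" for s t
    using ab that by (cases "a = 0") (auto intro!: add_pos_nonneg)
  ultimately show "0 < Re (cinner v (pencil a b A *v v))" by simp
qed

lemma positive_definite_invertible:
  assumes A: "positive_definite A"
  shows "invertible A"
proof -
  have "v = 0" if "A *v v = 0" for v
  proof (rule ccontr)
    assume "v \<noteq> 0"
    then have "0 < Re (cinner v (A *v v))" using A by (simp add: positive_definite_def)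
    then show False by (simp add: that cinner_def)
  qed
  then have "\<exists>B. B ** A = mat 1" by (simp add: matrix_left_invertible_ker)
  then show ?thesis using matrix_left_right_inverse by (auto simp: invertible_def)
qed

lemma hermitian_det_real:
  assumes A: "hermitian A"
  shows "Im (det A) = 0"
proof -
  have "(\<chi> i j. cnj (A $ i $ j)) = transpose A"
    by (simp add: vec_eq_iff transpose_def hermitian_cnj[OF A])
  then have "det (\<chi> i j. cnj (A $ i $ j)) = det A" by (simp add: det_transpose)
  moreover have "det (\<chi> i j. cnj (A $ i $ j)) = cnj (det A)"
    by (simp add: det_def cnj_sum cnj_prod)
  ultimately have "cnj (det A) = det A" by simp
  then show ?thesis by (simp add: complex_eq_iff)
qed

text \<open>
  Along the segment from the identity to \<open>A\<close> the determinant is real and continuous, and it never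
  vanishes because all matrices on the segment are positive definite. It therefore keeps the sign
  that it has at the identity.
\<close>

lemma positive_definite_det_pos:
  assumes A: "positive_definite A"
  shows "0 < Re (det A)"
proof (rule ccontr)
  assume neg: "\<not> 0 < Re (det A)"
  define f where "f t = Re (det (pencil (1 - t) t A))" for t
  have f0: "f 0 = 1"
  proof -
    have "pencil 1 0 A = mat 1" by (auto simp: pencil_def mat_def vec_eq_iff)
    then show ?thesis by (simp add: f_def)
  qed
  have f1: "f 1 = Re (det A)"
  proof -
    have "pencil 0 1 A = A" by (auto simp: pencil_def vec_eq_iff)
    then show ?thesis by (simp add: f_def)
  qed
  have split_cont: "continuous_on S (\<lambda>t. if P then h t else 0)" if "continuous_on S h"
    for S :: "real set" and h :: "real \<Rightarrow> complex" and P
    using that by (cases P) auto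
  have "continuous_on {0..1} f"
    unfolding f_def det_def pencil_def
    by (auto intro!: continuous_intros split_cont)
  then obtain t where t: "0 \<le> t" "t \<le> 1" "f t = 0"
    using IVT2'[of f 1 0 0] f0 f1 neg by auto
  have pd: "positive_definite (pencil (1 - t) t A)" by (rule positive_definite_pencil[OF A]) (use t in auto)
  have "det (pencil (1 - t) t A) \<noteq> 0"
    using positive_definite_invertible[OF pd] by (simp add: invertible_det_nz)
  moreover have "Im (det (pencil (1 - t) t A)) = 0"
    by (rule hermitian_det_real) (use pd in \<open>simp add: positive_definite_def\<close>)
  ultimately show False using t(3) by (simp add: f_def complex_eq_iff)
qed

text \<open>
  Writing \<open>v = A u\<close>, the quantity is the quadratic form of \<open>A\<close> itself at \<open>u\<close>.
\<close>

lemma weighted_norm_sq_nonneg: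
  assumes A: "positive_definite A"
  shows "0 \<le> weighted_norm_sq A v"
proof -
  define u where "u = matrix_inv A *v v"
  have "A ** matrix_inv A = mat 1"
    using positive_definite_invertible[OF A] someI_ex[of "\<lambda>B. A ** B = mat 1 \<and> B ** A = mat 1"]
    by (simp add: invertible_def matrix_inv_def)
  then have Au: "A *v u = v" by (simp add: u_def matrix_vector_mul_assoc)
  have "weighted_norm_sq A v = Re (cinner u (A *v u))"
    using arg_cong[OF cinner_commute[of v u], of Re] by (simp add: weighted_norm_sq_def u_def[symmetric] Au)
  also have "\<dots> \<ge> 0" using A by (cases "u = 0") (auto simp: positive_definite_def less_imp_le cinner_def)
  finally show ?thesis .
qed

lemma continuous_on_weighted_norm_sq:
  assumes "continuous_on S f"
  shows "continuous_on S (\<lambda>x. weighted_norm_sq A (f x))"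
  unfolding weighted_norm_sq_def cinner_def matrix_vector_mult_def
  using assms by (auto intro!: continuous_intros)

text \<open>
  Each exponent is nonpositive, so the mixture density is at most the sum of its weighted
  normalising constants, which are positive because the determinants are.
\<close>

lemma log_likelihood_continuous_bounded:
  fixes F :: "'a::real_normed_vector \<Rightarrow> complex ^ 'n"
  assumes K: "K > 0" and \<nu>: "\<nu> > 0"
    and w: "\<And>k. k \<in> {1..K} \<Longrightarrow> 0 < w k"
    and \<Sigma>: "\<And>k. k \<in> {1..K} \<Longrightarrow> positive_definite (\<Sigma> k)"
    and F: "continuous_on UNIV F"
  shows "continuous_on UNIV (log_likelihood K w \<zeta> \<Sigma> \<nu> F d)"
    and "\<exists>C. \<forall>m. exp (log_likelihood K w \<zeta> \<Sigma> \<nu> F d m) \<le> C"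
proof -
  define A where "A k = \<Sigma> k + mat (complex_of_real \<nu>)" for k
  have "A k = pencil \<nu> 1 (\<Sigma> k)" for k
    by (auto simp: A_def pencil_def mat_def vec_eq_iff)
  then have A: "positive_definite (A k)" if "k \<in> {1..K}" for k
    using positive_definite_pencil[OF \<Sigma>[OF that], of \<nu> 1] \<nu> by simp
  define c where "c k = w k * (1 / (pi ^ CARD('n) * Re (det (A k))))" for k
  have c: "0 < c k" if "k \<in> {1..K}" for k
    using w[OF that] positive_definite_det_pos[OF A[OF that]] by (simp add: c_def)
  define s where "s m = (\<Sum>k=1..K. c k * exp (- weighted_norm_sq (A k) (d - F m - \<zeta> k)))" for m
  have ll: "log_likelihood K w \<zeta> \<Sigma> \<nu> F d m = ln (s m)" for m
    by (simp add: log_likelihood_def s_def c_def A_def)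
  have s0: "0 < s m" for m
    unfolding s_def by (rule sum_pos) (use K c in auto)
  have "continuous_on UNIV s"
    unfolding s_def by (intro continuous_intros continuous_on_weighted_norm_sq F)
  then show "continuous_on UNIV (log_likelihood K w \<zeta> \<Sigma> \<nu> F d)"
    unfolding ll[abs_def] using s0 by (intro continuous_on_ln) (auto simp: less_imp_neq[symmetric] dest: less_imp_neq)
  have "s m \<le> (\<Sum>k=1..K. c k)" for m
    unfolding s_def
  proof (rule sum_mono)
    fix k assume k: "k \<in> {1..K}"
    have "c k * exp (- weighted_norm_sq (A k) (d - F m - \<zeta> k)) \<le> c k * 1"
      using c[OF k] weighted_norm_sq_nonneg[OF A[OF k]] by (intro mult_left_mono) auto
    then show "c k * exp (- weighted_norm_sq (A k) (d - F m - \<zeta> k)) \<le> c k" by simp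
  qed
  then show "\<exists>C. \<forall>m. exp (log_likelihood K w \<zeta> \<Sigma> \<nu> F d m) \<le> C"
    using s0 by (auto simp: ll intro!: exI[of _ "\<Sum>k=1..K. c k"])
qed

section \<open>Small balls under the posterior\<close>

context centred_gaussian
begin

lemma integral_ball_average_tendsto:
  assumes f: "continuous_on UNIV f" "\<And>x. \<bar>f x\<bar> \<le> C"
    and pos: "eventually (\<lambda>\<delta>. 0 < measure M (ball m \<delta>)) (at_right 0)"
  shows "((\<lambda>\<delta>. (\<integral>x. indicator (ball m \<delta>) x * f x \<partial>M) / measure M (ball m \<delta>)) \<longlongrightarrow> f m) (at_right 0)"
proof (rule tendstoI)
  fix e :: real assume e: "0 < e"
  obtain r where r: "0 < r" "\<And>x. dist x m < r \<Longrightarrow> dist (f x) (f m) < e / 2"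
    using f(1) e unfolding continuous_on_iff by (metis UNIV_I half_gt_zero)
  have fm: "f \<in> borel_measurable M" by (intro measurable_M borel_measurable_continuous_onI f)
  have ball: "ball m \<delta> \<in> sets M" for \<delta> by (simp add: sets_M)
  have i: "integrable M (\<lambda>x. indicator (ball m \<delta>) x * f x)" for \<delta>
  proof (rule integrable_const_bound[of _ C])
    show "(\<lambda>x. indicator (ball m \<delta>) x * f x) \<in> borel_measurable M"
      by (intro borel_measurable_times borel_measurable_indicator ball fm)
  qed (use f(2) order.trans[OF abs_ge_zero f(2)] in \<open>auto simp: indicator_def\<close>)
  have j: "integrable M (\<lambda>x. indicator (ball m \<delta>) x * c)" for \<delta> and c :: real
    using ball by (simp add: emeasure_eq_measure)
  have "eventually (\<lambda>\<delta>. \<delta> < r) (at_right (0::real))"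
    unfolding eventually_at_right_field using r(1) by (intro exI[of _ r]) auto
  with pos show "eventually (\<lambda>\<delta>. dist ((\<integral>x. indicator (ball m \<delta>) x * f x \<partial>M) / measure M (ball m \<delta>)) (f m) < e) (at_right 0)"
  proof eventually_elim
    case (elim \<delta>)
    have "\<bar>(\<integral>x. indicator (ball m \<delta>) x * f x \<partial>M) - f m * measure M (ball m \<delta>)\<bar>
        = \<bar>\<integral>x. indicator (ball m \<delta>) x * f x - indicator (ball m \<delta>) x * f m \<partial>M\<bar>"
      using i j by (simp add: space_M mult.commute)
    also have "\<dots> \<le> (\<integral>x. \<bar>indicator (ball m \<delta>) x * f x - indicator (ball m \<delta>) x * f m\<bar> \<partial>M)"
      by (rule integral_abs_bound)
    also have "\<dots> \<le> (\<integral>x. indicator (ball m \<delta>) x * (e / 2) \<partial>M)"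
    proof (rule integral_mono)
      fix x
      show "\<bar>indicator (ball m \<delta>) x * f x - indicator (ball m \<delta>) x * f m\<bar> \<le> indicator (ball m \<delta>) x * (e / 2)"
        using r(2)[of x] elim(2) by (auto simp: indicator_def dist_real_def dist_commute)
    qed (use i j in auto)
    also have "\<dots> = e / 2 * measure M (ball m \<delta>)" by (simp add: space_M)
    finally have "\<bar>(\<integral>x. indicator (ball m \<delta>) x * f x \<partial>M) / measure M (ball m \<delta>) - f m\<bar> \<le> e / 2"
      using elim(1) by (simp add: abs_le_iff field_simps)
    then show ?case using e by (simp add: dist_real_def)
  qed
qed

text \<open>
  The normalising constant cancels, and each posterior ball is compared with the prior ball of the
  same radius about the origin: a factor \<open>exp (\<Phi> m)\<close> comes from the likelihood, and a factor
  \<open>exp (- \<parallel>g\<parallel>\<^sup>2 / 2)\<close> from the translation.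
\<close>

theorem posterior_ball_ratio_tendsto:
  assumes \<Phi>: "continuous_on UNIV \<Phi>" "\<And>x. exp (\<Phi> x) \<le> C"
    and rep1: "cameron_martin_rep M m1 g1" and rep2: "cameron_martin_rep M m2 g2"
  shows "((\<lambda>\<delta>. measure (posterior M \<Phi>) (ball m1 \<delta>) / measure (posterior M \<Phi>) (ball m2 \<delta>))
    \<longlongrightarrow> exp ((- \<Phi> m2 + 1 / 2 * (\<integral>x. (g2 x)\<^sup>2 \<partial>M)) - (- \<Phi> m1 + 1 / 2 * (\<integral>x. (g1 x)\<^sup>2 \<partial>M)))) (at_right 0)"
proof -
  have \<Phi>m [measurable]: "\<Phi> \<in> borel_measurable M" by (intro measurable_M borel_measurable_continuous_onI \<Phi>)
  have i: "integrable M (\<lambda>x. exp (\<Phi> x))"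
    by (rule integrable_const_bound[of _ C]) (use \<Phi>(2) in auto)
  define Z where "Z = (\<integral>x. exp (\<Phi> x) \<partial>M)"
  have Z: "0 < Z"
  proof -
    have "Z \<noteq> 0"
    proof
      assume "Z = 0"
      then have "AE x in M. exp (\<Phi> x) = 0"
        using integral_nonneg_eq_0_iff_AE[OF i] by (simp add: Z_def)
      then show False by simp
    qed
    moreover have "0 \<le> Z" by (simp add: Z_def)
    ultimately show ?thesis by simp
  qed
  define Q where "Q B = (\<integral>x. indicator B x * exp (\<Phi> x) \<partial>M)" for B
  have post: "measure (posterior M \<Phi>) B = Q B / Z" if "B \<in> sets borel" for B
  proof -
    have [measurable]: "B \<in> sets M" using that by (simp add: sets_M)
    have "measure (posterior M \<Phi>) B = (\<integral>x. indicator B x \<partial>posterior M \<Phi>)"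
      by (simp add: posterior_def space_M)
    also have "\<dots> = (\<integral>x. (1 / Z * exp (\<Phi> x)) *\<^sub>R indicator B x \<partial>M)"
      unfolding posterior_def Z_def[symmetric] by (rule integral_density) (use Z in auto)
    also have "\<dots> = Q B / Z" by (simp add: Q_def mult.commute)
    finally show ?thesis .
  qed
  have pos0: "eventually (\<lambda>\<delta>. 0 < measure M (ball 0 \<delta>)) (at_right 0)"
    unfolding eventually_at_right_field using small_ball_pos by (intro exI[of _ 1]) auto
  have one: "((\<lambda>\<delta>. Q (ball m \<delta>) / measure M (ball 0 \<delta>)) \<longlongrightarrow> exp (\<Phi> m) * exp (- (\<integral>x. (g x)\<^sup>2 \<partial>M) / 2)) (at_right 0)"
    if rep: "cameron_martin_rep M m g" for m g
  proof -
    note lim = shifted_ball_ratio_tendsto[OF rep]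
    have "eventually (\<lambda>\<delta>. 0 < measure M (ball m \<delta>) / measure M (ball 0 \<delta>)) (at_right 0)"
      by (rule order_tendstoD[OF lim]) simp
    then have pos: "eventually (\<lambda>\<delta>. 0 < measure M (ball m \<delta>)) (at_right 0)"
      by eventually_elim (simp add: zero_less_divide_iff measure_nonneg not_less)
    have "((\<lambda>\<delta>. Q (ball m \<delta>) / measure M (ball m \<delta>) * (measure M (ball m \<delta>) / measure M (ball 0 \<delta>)))
        \<longlongrightarrow> exp (\<Phi> m) * exp (- (\<integral>x. (g x)\<^sup>2 \<partial>M) / 2)) (at_right 0)"
      unfolding Q_def
      by (intro tendsto_mult lim integral_ball_average_tendsto[of "\<lambda>x. exp (\<Phi> x)" C] pos continuous_on_exp \<Phi>)
        (use \<Phi>(2) in simp)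
    then show ?thesis
      by (rule Lim_transform_eventually) (use pos in eventually_elim, simp)
  qed
  have "((\<lambda>\<delta>. (Q (ball m1 \<delta>) / measure M (ball 0 \<delta>)) / (Q (ball m2 \<delta>) / measure M (ball 0 \<delta>)))
      \<longlongrightarrow> (exp (\<Phi> m1) * exp (- (\<integral>x. (g1 x)\<^sup>2 \<partial>M) / 2)) / (exp (\<Phi> m2) * exp (- (\<integral>x. (g2 x)\<^sup>2 \<partial>M) / 2))) (at_right 0)"
    by (intro tendsto_divide one rep1 rep2) simp
  moreover have "eventually (\<lambda>\<delta>. (Q (ball m1 \<delta>) / measure M (ball 0 \<delta>)) / (Q (ball m2 \<delta>) / measure M (ball 0 \<delta>))
      = measure (posterior M \<Phi>) (ball m1 \<delta>) / measure (posterior M \<Phi>) (ball m2 \<delta>)) (at_right 0)"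
    using pos0 by eventually_elim (use Z in \<open>simp add: post\<close>)
  ultimately have "((\<lambda>\<delta>. measure (posterior M \<Phi>) (ball m1 \<delta>) / measure (posterior M \<Phi>) (ball m2 \<delta>))
      \<longlongrightarrow> (exp (\<Phi> m1) * exp (- (\<integral>x. (g1 x)\<^sup>2 \<partial>M) / 2)) / (exp (\<Phi> m2) * exp (- (\<integral>x. (g2 x)\<^sup>2 \<partial>M) / 2))) (at_right 0)"
    by (rule Lim_transform_eventually)
  also have "(exp (\<Phi> m1) * exp (- (\<integral>x. (g1 x)\<^sup>2 \<partial>M) / 2)) / (exp (\<Phi> m2) * exp (- (\<integral>x. (g2 x)\<^sup>2 \<partial>M) / 2))
      = exp ((- \<Phi> m2 + 1 / 2 * (\<integral>x. (g2 x)\<^sup>2 \<partial>M)) - (- \<Phi> m1 + 1 / 2 * (\<integral>x. (g1 x)\<^sup>2 \<partial>M)))"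
    by (simp add: exp_add[symmetric] exp_diff[symmetric])
  finally show ?thesis .
qed

end

theorem theorem2p3:
  fixes F :: "'a::{banach, second_countable_topology} \<Rightarrow> complex ^ 'n"
    and K :: nat and \<nu> :: real and w :: "nat \<Rightarrow> real"
    and \<zeta> :: "nat \<Rightarrow> complex ^ 'n" and \<Sigma> :: "nat \<Rightarrow> complex ^ 'n ^ 'n"
    and \<mu>0 \<mu> :: "'a measure" and d :: "complex ^ 'n"
    and \<Phi> :: "'a \<Rightarrow> real" and J :: "'a \<Rightarrow> ereal" and m1 m2 :: 'a
  assumes "K > 0" and "\<nu> > 0"
    and "\<And>k. k \<in> {1..K} \<Longrightarrow> 0 < w k \<and> w k < 1"
    and "(\<Sum>k=1..K. w k) = 1"
    and "\<And>k. k \<in> {1..K} \<Longrightarrow> positive_definite (\<Sigma> k)"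
    and "\<And>m. F differentiable (at m)"
    and "\<And>\<epsilon>::real. \<epsilon> > 0 \<Longrightarrow> \<exists>M C. \<forall>m. norm (F m) \<le> C * exp (\<epsilon> * (norm m)\<^sup>2 + M)"
    and "\<And>\<rho>::real. \<rho> > 0 \<Longrightarrow>
           \<exists>L. \<forall>m. norm m < \<rho> \<longrightarrow> onorm (frechet_derivative F (at m)) \<le> L"
    and "gaussian_measure \<mu>0" and "centred \<mu>0"
    and "\<Phi> = log_likelihood K w \<zeta> \<Sigma> \<nu> F d"
    and "\<mu> = posterior \<mu>0 \<Phi>"
    and "J = onsager_machlup \<mu>0 \<Phi>"
    and "m1 \<in> cameron_martin_space \<mu>0" and "m2 \<in> cameron_martin_space \<mu>0"
  shows "((\<lambda>\<delta>. measure \<mu> (ball m1 \<delta>) / measure \<mu> (ball m2 \<delta>))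
           \<longlongrightarrow> exp (real_of_ereal (J m2 - J m1))) (at_right 0)"
proof -
  interpret centred_gaussian \<mu>0 by standard fact+
  obtain g1 g2 where rep1: "cameron_martin_rep \<mu>0 m1 g1" and rep2: "cameron_martin_rep \<mu>0 m2 g2"
    using assms(14,15) by (auto simp: cameron_martin_space_def)
  have F: "continuous_on UNIV F"
    using assms(6) by (intro continuous_at_imp_continuous_on) (auto intro: differentiable_imp_continuous_within)
  have \<Phi>: "continuous_on UNIV \<Phi>"
    unfolding assms(11) by (rule log_likelihood_continuous_bounded) (use assms(1-3,5) F in auto)
  have "\<exists>C. \<forall>m. exp (\<Phi> m) \<le> C"
    unfolding assms(11) by (rule log_likelihood_continuous_bounded) (use assms(1-3,5) F in auto)
  then obtain C where C: "\<And>m. exp (\<Phi> m) \<le> C" by blast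
  have J1: "J m1 = ereal (- \<Phi> m1 + 1 / 2 * (\<integral>x. (g1 x)\<^sup>2 \<partial>\<mu>0))"
    and J2: "J m2 = ereal (- \<Phi> m2 + 1 / 2 * (\<integral>x. (g2 x)\<^sup>2 \<partial>\<mu>0))"
    using assms(14,15) cameron_martin_norm_eq[OF gaussian rep1] cameron_martin_norm_eq[OF gaussian rep2]
    by (simp_all add: assms(13) onsager_machlup_def)
  show ?thesis
    unfolding assms(12) J1 J2 using posterior_ball_ratio_tendsto[OF \<Phi> C rep1 rep2] by simp
qed

end
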